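(* Let $n\ge1$. For an admissible collection $\mathbf S=(S_1,\dots,S_n)$, the point $p_{\mathbf S}$ is a smooth point of the degenerate flag variety $\mathcal F^a_{n+1}$ if and only if for all $1\le j<i\le n$ the condition $i\in S_j$ implies $j+1\in S_i$. The number of smooth $T$-fixed points of $\mathcal F^a_{n+1}$ is equal to the large Schr\"oder number $r_n$.
   Context: Work over $\mathbb C$. Let $W$ be a vector space with basis $w_1,\dots,w_{n+1}$, and let $pr_k:W\to W$ be the linear map with $pr_kw_k=0$ and $pr_kw_i=w_i$ for $i\ne k$. The degenerate flag variety $\mathcal F^a_{n+1}\subset\prod_{k=1}^n\mathrm{Gr}_k(W)$ consists of collections $(V_1,\dots,V_n)$ with $\dim V_k=k$ and $pr_{k+1}V_k\subset V_{k+1}$ for $1\le k\le n-1$. A collection $\mathbf S=(S_1,\dots,S_n)$ of subsets of $\{1,\dots,n+1\}$ with $\#S_k=k$ is called admissible if $S_k\subset S_{k+1}\cup\{k+1\}$ for $1\le k\le n-1$; put $p_{\mathbf S}=(V_k)_{k=1}^n$ with $V_k=\mathrm{span}(w_i: i\in S_k)$. The torus $T\cong(\mathbb C^* )^{2n}$ acts on $\mathcal F^a_{n+1}$ as follows. Consider the representation $M$ of the quiver $1\to2\to\dots\to n$ with $M_k=W$ at every vertex and $pr_{k+1}$ on the arrow $k\to k+1$; points of $\mathcal F^a_{n+1}$ are subrepresentations of $M$ of dimension vector $(1,\dots,n)$. $M$ is the direct sum of $2n$ indecomposables: $P_k$ ($1\le k\le n$), spanned by the copies of $w_k$ at vertices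 $k,\dots,n$, and $I_k$ ($1\le k\le n$), spanned by the copies of $w_{k+1}$ at vertices $1,\dots,k$. $T$ scales these $2n$ summands independently. Its fixed points in $\mathcal F^a_{n+1}$ are exactly the points $p_{\mathbf S}$ with $\mathbf S$ admissible. The large Schr\"oder number $r_n$ is the number of Schr\"oder paths, i.e. lattice paths from $(0,0)$ to $(n,n)$ with steps $(1,0)$, $(0,1)$, $(1,1)$ which never go above the diagonal $y=x$. *)

theory Defs
  imports
    Complex_Main
    "HOL-Library.FuncSet"
    "HOL-Library.Function_Algebras"
    "HOL-Library.Extended_Nat"
begin

section \<open>Coordinate spaces over the complex numbers\<close>

definition fscale :: "complex \<Rightarrow> ('i \<Rightarrow> complex) \<Rightarrow> 'i \<Rightarrow> complex"
  where "fscale c v = (\<lambda>i. c * v i)"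

interpretation cvs: vector_space fscale
  by unfold_locales (auto simp: fscale_def fun_eq_iff algebra_simps)

text \<open>The space with coordinates indexed by \<open>I\<close>; the remaining coordinates are set to 0.\<close>

definition coord_space :: "'i set \<Rightarrow> ('i \<Rightarrow> complex) set"
  where "coord_space I = {v. \<forall>i. i \<notin> I \<longrightarrow> v i = 0}"


section \<open>Smooth points of affine algebraic sets\<close>

text \<open>Since the ground field is infinite, polynomials in the variables \<open>x i\<close> with \<open>i \<in> I\<close> are
  identified with the functions they define.\<close>

inductive_set poly_funs :: "'i set \<Rightarrow> (('i \<Rightarrow> complex) \<Rightarrow> complex) set" for I :: "'i set"
  where
    const: "(\<lambda>x. c) \<in> poly_funs I"
  | var: "i \<in> I \<Longrightarrow> (\<lambda>x. x i) \<in> poly_funs I"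
  | add: "f \<in> poly_funs I \<Longrightarrow> g \<in> poly_funs I \<Longrightarrow> (\<lambda>x. f x + g x) \<in> poly_funs I"
  | mult: "f \<in> poly_funs I \<Longrightarrow> g \<in> poly_funs I \<Longrightarrow> (\<lambda>x. f x * g x) \<in> poly_funs I"

definition zariski_closed :: "'i set \<Rightarrow> ('i \<Rightarrow> complex) set \<Rightarrow> bool"
  where "zariski_closed I Z \<longleftrightarrow>
    (\<exists>F \<subseteq> poly_funs I. Z = {x \<in> coord_space I. \<forall>f\<in>F. f x = 0})"

definition irreducible_closed :: "'i set \<Rightarrow> ('i \<Rightarrow> complex) set \<Rightarrow> bool"
  where "irreducible_closed I Z \<longleftrightarrow>
    zariski_closed I Z \<and> Z \<noteq> {} \<and>
    (\<forall>A B. zariski_closed I A \<longrightarrow> zariski_closed I B \<longrightarrow> Z = A \<union> B \<longrightarrow> A = Z \<or> B = Z)"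

text \<open>The dimension of \<open>Z\<close> at \<open>p\<close>, i.e. the Krull dimension of the local ring of \<open>Z\<close> at \<open>p\<close>:
  prime ideals of this local ring correspond to the irreducible closed subsets of \<open>Z\<close>
  containing \<open>p\<close>.\<close>

definition local_dim :: "'i set \<Rightarrow> ('i \<Rightarrow> complex) set \<Rightarrow> ('i \<Rightarrow> complex) \<Rightarrow> enat"
  where "local_dim I Z p = Sup {enat d | d. \<exists>C :: nat \<Rightarrow> ('i \<Rightarrow> complex) set.
    (\<forall>i\<le>d. irreducible_closed I (C i) \<and> p \<in> C i \<and> C i \<subseteq> Z) \<and> (\<forall>i<d. C i \<subset> C (Suc i))}"

text \<open>The Zariski tangent space of the (reduced) algebraic set \<open>Z\<close> at \<open>p\<close>: the vectors killed by
  the differentials at \<open>p\<close> of all polynomials vanishing on \<open>Z\<close>.\<close>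

definition tangent_space ::
    "'i set \<Rightarrow> ('i \<Rightarrow> complex) set \<Rightarrow> ('i \<Rightarrow> complex) \<Rightarrow> ('i \<Rightarrow> complex) set"
  where "tangent_space I Z p = {v \<in> coord_space I. \<forall>f \<in> poly_funs I. (\<forall>x\<in>Z. f x = 0) \<longrightarrow>
    ((\<lambda>t::complex. f (p + fscale t v)) has_field_derivative 0) (at 0)}"

text \<open>Used for finite \<open>I\<close> and Zariski closed \<open>Z\<close> only.\<close>

definition affine_smooth_point ::
    "'i set \<Rightarrow> ('i \<Rightarrow> complex) set \<Rightarrow> ('i \<Rightarrow> complex) \<Rightarrow> bool"
  where "affine_smooth_point I Z p \<longleftrightarrow>
    p \<in> Z \<and> enat (cvs.dim (tangent_space I Z p)) = local_dim I Z p"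


section \<open>Products of Grassmannians\<close>

definition W :: "nat \<Rightarrow> (nat \<Rightarrow> complex) set"
  where "W n = coord_space {1..n+1}"

definition w :: "nat \<Rightarrow> nat \<Rightarrow> complex"
  where "w i = (\<lambda>j. if j = i then 1 else 0)"

definition Gr :: "nat \<Rightarrow> nat \<Rightarrow> (nat \<Rightarrow> complex) set set"
  where "Gr n k = {V. cvs.subspace V \<and> V \<subseteq> W n \<and> cvs.dim V = k}"

type_synonym collection = "nat \<Rightarrow> (nat \<Rightarrow> complex) set"

definition prod_Gr :: "nat \<Rightarrow> collection set"
  where "prod_Gr n = (\<Pi>\<^sub>E k\<in>{1..n}. Gr n k)"

definition index_collection :: "nat \<Rightarrow> (nat \<Rightarrow> nat set) \<Rightarrow> bool"
  where "index_collection n S \<longleftrightarrow> (\<forall>k\<in>{1..n}. S k \<subseteq> {1..n+1} \<and> card (S k) = k)"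

text \<open>The standard affine charts. Given \<open>S\<close>, the collections such that each \<open>V k\<close> is
  complementary to the span of the \<open>w i\<close> with \<open>i \<notin> S k\<close> form an open subset; there \<open>V k\<close> is the
  graph of a linear map from the span of the \<open>w j\<close> with \<open>j \<in> S k\<close> to that complement, whose
  matrix entries \<open>x (k, i, j)\<close> are the coordinates.\<close>

definition chart_index :: "nat \<Rightarrow> (nat \<Rightarrow> nat set) \<Rightarrow> (nat \<times> nat \<times> nat) set"
  where "chart_index n S =
    {(k, i, j) | k i j. k \<in> {1..n} \<and> i \<in> {1..n+1} - S k \<and> j \<in> S k}"

definition chart :: "nat \<Rightarrow> (nat \<Rightarrow> nat set) \<Rightarrow> (nat \<times> nat \<times> nat \<Rightarrow> complex) \<Rightarrow> collection"
  where "chart n S x = (\<lambda>k\<in>{1..n}. cvs.span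
    ((\<lambda>j. w j + (\<Sum>i\<in>{1..n+1} - S k. fscale (x (k, i, j)) (w i))) ` S k))"

definition smooth_point :: "nat \<Rightarrow> collection set \<Rightarrow> collection \<Rightarrow> bool"
  where "smooth_point n X V \<longleftrightarrow>
    (\<exists>S. index_collection n S \<and>
      (\<exists>x \<in> coord_space (chart_index n S). chart n S x = V \<and>
        affine_smooth_point (chart_index n S)
          {y \<in> coord_space (chart_index n S). chart n S y \<in> X} x))"


section \<open>The degenerate flag variety and its torus action\<close>

definition pr :: "nat \<Rightarrow> (nat \<Rightarrow> complex) \<Rightarrow> nat \<Rightarrow> complex"
  where "pr k v = v(k := 0)"

definition degenerate_flag_variety :: "nat \<Rightarrow> collection set"
  where "degenerate_flag_variety n =
    {V \<in> prod_Gr n. \<forall>k. 1 \<le> k \<and> k < n \<longrightarrow> pr (k+1) ` V k \<subseteq> V (k+1)}"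

definition admissible :: "nat \<Rightarrow> (nat \<Rightarrow> nat set) \<Rightarrow> bool"
  where "admissible n S \<longleftrightarrow>
    index_collection n S \<and> (\<forall>k. 1 \<le> k \<and> k < n \<longrightarrow> S k \<subseteq> S (k+1) \<union> {k+1})"

definition coord_point :: "nat \<Rightarrow> (nat \<Rightarrow> nat set) \<Rightarrow> collection"
  where "coord_point n S = (\<lambda>k\<in>{1..n}. cvs.span (w ` S k))"

text \<open>A torus element is a pair \<open>(a, b)\<close>, where \<open>a k\<close> scales the summand \<open>P k\<close> and \<open>b k\<close> scales
  the summand \<open>I k\<close>. The copy of \<open>w i\<close> at vertex \<open>k\<close> lies in \<open>P i\<close> if \<open>i \<le> k\<close>, and in \<open>I (i-1)\<close>
  otherwise.\<close>

definition torus :: "nat \<Rightarrow> ((nat \<Rightarrow> complex) \<times> (nat \<Rightarrow> complex)) set"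
  where "torus n = {(a, b). \<forall>k\<in>{1..n}. a k \<noteq> 0 \<and> b k \<noteq> 0}"

definition torus_act ::
    "nat \<Rightarrow> (nat \<Rightarrow> complex) \<times> (nat \<Rightarrow> complex) \<Rightarrow> collection \<Rightarrow> collection"
  where "torus_act n t V = (\<lambda>k\<in>{1..n}.
    (\<lambda>v i. (if i \<le> k then fst t i else snd t (i - 1)) * v i) ` V k)"

definition torus_fixed :: "nat \<Rightarrow> collection \<Rightarrow> bool"
  where "torus_fixed n V \<longleftrightarrow> (\<forall>t \<in> torus n. torus_act n t V = V)"


section \<open>Large Schroeder numbers\<close>

text \<open>A path starting at the origin is encoded by its list of steps; it stays weakly below the
  diagonal iff all its vertices, the end points of its initial segments, do.\<close>

definition end_point :: "(nat \<times> nat) list \<Rightarrow> nat \<times> nat"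
  where "end_point p = (sum_list (map fst p), sum_list (map snd p))"

definition schroeder_paths :: "nat \<Rightarrow> (nat \<times> nat) list set"
  where "schroeder_paths n = {p. set p \<subseteq> {(1, 0), (0, 1), (1, 1)} \<and> end_point p = (n, n) \<and>
    (\<forall>m \<le> length p. snd (end_point (take m p)) \<le> fst (end_point (take m p)))}"

definition large_schroeder :: "nat \<Rightarrow> nat"
  where "large_schroeder n = card (schroeder_paths n)"

end

theory Submission
  imports Defs "HOL-Computational_Algebra.Polynomial" "Jordan_Normal_Form.Determinant"
begin

text \<open>
  In the only standard chart containing \<open>p\<^sub>S\<close> the degenerate flag variety is cut out by equations
  with a linear and a quadratic part. The kernel of the linear parts is spanned by the directions of
  lines that lie in the variety, so it is the tangent space of the reduced variety; the
  number of coordinates minus the number of equations is \<open>N = n(n+1)/2\<close>, and the linear parts are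
  independent exactly under the stated condition. In that case the equations, which are homogeneous
  for a positive grading, exhibit the chart as a graph over an affine space of dimension \<open>N\<close>.
  The local dimension is at most \<open>N\<close> everywhere, because the variety is a finite union of cells
  parametrised by at most \<open>N\<close> coordinates, while a chain of irreducible closed sets of length \<open>d\<close>
  yields \<open>d\<close> algebraically independent functions.

  For the number of fixed points one splits the collections by the element missing in \<open>S\<^sub>n\<close>, which
  gives the recursion that Schroeder paths satisfy by decomposing at the first return to the diagonal.
\<close>

section \<open>Polynomial functions\<close>

text \<open>The condition records which linear parts degenerate. In the equation
  \<open>(k, i, j)\<close> the projection deletes the entry at vertex \<open>k\<close> if
  \<open>i = k + 1\<close>, and the one at vertex \<open>k + 1\<close> if \<open>j = k + 1\<close>.
  An equation not matched with a coordinate by \<open>eq_of\<close> has \<open>i = k + 1\<close>,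
  and either both entries are deleted or the surviving one is already forced to 0 by equations
  further right. A violation of the condition at \<open>i\<close>, \<open>j\<close> is exactly such
  an equation \<open>(j, j + 1, i)\<close>. The singular case needs only the upper bound N, because
  the tangent space is too large; the smooth case also needs a chain of length N. Dependent
  equations give no upper bound, so it is taken from cells that do not refer to the point. Its
  delicate point is that a vertex may contribute two new pivots: this happens when the arrow into it
  kills the pivot \<open>k\<close>, and it is paid for by the small number of parameters that
  \<open>k\<close> had where it entered. Since the grading is positive, the equations can be solved
  by a finite recursion, and the graph is polynomial and global.\<close>

lemma poly_funs_cong:
  "f \<in> poly_funs I \<Longrightarrow> (\<And>i. i \<in> I \<Longrightarrow> x i = y i) \<Longrightarrow> f x = f y"
  by (induction rule: poly_funs.induct) auto

lemma poly_funs_compose: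
  "f \<in> poly_funs I \<Longrightarrow> (\<And>i. i \<in> I \<Longrightarrow> (\<lambda>x. h x i) \<in> poly_funs K) \<Longrightarrow> (\<lambda>x. f (h x)) \<in> poly_funs K"
  by (induction rule: poly_funs.induct) (auto intro: poly_funs.intros)

lemma poly_funs_sum:
  "(\<And>a. a \<in> A \<Longrightarrow> f a \<in> poly_funs I) \<Longrightarrow> (\<lambda>x. \<Sum>a\<in>A. f a x) \<in> poly_funs I"
  by (induction A rule: infinite_finite_induct) (auto intro: poly_funs.intros)

lemma poly_funs_prod:
  "(\<And>a. a \<in> A \<Longrightarrow> f a \<in> poly_funs I) \<Longrightarrow> (\<lambda>x. \<Prod>a\<in>A. f a x) \<in> poly_funs I"
  by (induction A rule: infinite_finite_induct) (auto intro: poly_funs.intros)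

lemma poly_funs_diff:
  assumes "f \<in> poly_funs I" "g \<in> poly_funs I"
  shows "(\<lambda>x. f x - g x) \<in> poly_funs I"
proof -
  have "(\<lambda>x. f x + (-1) * g x) \<in> poly_funs I"
    using assms by (intro poly_funs.intros)
  then show ?thesis by simp
qed

lemma poly_funs_line:
  "f \<in> poly_funs I \<Longrightarrow> \<exists>q. \<forall>t. f (\<lambda>i. x i + t * v i) = poly q t"
proof (induction rule: poly_funs.induct)
  case (const c)
  show ?case by (rule exI[of _ "[:c:]"]) simp
next
  case (var i)
  show ?case by (rule exI[of _ "[:x i, v i:]"]) simp
next
  case (add f g)
  then show ?case by (metis poly_add)
next
  case (mult f g)
  then show ?case by (metis poly_mult)
qed

text \<open>Join a point where \<open>f\<close> is nonzero to one where \<open>g\<close> is nonzero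
  by a line. On it both become nonzero univariate polynomials, and their product vanishes at every
  parameter.\<close>

lemma poly_funs_mult_eq_0:
  assumes f: "f \<in> poly_funs I" and g: "g \<in> poly_funs I"
    and fg: "\<And>x. x \<in> coord_space I \<Longrightarrow> f x * g x = 0"
  shows "(\<forall>x\<in>coord_space I. f x = 0) \<or> (\<forall>x\<in>coord_space I. g x = 0)"
proof (rule ccontr)
  assume "\<not> ?thesis"
  then obtain x y where x: "x \<in> coord_space I" "f x \<noteq> 0" and y: "y \<in> coord_space I" "g y \<noteq> 0"
    by blast
  define v where "v = (\<lambda>i. y i - x i)"
  obtain q where q: "\<forall>t. f (\<lambda>i. x i + t * v i) = poly q t" using poly_funs_line[OF f] by blast
  obtain r where r: "\<forall>t. g (\<lambda>i. x i + t * v i) = poly r t" using poly_funs_line[OF g] by blast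
  have "poly (q * r) t = 0" for t
  proof -
    have "(\<lambda>i. x i + t * v i) \<in> coord_space I" using x y by (auto simp: coord_space_def v_def)
    from fg[OF this] show ?thesis using q r by simp
  qed
  then have "q * r = 0" using poly_all_0_iff_0 by blast
  then have "q = 0 \<or> r = 0" by simp
  moreover have "poly q 0 \<noteq> 0" using spec[OF q, of 0] x by simp
  moreover have "poly r 1 \<noteq> 0" using spec[OF r, of 1] y by (simp add: v_def)
  ultimately show False by auto
qed

text \<open>\<open>tangent_space\<close> only mentions derivatives along single lines. The linear
  dependence on the direction, provided here, is what makes it a subspace.\<close>

lemma poly_funs_derivative:
  "f \<in> poly_funs I \<Longrightarrow> \<exists>D. (\<forall>v. ((\<lambda>t::complex. f (p + fscale t v)) has_field_derivative D v) (at 0)) \<and>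
     (\<forall>u v. D (u + v) = D u + D v) \<and> (\<forall>c v. D (fscale c v) = c * D v)"
proof (induction rule: poly_funs.induct)
  case (const c)
  show ?case by (rule exI[of _ "\<lambda>_. 0"]) auto
next
  case (var i)
  have "((\<lambda>t::complex. (p + fscale t v) i) has_field_derivative v i) (at 0)" for v
    unfolding plus_fun_def fscale_def by (auto intro!: derivative_eq_intros)
  then show ?case by (intro exI[of _ "\<lambda>v. v i"]) (auto simp: fscale_def)
next
  case (add f g)
  then obtain D E where D: "\<forall>v. ((\<lambda>t::complex. f (p + fscale t v)) has_field_derivative D v) (at 0)"
     "\<forall>u v. D (u + v) = D u + D v" "\<forall>c v. D (fscale c v) = c * D v"
    and E: "\<forall>v. ((\<lambda>t::complex. g (p + fscale t v)) has_field_derivative E v) (at 0)"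
     "\<forall>u v. E (u + v) = E u + E v" "\<forall>c v. E (fscale c v) = c * E v" by blast
  have "((\<lambda>t::complex. f (p + fscale t v) + g (p + fscale t v)) has_field_derivative D v + E v) (at 0)" for v
    using D E by (auto intro!: derivative_eq_intros)
  moreover have "\<forall>u v. D (u + v) + E (u + v) = D u + E u + (D v + E v)"
    "\<forall>c v. D (fscale c v) + E (fscale c v) = c * (D v + E v)" using D E by (simp_all add: algebra_simps)
  ultimately show ?case by (intro exI[of _ "\<lambda>v. D v + E v"]) blast
next
  case (mult f g)
  then obtain D E where D: "\<forall>v. ((\<lambda>t::complex. f (p + fscale t v)) has_field_derivative D v) (at 0)"
     "\<forall>u v. D (u + v) = D u + D v" "\<forall>c v. D (fscale c v) = c * D v"
    and E: "\<forall>v. ((\<lambda>t::complex. g (p + fscale t v)) has_field_derivative E v) (at 0)"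
     "\<forall>u v. E (u + v) = E u + E v" "\<forall>c v. E (fscale c v) = c * E v" by blast
  have [simp]: "p + fscale 0 v = p" for v by (simp add: fscale_def fun_eq_iff)
  have "((\<lambda>t::complex. f (p + fscale t v) * g (p + fscale t v)) has_field_derivative D v * g p + E v * f p) (at 0)" for v
    using DERIV_mult[OF spec[OF D(1), of v] spec[OF E(1), of v]] by simp
  moreover have "\<forall>u v. D (u + v) * g p + E (u + v) * f p = D u * g p + E u * f p + (D v * g p + E v * f p)"
    "\<forall>c v. D (fscale c v) * g p + E (fscale c v) * f p = c * (D v * g p + E v * f p)"
    using D E by (simp_all add: algebra_simps)
  ultimately show ?case by (intro exI[of _ "\<lambda>v. D v * g p + E v * f p"]) blast
qed

lemma subspace_tangent_space: "cvs.subspace (tangent_space I Z p)"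
proof -
  have *: "((\<lambda>t::complex. f (p + fscale t (u + v))) has_field_derivative 0) (at 0) \<and>
     ((\<lambda>t::complex. f (p + fscale t (fscale c u))) has_field_derivative 0) (at 0)"
    if f: "f \<in> poly_funs I" "((\<lambda>t::complex. f (p + fscale t u)) has_field_derivative 0) (at 0)"
     "((\<lambda>t::complex. f (p + fscale t v)) has_field_derivative 0) (at 0)" for f u v c
  proof -
    obtain D where D: "\<forall>v. ((\<lambda>t::complex. f (p + fscale t v)) has_field_derivative D v) (at 0)"
     "\<forall>u v. D (u + v) = D u + D v" "\<forall>c v. D (fscale c v) = c * D v"
      using poly_funs_derivative[OF f(1)] by blast
    have "D u = 0" "D v = 0" using f D(1) DERIV_unique by blast+
    then have "D (u + v) = 0" "D (fscale c u) = 0" using D by auto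
    then show ?thesis using D(1) by metis
  qed
  have z: "((\<lambda>t::complex. f (p + fscale t 0)) has_field_derivative 0) (at 0)" for f
    by (simp add: fscale_def)
  show ?thesis
    unfolding cvs.subspace_def tangent_space_def
    using * z by (auto simp: coord_space_def fscale_def zero_fun_def plus_fun_def)
qed

section \<open>Lengths of chains of irreducible closed sets\<close>

text \<open>The degree is bounded in each variable separately: the exponents then form a box with
  \<open>(D + 1) ^ card I\<close> elements, and multiplication adds the bounds.\<close>

definition box_monos :: "'i set \<Rightarrow> nat \<Rightarrow> (('i \<Rightarrow> complex) \<Rightarrow> complex) set"
  where "box_monos I D = (\<lambda>\<alpha> x. \<Prod>i\<in>I. x i ^ \<alpha> i) ` (I \<rightarrow>\<^sub>E {..D})"

abbreviation box_polys :: "'i set \<Rightarrow> nat \<Rightarrow> (('i \<Rightarrow> complex) \<Rightarrow> complex) set"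
  where "box_polys I D \<equiv> cvs.span (box_monos I D)"

lemma finite_box_monos: "finite I \<Longrightarrow> finite (box_monos I D)"
  by (simp add: box_monos_def finite_PiE)

lemma card_box_monos_le: "finite I \<Longrightarrow> card (box_monos I D) \<le> (D + 1) ^ card I"
  unfolding box_monos_def
  by (rule order.trans[OF card_image_le]) (auto simp: finite_PiE card_PiE)

lemma box_monos_mono: "D \<le> D' \<Longrightarrow> box_monos I D \<subseteq> box_monos I D'"
  unfolding box_monos_def by (intro image_mono PiE_mono) auto

lemma box_polys_mono: "D \<le> D' \<Longrightarrow> box_polys I D \<subseteq> box_polys I D'"
  by (intro cvs.span_mono box_monos_mono)

lemma box_monos_mult:
  assumes "m \<in> box_monos I a" "m' \<in> box_monos I b"
  shows "(\<lambda>x. m x * m' x) \<in> box_monos I (a + b)"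
proof -
  obtain \<alpha> \<beta> where \<alpha>: "\<alpha> \<in> I \<rightarrow>\<^sub>E {..a}" "m = (\<lambda>x. \<Prod>i\<in>I. x i ^ \<alpha> i)"
    and \<beta>: "\<beta> \<in> I \<rightarrow>\<^sub>E {..b}" "m' = (\<lambda>x. \<Prod>i\<in>I. x i ^ \<beta> i)"
    using assms by (auto simp: box_monos_def)
  have "(\<lambda>x. m x * m' x) = (\<lambda>x. \<Prod>i\<in>I. x i ^ (restrict (\<lambda>i. \<alpha> i + \<beta> i) I) i)"
    using \<alpha> \<beta> by (auto simp: fun_eq_iff power_add prod.distrib)
  moreover have "restrict (\<lambda>i. \<alpha> i + \<beta> i) I \<in> I \<rightarrow>\<^sub>E {..a+b}"
    using \<alpha>(1) \<beta>(1) by (auto simp: PiE_iff add_mono)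
  ultimately show ?thesis unfolding box_monos_def by blast
qed

lemma span_linear_image:
  assumes "u \<in> cvs.span A" and L: "\<And>u v. L (u + v) = L u + L v" "\<And>c u. L (fscale c u) = fscale c (L u)"
    and A: "\<And>a. a \<in> A \<Longrightarrow> L a \<in> cvs.span B"
  shows "L u \<in> cvs.span B"
  using assms(1)
proof (rule cvs.span_induct)
  have "L 0 = 0" using L(2)[of 0 0] by (simp add: fscale_def zero_fun_def)
  then show "cvs.subspace {u. L u \<in> cvs.span B}"
    unfolding cvs.subspace_def using L cvs.span_zero cvs.span_add cvs.span_scale by auto
qed (use A in auto)

lemma box_polys_mult:
  assumes f: "f \<in> box_polys I a" and g: "g \<in> box_polys I b"
  shows "(\<lambda>x. f x * g x) \<in> box_polys I (a + b)"
proof -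
  have "(\<lambda>x. f x * m x) \<in> box_polys I (a + b)" if "m \<in> box_monos I b" for m
    by (rule span_linear_image[where L = "\<lambda>f x. f x * m x", OF f])
      (use that in \<open>auto simp: fun_eq_iff fscale_def algebra_simps intro: cvs.span_base box_monos_mult\<close>)
  then show ?thesis
    by (intro span_linear_image[where L = "\<lambda>g x. f x * g x", OF g])
      (auto simp: fun_eq_iff fscale_def algebra_simps)
qed

lemma one_in_box_polys: "(\<lambda>x. 1) \<in> box_polys I D"
proof -
  have "(\<lambda>x. 1) \<in> box_monos I D"
    unfolding box_monos_def by (rule image_eqI[where x = "restrict (\<lambda>_. 0) I"]) auto
  then show ?thesis by (rule cvs.span_base)
qed

lemma box_polys_power: "f \<in> box_polys I e \<Longrightarrow> (\<lambda>x. f x ^ k) \<in> box_polys I (e * k)"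
  by (induction k) (auto intro: one_in_box_polys box_polys_mult)

lemma box_polys_prod:
  "finite T \<Longrightarrow> (\<And>t. t \<in> T \<Longrightarrow> f t \<in> box_polys I (e t)) \<Longrightarrow> (\<lambda>x. \<Prod>t\<in>T. f t x) \<in> box_polys I (\<Sum>t\<in>T. e t)"
  by (induction T rule: finite_induct) (auto intro: one_in_box_polys box_polys_mult)

lemma poly_funs_in_box_polys:
  assumes "finite I"
  shows "f \<in> poly_funs I \<Longrightarrow> \<exists>e. f \<in> box_polys I e"
proof (induction rule: poly_funs.induct)
  case (const c)
  have "(\<lambda>x. c) \<in> box_polys I 0"
    using cvs.span_scale[OF one_in_box_polys[of I 0], of c] by (simp add: fscale_def)
  then show ?case by blast
next
  case (var i)
  have "(\<Prod>j\<in>I. x j ^ restrict (\<lambda>j. if j = i then 1 else 0) I j) = x i" for x :: "'a \<Rightarrow> complex"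
  proof -
    have "(\<Prod>j\<in>I. x j ^ restrict (\<lambda>j. if j = i then 1 else 0) I j) = (\<Prod>j\<in>I. if j = i then x j else 1)"
      by (intro prod.cong) auto
    then show ?thesis using assms var by simp
  qed
  moreover have "restrict (\<lambda>j. if j = i then 1 else 0::nat) I \<in> I \<rightarrow>\<^sub>E {..1}" by auto
  ultimately have "(\<lambda>x. x i) \<in> box_monos I 1"
    unfolding box_monos_def by (auto simp: image_iff fun_eq_iff intro!: bexI[of _ "restrict (\<lambda>j. if j = i then 1 else 0::nat) I"])
  then show ?case using cvs.span_base by blast
next
  case (add f g)
  then obtain a b where "f \<in> box_polys I a" "g \<in> box_polys I b" by blast
  then have "f \<in> box_polys I (max a b)" "g \<in> box_polys I (max a b)"
    using box_polys_mono[of a "max a b" I] box_polys_mono[of b "max a b" I] by auto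
  from cvs.span_add[OF this] show ?case by (auto simp: plus_fun_def)
next
  case (mult f g)
  then show ?case using box_polys_mult by blast
qed

section \<open>Algebraic independence along a chain of irreducible closed sets\<close>

lemma sum_PiE_insert:
  assumes "a \<notin> S"
  shows "(\<Sum>\<alpha>\<in>PiE (insert a S) T. h \<alpha>) = (\<Sum>m\<in>T a. \<Sum>\<beta>\<in>PiE S T. h (\<beta>(a := m)))"
proof -
  have "(\<Sum>\<alpha>\<in>PiE (insert a S) T. h \<alpha>) = (\<Sum>(m, \<beta>)\<in>T a \<times> PiE S T. h (\<beta>(a := m)))"
    unfolding PiE_insert_eq using assms
    by (subst sum.reindex[OF inj_combinator]) (auto simp: case_prod_unfold)
  then show ?thesis by (simp add: sum.cartesian_product)
qed

lemma zariski_closed_subset_zeros: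
  assumes "zariski_closed I Z" "f \<in> poly_funs I"
  shows "zariski_closed I {x\<in>Z. f x = 0}"
proof -
  obtain F where F: "F \<subseteq> poly_funs I" "Z = {x \<in> coord_space I. \<forall>f\<in>F. f x = 0}"
    using assms by (auto simp: zariski_closed_def)
  show ?thesis unfolding zariski_closed_def
    by (rule exI[of _ "insert f F"]) (use F assms in auto)
qed

lemma irreducible_closed_mult_eq_0:
  assumes C: "irreducible_closed I C" and f: "f \<in> poly_funs I" and g: "g \<in> poly_funs I"
    and fg: "\<And>x. x \<in> C \<Longrightarrow> f x * g x = 0"
  shows "(\<forall>x\<in>C. f x = 0) \<or> (\<forall>x\<in>C. g x = 0)"
proof -
  have "C = {x\<in>C. f x = 0} \<union> {x\<in>C. g x = 0}" using fg by auto
  moreover have "zariski_closed I {x\<in>C. f x = 0}" "zariski_closed I {x\<in>C. g x = 0}"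
    using C f g by (auto simp: irreducible_closed_def intro: zariski_closed_subset_zeros)
  ultimately have "{x\<in>C. f x = 0} = C \<or> {x\<in>C. g x = 0} = C"
    using C unfolding irreducible_closed_def by blast
  then show ?thesis by blast
qed

abbreviation exps :: "nat \<Rightarrow> nat \<Rightarrow> (nat \<Rightarrow> nat) set"
  where "exps d D \<equiv> {..<d} \<rightarrow>\<^sub>E {..D}"

text \<open>Each step of the chain supplies one new function, namely some \<open>g\<close> that
  vanishes on \<open>C d\<close> but not on all of \<open>C (Suc d)\<close>. Independence is stated
  through coefficients of exponent boxes, the form in which it is counted later.\<close>

lemma chain_algebraically_independent:
  assumes "\<forall>i\<le>d. irreducible_closed I (C i)" "\<forall>i<d. C i \<subset> C (Suc i)"
  shows "\<exists>f. (\<forall>s<d. f s \<in> poly_funs I) \<and>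
    (\<forall>D c. (\<forall>x\<in>C d. (\<Sum>\<alpha>\<in>exps d D. c \<alpha> * (\<Prod>s<d. f s x ^ \<alpha> s)) = 0) \<longrightarrow> (\<forall>\<alpha>\<in>exps d D. c \<alpha> = 0))"
  using assms
proof (induction d)
  case 0
  have "C 0 \<noteq> {}" using 0 by (auto simp: irreducible_closed_def)
  then show ?case by auto
next
  case (Suc d)
  have "\<forall>i\<le>d. irreducible_closed I (C i)" "\<forall>i<d. C i \<subset> C (Suc i)" using Suc.prems by auto
  from Suc.IH[OF this] obtain f where f: "\<forall>s<d. f s \<in> poly_funs I"
    and ind: "\<And>D c \<alpha>. (\<forall>x\<in>C d. (\<Sum>\<alpha>\<in>exps d D. c \<alpha> * (\<Prod>s<d. f s x ^ \<alpha> s)) = 0) \<Longrightarrow> \<alpha>\<in>exps d D \<Longrightarrow> c \<alpha> = 0"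
    by blast
  have irr: "irreducible_closed I (C (Suc d))" and sub: "C d \<subset> C (Suc d)" and cl: "zariski_closed I (C d)"
    using Suc.prems by (auto simp: irreducible_closed_def)
  obtain F where F: "F \<subseteq> poly_funs I" "C d = {x \<in> coord_space I. \<forall>f\<in>F. f x = 0}"
    using cl by (auto simp: zariski_closed_def)
  have "C (Suc d) \<subseteq> coord_space I"
    using irr by (auto simp: irreducible_closed_def zariski_closed_def)
  then obtain y where y: "y \<in> C (Suc d)" "y \<notin> C d" "y \<in> coord_space I" using sub by blast
  then obtain g where "g \<in> F" "g y \<noteq> 0" using F by blast
  then have g: "g \<in> poly_funs I" "\<forall>x\<in>C d. g x = 0" "\<not> (\<forall>x\<in>C (Suc d). g x = 0)"
    using y F by auto
  \<comment> \<open>Sort a relation by powers of \<open>g\<close>. On \<open>C d\<close> only the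
    part without \<open>g\<close> survives, so its coefficients vanish by the induction hypothesis.
    The rest is divisible by \<open>g\<close>, and irreducibility of \<open>C (Suc d)\<close> allows
    cancelling this factor; repeat with one power less.\<close>
  have key: "\<forall>m<M. \<forall>\<alpha>\<in>exps d D. c m \<alpha> = 0"
    if "\<forall>x\<in>C (Suc d). (\<Sum>m<M. g x ^ m * (\<Sum>\<alpha>\<in>exps d D. c m \<alpha> * (\<Prod>s<d. f s x ^ \<alpha> s))) = 0" for M D c
    using that
  proof (induction M arbitrary: c)
    case (Suc M)
    let ?h = "\<lambda>m x. \<Sum>\<alpha>\<in>exps d D. c m \<alpha> * (\<Prod>s<d. f s x ^ \<alpha> s)"
    let ?r = "\<lambda>x. \<Sum>m<M. g x ^ m * ?h (Suc m) x"
    have eq: "(\<Sum>m<Suc M. g x ^ m * ?h m x) = ?h 0 x + g x * ?r x" for x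
      by (simp add: sum.lessThan_Suc_shift sum_distrib_left algebra_simps del: sum.lessThan_Suc)
    have "\<forall>x\<in>C d. ?h 0 x = 0"
    proof
      fix x assume "x \<in> C d"
      then have "?h 0 x + g x * ?r x = 0" using Suc.prems sub eq by auto
      then show "?h 0 x = 0" using g \<open>x \<in> C d\<close> by simp
    qed
    then have c0: "\<forall>\<alpha>\<in>exps d D. c 0 \<alpha> = 0" using ind[where c = "c 0" and D = D] by blast
    then have "?h 0 x = 0" for x by simp
    then have "g x * ?r x = 0" if "x \<in> C (Suc d)" for x using Suc.prems eq that by auto
    moreover have "?r \<in> poly_funs I"
    proof -
      have 1: "(\<lambda>x. g x ^ m) \<in> poly_funs I" for m
        by (induction m) (auto intro: poly_funs.intros g)
      have 2: "(\<lambda>x. f s x ^ m) \<in> poly_funs I" if "s < d" for m s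
        using f that by (induction m) (auto intro: poly_funs.intros)
      show ?thesis
        by (intro poly_funs_sum poly_funs.mult poly_funs_prod poly_funs.const 1 2) auto
    qed
    ultimately have "\<forall>x\<in>C (Suc d). ?r x = 0"
      using irreducible_closed_mult_eq_0[OF irr g(1)] g(3) by blast
    from Suc.IH[of "\<lambda>m. c (Suc m)", OF this] c0 show ?case
      by (auto simp: less_Suc_eq_0_disj)
  qed simp
  let ?f = "f(d := g)"
  have "c \<alpha> = 0" if 0: "\<forall>x\<in>C (Suc d). (\<Sum>\<alpha>\<in>exps (Suc d) D. c \<alpha> * (\<Prod>s<Suc d. ?f s x ^ \<alpha> s)) = 0"
    and \<alpha>: "\<alpha> \<in> exps (Suc d) D" for D c \<alpha>
  proof -
    have eq: "(\<Sum>\<alpha>\<in>exps (Suc d) D. c \<alpha> * (\<Prod>s<Suc d. ?f s x ^ \<alpha> s)) =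
       (\<Sum>m<Suc D. g x ^ m * (\<Sum>\<alpha>\<in>exps d D. c (\<alpha>(d := m)) * (\<Prod>s<d. f s x ^ \<alpha> s)))" for x
    proof -
      have "(\<Sum>\<alpha>\<in>exps (Suc d) D. c \<alpha> * (\<Prod>s<Suc d. ?f s x ^ \<alpha> s)) =
         (\<Sum>m\<le>D. \<Sum>\<beta>\<in>exps d D. c (\<beta>(d := m)) * (\<Prod>s<Suc d. ?f s x ^ (\<beta>(d := m)) s))"
        unfolding lessThan_Suc by (subst sum_PiE_insert) auto
      also have "\<dots> = (\<Sum>m\<le>D. \<Sum>\<beta>\<in>exps d D. g x ^ m * (c (\<beta>(d := m)) * (\<Prod>s<d. f s x ^ \<beta> s)))"
        by (intro sum.cong refl) simp
      finally show ?thesis by (simp add: sum_distrib_left lessThan_Suc_atMost)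
    qed
    have *: "\<forall>m<Suc D. \<forall>\<beta>\<in>exps d D. c (\<beta>(d := m)) = 0"
      by (rule key[where c = "\<lambda>m \<beta>. c (\<beta>(d := m))"]) (use 0[unfolded eq] in blast)
    have "\<alpha> \<in> (\<lambda>(y, g). g(d := y)) ` ({..D} \<times> exps d D)"
      using \<alpha> unfolding lessThan_Suc PiE_insert_eq by simp
    then show ?thesis using * by (auto simp: le_imp_less_Suc)
  qed
  moreover have "\<forall>s<Suc d. ?f s \<in> poly_funs I" using f g by (auto simp: less_Suc_eq)
  ultimately show ?case by blast
qed

lemma sum_fun_apply: "(\<Sum>a\<in>A. f a) x = (\<Sum>a\<in>A. f a x)"
  for f :: "'a \<Rightarrow> 'b \<Rightarrow> 'c::comm_monoid_add"
  by (induction A rule: infinite_finite_induct) auto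

lemma cvs_independent_family:
  assumes fin: "finite P" and c: "\<And>c. (\<Sum>a\<in>P. fscale (c a) (\<psi> a)) = 0 \<Longrightarrow> (\<forall>a\<in>P. c a = 0)"
  shows "inj_on \<psi> P \<and> cvs.independent (\<psi> ` P)"
proof
  show inj: "inj_on \<psi> P"
  proof (rule inj_onI, rule ccontr)
    fix a b assume ab: "a \<in> P" "b \<in> P" "\<psi> a = \<psi> b" "a \<noteq> b"
    let ?c = "\<lambda>x. if x = a then 1 else if x = b then - 1 else 0"
    have "(\<Sum>x\<in>P. fscale (?c x) (\<psi> x)) = (\<Sum>x\<in>{a,b}. fscale (?c x) (\<psi> x))"
      by (rule sum.mono_neutral_right) (use ab fin in \<open>auto simp: fscale_def fun_eq_iff\<close>)
    also have "\<dots> = 0" using ab by (simp add: fscale_def fun_eq_iff)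
    finally show False using c[of ?c] ab by auto
  qed
  show "cvs.independent (\<psi> ` P)"
  proof
    assume "cvs.dependent (\<psi> ` P)"
    then obtain u where u: "\<exists>v\<in>\<psi> ` P. u v \<noteq> 0" "(\<Sum>v\<in>\<psi> ` P. fscale (u v) v) = 0"
      using cvs.dependent_finite[of "\<psi> ` P"] fin by auto
    then have "(\<Sum>a\<in>P. fscale (u (\<psi> a)) (\<psi> a)) = 0" using inj by (simp add: sum.reindex)
    from c[OF this] u(1) show False by auto
  qed
qed

text \<open>The parametrisation is a relation between \<open>x\<close> and \<open>z\<close> instead
  of a map, since it makes sense only where all denominators are nonzero. \<open>F\<close> and
  \<open>G\<close> are chosen uniformly in \<open>x\<close> and \<open>z\<close>.\<close>

lemma rational_pullback:
  assumes gh: "\<And>i. i \<in> I \<Longrightarrow> g i \<in> poly_funs E \<and> h i \<in> poly_funs E"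
    and f: "f \<in> poly_funs I"
  shows "\<exists>F\<in>poly_funs E. \<exists>G\<in>poly_funs E. \<forall>x z. (\<forall>i\<in>I. g i z \<noteq> 0 \<and> x i = h i z / g i z) \<longrightarrow>
    G z \<noteq> 0 \<and> f x = F z / G z"
  using f
proof (induction rule: poly_funs.induct)
  case (const c)
  show ?case by (rule bexI[of _ "\<lambda>_. c"], rule bexI[of _ "\<lambda>_. 1"]) (auto intro: poly_funs.intros)
next
  case (var i)
  show ?case by (rule bexI[where x = "h i"], rule bexI[where x = "g i"]) (use var gh in auto)
next
  case (add f1 f2)
  then obtain F1 G1 F2 G2 where *: "F1 \<in> poly_funs E" "G1 \<in> poly_funs E" "F2 \<in> poly_funs E" "G2 \<in> poly_funs E"
    "\<forall>x z. (\<forall>i\<in>I. g i z \<noteq> 0 \<and> x i = h i z / g i z) \<longrightarrow> G1 z \<noteq> 0 \<and> f1 x = F1 z / G1 z"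
    "\<forall>x z. (\<forall>i\<in>I. g i z \<noteq> 0 \<and> x i = h i z / g i z) \<longrightarrow> G2 z \<noteq> 0 \<and> f2 x = F2 z / G2 z"
    by blast
  show ?case
  proof (rule bexI[where x = "\<lambda>z. F1 z * G2 z + F2 z * G1 z"], rule bexI[where x = "\<lambda>z. G1 z * G2 z"], intro allI impI)
    fix x z assume "\<forall>i\<in>I. g i z \<noteq> 0 \<and> x i = h i z / g i z"
    with * have "G1 z \<noteq> 0" "f1 x = F1 z / G1 z" "G2 z \<noteq> 0" "f2 x = F2 z / G2 z" by blast+
    then show "G1 z * G2 z \<noteq> 0 \<and> f1 x + f2 x = (F1 z * G2 z + F2 z * G1 z) / (G1 z * G2 z)"
      by (simp add: field_simps)
  qed (use * in \<open>auto intro!: poly_funs.intros\<close>)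
next
  case (mult f1 f2)
  then obtain F1 G1 F2 G2 where *: "F1 \<in> poly_funs E" "G1 \<in> poly_funs E" "F2 \<in> poly_funs E" "G2 \<in> poly_funs E"
    "\<forall>x z. (\<forall>i\<in>I. g i z \<noteq> 0 \<and> x i = h i z / g i z) \<longrightarrow> G1 z \<noteq> 0 \<and> f1 x = F1 z / G1 z"
    "\<forall>x z. (\<forall>i\<in>I. g i z \<noteq> 0 \<and> x i = h i z / g i z) \<longrightarrow> G2 z \<noteq> 0 \<and> f2 x = F2 z / G2 z"
    by blast
  show ?case
  proof (rule bexI[where x = "\<lambda>z. F1 z * F2 z"], rule bexI[where x = "\<lambda>z. G1 z * G2 z"], intro allI impI)
    fix x z assume "\<forall>i\<in>I. g i z \<noteq> 0 \<and> x i = h i z / g i z"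
    with * have "G1 z \<noteq> 0" "f1 x = F1 z / G1 z" "G2 z \<noteq> 0" "f2 x = F2 z / G2 z" by blast+
    then show "G1 z * G2 z \<noteq> 0 \<and> f1 x * f2 x = (F1 z * F2 z) / (G1 z * G2 z)"
      by (simp add: field_simps)
  qed (use * in \<open>auto intro!: poly_funs.intros\<close>)
qed

lemma exponent_le_of_power_bound:
  fixes d N a M :: nat
  assumes "\<And>D. (D + 1) ^ d \<le> a * (M * D + 1) ^ N"
  shows "d \<le> N"
proof (rule ccontr)
  assume "\<not> d \<le> N"
  then have dN: "Suc N \<le> d" by simp
  \<comment> \<open>With this value the factor \<open>a * (M + 1) ^ N\<close> on the right becomes
    \<open>D\<close> itself, so a power \<open>N + 1\<close> or higher on the left would give
    \<open>D + 1 \<le> D\<close>.\<close>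
  define D where "D = a * (M + 1) ^ N"
  have "(D + 1) ^ Suc N \<le> (D + 1) ^ d" using dN by (intro power_increasing) auto
  also have "\<dots> \<le> a * (M * D + 1) ^ N" by (rule assms)
  also have "\<dots> \<le> a * ((M + 1) * (D + 1)) ^ N"
    by (intro mult_left_mono power_mono) (auto simp: algebra_simps)
  also have "\<dots> = D * (D + 1) ^ N" by (simp only: D_def power_mult_distrib mult.assoc)
  finally have "(D + 1) * (D + 1) ^ N \<le> D * (D + 1) ^ N" by simp
  then show False by simp
qed

text \<open>The \<open>(D + 1) ^ d\<close> monomials in the \<open>d\<close> independent functions
  are linearly independent on \<open>C d\<close>. Pulled back to the parameters and cleared of
  denominators, they become polynomials in at most \<open>N\<close> variables, with exponents linear
  in \<open>D\<close>, on each of \<open>card A\<close> pieces. The space of those has dimension at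
  most of order \<open>D ^ N\<close>, which forces \<open>d \<le> N\<close>.\<close>

lemma chain_length_le:
  fixes E :: "'s \<Rightarrow> 'e set" and I :: "'i set"
  assumes A: "finite A" and E: "\<And>s. s \<in> A \<Longrightarrow> finite (E s) \<and> card (E s) \<le> N"
    and gh: "\<And>s i. s \<in> A \<Longrightarrow> i \<in> I \<Longrightarrow> g s i \<in> poly_funs (E s) \<and> h s i \<in> poly_funs (E s)"
    and Z: "\<And>x. x \<in> Z \<Longrightarrow> \<exists>s\<in>A. \<exists>z. \<forall>i\<in>I. g s i z \<noteq> 0 \<and> x i = h s i z / g s i z"
    and C: "\<forall>i\<le>d. irreducible_closed I (C i)" "\<forall>i<d. C i \<subset> C (Suc i)" "C d \<subseteq> Z"
  shows "d \<le> N"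
proof -
  obtain f where f: "\<And>t. t < d \<Longrightarrow> f t \<in> poly_funs I"
    and ind: "\<And>D c \<alpha>. (\<forall>x\<in>C d. (\<Sum>\<alpha>\<in>exps d D. c \<alpha> * (\<Prod>s<d. f s x ^ \<alpha> s)) = 0) \<Longrightarrow> \<alpha>\<in>exps d D \<Longrightarrow> c \<alpha> = 0"
    using chain_algebraically_independent[OF C(1,2)] by blast
  define P where "P s t F G \<longleftrightarrow> F \<in> poly_funs (E s) \<and> G \<in> poly_funs (E s) \<and>
    (\<forall>x z. (\<forall>i\<in>I. g s i z \<noteq> 0 \<and> x i = h s i z / g s i z) \<longrightarrow> G z \<noteq> 0 \<and> f t x = F z / G z)" for s t F G
  have "\<exists>F G. P s t F G" if "s \<in> A" "t < d" for s t
    using rational_pullback[of I "g s" "E s" "h s" "f t", OF gh[OF that(1)] f[OF that(2)]] unfolding P_def by blast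
  then obtain F G where P: "\<And>s t. s \<in> A \<Longrightarrow> t < d \<Longrightarrow> P s t (F s t) (G s t)" by metis
  have FG: "F s t \<in> poly_funs (E s)" "G s t \<in> poly_funs (E s)"
    "\<And>x z. \<forall>i\<in>I. g s i z \<noteq> 0 \<and> x i = h s i z / g s i z \<Longrightarrow> G s t z \<noteq> 0 \<and> f t x = F s t z / G s t z"
    if "s \<in> A" "t < d" for s t
    using P[OF that] unfolding P_def by blast+
  \<comment> \<open>\<open>H s\<close> is a common denominator of the pullbacks of all
    \<open>f t\<close> to the piece \<open>s\<close>, and \<open>K s t\<close> is the matching
    numerator.\<close>
  define H where "H s z = (\<Prod>t<d. G s t z)" for s z
  define K where "K s t z = F s t z * (\<Prod>u\<in>{..<d} - {t}. G s u z)" for s t z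
  have H: "H s \<in> poly_funs (E s)" if "s \<in> A" for s
    unfolding H_def using FG(2)[OF that] by (intro poly_funs_prod) auto
  have K: "K s t \<in> poly_funs (E s)" if "s \<in> A" "t < d" for s t
    unfolding K_def using FG(1,2)[OF that(1)] that(2) by (intro poly_funs_prod poly_funs.mult) auto
  have KH: "H s z \<noteq> 0 \<and> f t x * H s z = K s t z" 
    if "s \<in> A" "t < d" "\<forall>i\<in>I. g s i z \<noteq> 0 \<and> x i = h s i z / g s i z" for s t x z
  proof -
    have "H s z = G s t z * (\<Prod>u\<in>{..<d} - {t}. G s u z)"
      unfolding H_def using that by (subst prod.remove[of _ t]) auto
    then show ?thesis using FG(3)[OF that(1) _ that(3)] that(2)
      by (auto simp: K_def H_def)
  qed
  have Hnz: "H s z \<noteq> 0" if "s \<in> A" "\<forall>i\<in>I. g s i z \<noteq> 0 \<and> x i = h s i z / g s i z" for s x z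
    unfolding H_def using FG(3)[OF that(1) _ that(2)] by auto
  have "\<exists>e. \<forall>s\<in>A. H s \<in> box_polys (E s) e \<and> (\<forall>t<d. K s t \<in> box_polys (E s) e)"
  proof -
    have "\<forall>s\<in>A. \<exists>e. H s \<in> box_polys (E s) e" using E H poly_funs_in_box_polys by blast
    then obtain a where a: "\<And>s. s \<in> A \<Longrightarrow> H s \<in> box_polys (E s) (a s)" by metis
    have "\<forall>s\<in>A. \<forall>t\<in>{..<d}. \<exists>e. K s t \<in> box_polys (E s) e" using E K poly_funs_in_box_polys by blast
    then obtain b where b: "\<And>s t. s \<in> A \<Longrightarrow> t < d \<Longrightarrow> K s t \<in> box_polys (E s) (b s t)"
      by (metis lessThan_iff)
    let ?e = "(\<Sum>s\<in>A. a s) + (\<Sum>s\<in>A. \<Sum>t<d. b s t)"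
    have "H s \<in> box_polys (E s) ?e" if "s \<in> A" for s
      using box_polys_mono[of "a s" ?e "E s"] a[OF that] member_le_sum[OF that _ A, of a] by auto
    moreover have "K s t \<in> box_polys (E s) ?e" if "s \<in> A" "t < d" for s t
    proof -
      have "b s t \<le> (\<Sum>t<d. b s t)" using that by (intro member_le_sum) auto
      also have "\<dots> \<le> (\<Sum>s\<in>A. \<Sum>t<d. b s t)" using that A by (intro member_le_sum) auto
      finally show ?thesis using box_polys_mono[of "b s t" ?e "E s"] b[OF that] by auto
    qed
    ultimately show ?thesis by blast
  qed
  then obtain e where eH: "\<And>s. s \<in> A \<Longrightarrow> H s \<in> box_polys (E s) e"
    and eK: "\<And>s t. s \<in> A \<Longrightarrow> t < d \<Longrightarrow> K s t \<in> box_polys (E s) e" by blast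
  have "(D + 1) ^ d \<le> card A * (e * d * D + 1) ^ N" for D
  proof -
    \<comment> \<open>The pullback of a monomial times \<open>H s z ^ (d * D)\<close>. This power is
      large enough for all exponents of the box and does not depend on them, so a linear relation
      between these functions is one between the monomials.\<close>
    define \<phi> where "\<phi> \<alpha> s z = (\<Prod>t<d. K s t z ^ \<alpha> t) * H s z ^ (d * D - (\<Sum>t<d. \<alpha> t))" for \<alpha> s z
    \<comment> \<open>No single piece need determine a relation on \<open>C d\<close>. The pieces
      are therefore combined into one function on the disjoint union of the parameter spaces, which
      costs only the factor \<open>card A\<close>.\<close>
    define \<psi> where "\<psi> \<alpha> = (\<lambda>(s, z). if s \<in> A then \<phi> \<alpha> s z else 0)" for \<alpha>
    define ext where "ext s m = (\<lambda>(s', z :: 'e \<Rightarrow> complex). if s' = s then m z else 0 :: complex)" for s :: 's and m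
    define B where "B = (\<Union>s\<in>A. ext s ` box_monos (E s) (e * d * D))"
    have le: "(\<Sum>t<d. \<alpha> t) \<le> d * D" if "\<alpha> \<in> exps d D" for \<alpha>
      using sum_bounded_above[of "{..<d}" \<alpha> D] that by (auto simp: PiE_iff)
    have \<phi>: "\<phi> \<alpha> s \<in> box_polys (E s) (e * d * D)" if "\<alpha> \<in> exps d D" "s \<in> A" for \<alpha> s
    proof -
      have "\<phi> \<alpha> s \<in> box_polys (E s) ((\<Sum>t<d. e * \<alpha> t) + e * (d * D - (\<Sum>t<d. \<alpha> t)))"
        unfolding \<phi>_def using that
        by (intro box_polys_mult box_polys_prod box_polys_power eH eK) auto
      moreover have "(\<Sum>t<d. e * \<alpha> t) + e * (d * D - (\<Sum>t<d. \<alpha> t)) = e * d * D"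
        using le[OF that(1)] by (simp flip: sum_distrib_left distrib_left)
      ultimately show ?thesis by simp
    qed
    have ext: "ext s m \<in> cvs.span B" if s: "s \<in> A" and m: "m \<in> box_polys (E s) (e * d * D)" for s m
      by (rule span_linear_image[where L = "ext s", OF m])
        (use s in \<open>auto simp: ext_def fscale_def fun_eq_iff B_def intro!: cvs.span_base\<close>)
    have \<psi>: "\<psi> \<alpha> \<in> cvs.span B" if "\<alpha> \<in> exps d D" for \<alpha>
    proof -
      have "\<psi> \<alpha> = (\<Sum>s\<in>A. ext s (\<phi> \<alpha> s))"
        by (auto simp: fun_eq_iff \<psi>_def ext_def sum_fun_apply A)
      then show ?thesis using ext \<phi> that by (auto intro: cvs.span_sum)
    qed
    have finB: "finite B" unfolding B_def using A E finite_box_monos by blast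
    have "card B \<le> (\<Sum>s\<in>A. card (ext s ` box_monos (E s) (e * d * D)))"
      unfolding B_def by (rule card_UN_le[OF A])
    also have "\<dots> \<le> (\<Sum>s\<in>A. (e * d * D + 1) ^ N)"
    proof (rule sum_mono)
      fix s assume s: "s \<in> A"
      have "card (ext s ` box_monos (E s) (e * d * D)) \<le> card (box_monos (E s) (e * d * D))"
        using E[OF s] by (intro card_image_le finite_box_monos) auto
      also have "\<dots> \<le> (e * d * D + 1) ^ card (E s)" using E[OF s] by (intro card_box_monos_le) auto
      also have "\<dots> \<le> (e * d * D + 1) ^ N" using E[OF s] by (intro power_increasing) auto
      finally show "card (ext s ` box_monos (E s) (e * d * D)) \<le> (e * d * D + 1) ^ N" .
    qed
    finally have cardB: "card B \<le> card A * (e * d * D + 1) ^ N" by simp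
    have "inj_on \<psi> (exps d D) \<and> cvs.independent (\<psi> ` exps d D)"
    proof (rule cvs_independent_family)
      fix c assume 0: "(\<Sum>\<alpha>\<in>exps d D. fscale (c \<alpha>) (\<psi> \<alpha>)) = 0"
      have "(\<Sum>\<alpha>\<in>exps d D. c \<alpha> * (\<Prod>t<d. f t x ^ \<alpha> t)) = 0" if x: "x \<in> C d" for x
      proof -
        obtain s z where sz: "s \<in> A" "\<forall>i\<in>I. g s i z \<noteq> 0 \<and> x i = h s i z / g s i z"
          using Z C(3) x by blast
        have "\<phi> \<alpha> s z = (\<Prod>t<d. f t x ^ \<alpha> t) * H s z ^ (d * D)" if "\<alpha> \<in> exps d D" for \<alpha>
        proof -
          have "\<phi> \<alpha> s z = (\<Prod>t<d. (f t x * H s z) ^ \<alpha> t) * H s z ^ (d * D - (\<Sum>t<d. \<alpha> t))"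
            unfolding \<phi>_def using KH[OF sz(1) _ sz(2)] by simp
          also have "\<dots> = (\<Prod>t<d. f t x ^ \<alpha> t) * (H s z ^ (\<Sum>t<d. \<alpha> t) * H s z ^ (d * D - (\<Sum>t<d. \<alpha> t)))"
            by (simp add: power_mult_distrib prod.distrib power_sum)
          finally show ?thesis using le[OF that] by (simp flip: power_add)
        qed
        then have "(\<Sum>\<alpha>\<in>exps d D. c \<alpha> * (\<Prod>t<d. f t x ^ \<alpha> t)) * H s z ^ (d * D) = (\<Sum>\<alpha>\<in>exps d D. c \<alpha> * \<phi> \<alpha> s z)"
          by (simp add: sum_distrib_right mult.assoc)
        also have "\<dots> = (\<Sum>\<alpha>\<in>exps d D. fscale (c \<alpha>) (\<psi> \<alpha>)) (s, z)"
          using sz by (simp add: sum_fun_apply fscale_def \<psi>_def)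
        also have "\<dots> = 0" by (simp add: 0)
        finally show ?thesis using Hnz[OF sz] by simp
      qed
      then show "\<forall>\<alpha>\<in>exps d D. c \<alpha> = 0" using ind by blast
    qed (simp add: finite_PiE)
    then have "card (exps d D) \<le> card B"
      using cvs.independent_span_bound[OF finB, of "\<psi> ` exps d D"] \<psi> by (auto simp: card_image)
    then show ?thesis using cardB by (simp add: card_PiE)
  qed
  then show ?thesis by (rule exponent_le_of_power_bound)
qed

section \<open>Charts around coordinate points\<close>

definition graph_basis :: "nat set \<Rightarrow> nat set \<Rightarrow> (nat \<Rightarrow> nat \<Rightarrow> complex) \<Rightarrow> nat \<Rightarrow> nat \<Rightarrow> complex"
  where "graph_basis U T y j = w j + (\<Sum>i\<in>U - T. fscale (y i j) (w i))"

lemma index_collectionD: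
  assumes "index_collection n S" "k \<in> {1..n}"
  shows "S k \<subseteq> {1..n+1}" "card (S k) = k" "finite (S k)"
  using assms finite_subset[of "S k" "{1..n+1}"] by (auto simp: index_collection_def)

lemma graph_basis_apply:
  assumes "finite U" "T \<subseteq> U" "j \<in> T"
  shows "graph_basis U T y j m = (if m = j then 1 else if m \<in> U - T then y m j else 0)"
proof -
  have "(\<Sum>i\<in>U - T. y i j * (if m = i then 1 else 0)) = (\<Sum>i\<in>U - T. if i = m then y i j else 0)"
    by (intro sum.cong) auto
  also have "\<dots> = (if m \<in> U - T then y m j else 0)" using assms by simp
  finally show ?thesis using assms
    by (auto simp: graph_basis_def sum_fun_apply fscale_def w_def)
qed

lemma graph_basis_expand:
  assumes "finite U" "T \<subseteq> U" "v \<in> coord_space U" "\<forall>i\<in>U - T. v i = (\<Sum>j\<in>T. y i j * v j)"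
  shows "v = (\<Sum>j\<in>T. fscale (v j) (graph_basis U T y j))"
proof
  fix m
  have fT: "finite T" using assms finite_subset by blast
  have eq: "(\<Sum>j\<in>T. fscale (v j) (graph_basis U T y j)) m = (\<Sum>j\<in>T. v j * graph_basis U T y j m)"
    by (simp add: sum_fun_apply fscale_def)
  show "v m = (\<Sum>j\<in>T. fscale (v j) (graph_basis U T y j)) m"
  proof (cases "m \<in> T")
    case True
    then have "(\<Sum>j\<in>T. v j * graph_basis U T y j m) = (\<Sum>j\<in>T. if j = m then v j else 0)"
      using assms by (intro sum.cong) (auto simp: graph_basis_apply)
    then show ?thesis using eq True fT by simp
  next
    case False
    then have "(\<Sum>j\<in>T. v j * graph_basis U T y j m) = (\<Sum>j\<in>T. if m \<in> U then y m j * v j else 0)"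
      using assms by (intro sum.cong) (auto simp: graph_basis_apply)
    then show ?thesis using eq False assms by (cases "m \<in> U") (auto simp: coord_space_def)
  qed
qed

lemma span_graph_basis:
  assumes "finite U" "T \<subseteq> U"
  shows "v \<in> cvs.span (graph_basis U T y ` T) \<longleftrightarrow>
    v \<in> coord_space U \<and> (\<forall>i\<in>U - T. v i = (\<Sum>j\<in>T. y i j * v j))" (is "_ \<longleftrightarrow> ?R v")
proof
  have fT: "finite T" using assms finite_subset by blast
  assume "v \<in> cvs.span (graph_basis U T y ` T)"
  then show "?R v"
  proof (rule cvs.span_induct)
    show "cvs.subspace {v. ?R v}" unfolding cvs.subspace_def
      by (auto simp: coord_space_def fscale_def sum_distrib_left sum.distrib algebra_simps intro!: sum.cong)
    fix x assume "x \<in> graph_basis U T y ` T"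
    then obtain j where j: "j \<in> T" "x = graph_basis U T y j" by blast
    show "?R x"
    proof -
      have "(\<Sum>l\<in>T. y i l * x l) = x i" if "i \<in> U - T" for i
      proof -
        have "(\<Sum>l\<in>T. y i l * x l) = (\<Sum>l\<in>T. if l = j then y i l else 0)"
          unfolding j using assms j by (intro sum.cong) (auto simp: graph_basis_apply)
        then show ?thesis using fT that j assms by (auto simp: graph_basis_apply)
      qed
      then show ?thesis using assms j by (auto simp: coord_space_def graph_basis_apply)
    qed
  qed
next
  assume "?R v"
  then have "v = (\<Sum>j\<in>T. fscale (v j) (graph_basis U T y j))" using assms graph_basis_expand by blast
  also have "\<dots> \<in> cvs.span (graph_basis U T y ` T)"
    by (intro cvs.span_sum cvs.span_scale cvs.span_base) auto
  finally show "v \<in> cvs.span (graph_basis U T y ` T)" .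
qed

lemma graph_basis_independent:
  assumes "finite U" "T \<subseteq> U"
  shows "inj_on (graph_basis U T y) T \<and> cvs.independent (graph_basis U T y ` T)"
proof (rule cvs_independent_family)
  show fT: "finite T" using assms finite_subset by blast
  fix c assume 0: "(\<Sum>a\<in>T. fscale (c a) (graph_basis U T y a)) = 0"
  show "\<forall>a\<in>T. c a = 0"
  proof
    fix a assume a: "a \<in> T"
    have "(\<Sum>j\<in>T. fscale (c j) (graph_basis U T y j)) a = (\<Sum>j\<in>T. if j = a then c j else 0)"
      unfolding sum_fun_apply fscale_def using assms a by (intro sum.cong) (auto simp: graph_basis_apply)
    then show "c a = 0" using 0 a fT by simp
  qed
qed

lemma dim_span_graph_basis:
  assumes "finite U" "T \<subseteq> U"
  shows "cvs.dim (cvs.span (graph_basis U T y ` T)) = card T"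
  using graph_basis_independent[OF assms, of y]
  by (simp add: cvs.dim_eq_card_independent card_image)

lemma chart_eq_graph: "k \<in> {1..n} \<Longrightarrow>
  chart n S x k = cvs.span (graph_basis {1..n+1} (S k) (\<lambda>i j. x (k, i, j)) ` S k)"
  by (simp add: chart_def graph_basis_def)

lemma mem_chart:
  assumes "index_collection n S" "k \<in> {1..n}"
  shows "v \<in> chart n S x k \<longleftrightarrow>
    v \<in> W n \<and> (\<forall>i\<in>{1..n+1} - S k. v i = (\<Sum>j\<in>S k. x (k, i, j) * v j))"
  unfolding chart_eq_graph[OF assms(2)] W_def
  using assms by (subst span_graph_basis) (auto simp: index_collection_def)

lemma chart_in_prod_Gr:
  assumes "index_collection n S"
  shows "chart n S x \<in> prod_Gr n"
proof -
  have "chart n S x k \<in> Gr n k" if k: "k \<in> {1..n}" for k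
  proof -
    have "S k \<subseteq> {1..n+1}" "card (S k) = k" using assms k by (auto simp: index_collection_def)
    then have "cvs.dim (chart n S x k) = k" 
      unfolding chart_eq_graph[OF k] by (subst dim_span_graph_basis) auto
    moreover have "cvs.subspace (chart n S x k)" unfolding chart_eq_graph[OF k] by simp
    moreover have "chart n S x k \<subseteq> W n" using mem_chart[OF assms k] by blast
    ultimately show ?thesis by (simp add: Gr_def)
  qed
  then show ?thesis by (auto simp: prod_Gr_def chart_def)
qed

lemma mem_span_w:
  assumes "finite T"
  shows "v \<in> cvs.span (w ` T) \<longleftrightarrow> v \<in> coord_space T"
proof -
  have "w ` T = graph_basis T T (\<lambda>_ _. 0) ` T"
    by (intro image_cong) (auto simp: graph_basis_def)
  then show ?thesis using span_graph_basis[of T T v] assms by simp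
qed

lemma chart_zero: 
  assumes "index_collection n S"
  shows "chart n S 0 = coord_point n S"
proof -
  have "chart n S 0 k = cvs.span (w ` S k)" if k: "k \<in> {1..n}" for k
  proof -
    have "finite (S k)" "S k \<subseteq> {1..n+1}" using index_collectionD[OF assms k] by auto
    then have "v \<in> chart n S 0 k \<longleftrightarrow> v \<in> cvs.span (w ` S k)" for v
      unfolding mem_chart[OF assms k] by (fastforce simp: mem_span_w W_def coord_space_def)
    then show ?thesis by blast
  qed
  then show ?thesis by (auto simp: chart_def coord_point_def)
qed

text \<open>In the chart of \<open>S'\<close> a vector of \<open>V k\<close> is determined by its
  coordinates in \<open>S' k\<close>. If \<open>j\<close> is not in \<open>S' k\<close>, those of
  \<open>w j\<close> are all 0, so \<open>w j\<close> cannot lie in \<open>V k\<close>. Hence the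
  existential over charts in \<open>smooth_point\<close> reduces to one chart and its
  origin.\<close>

lemma chart_eq_coord_point:
  assumes S: "index_collection n S" and S': "index_collection n S'"
    and x: "x \<in> coord_space (chart_index n S')" and eq: "chart n S' x = coord_point n S"
  shows "(\<forall>k\<in>{1..n}. S' k = S k) \<and> x = 0"
proof -
  have wS: "\<forall>i\<in>{1..n+1} - S' k. w j i = (\<Sum>l\<in>S' k. x (k, i, l) * w j l)"
    if k: "k \<in> {1..n}" and j: "j \<in> S k" for k j
  proof -
    have "w j \<in> coord_point n S k" using k j by (auto simp: coord_point_def intro: cvs.span_base)
    then show ?thesis using mem_chart[OF S' k, of "w j" x] eq by simp
  qed
  have *: "S k = S' k" if k: "k \<in> {1..n}" for k
  proof -
    have "S k \<subseteq> S' k"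
    proof
      fix j assume j: "j \<in> S k"
      show "j \<in> S' k"
      proof (rule ccontr)
        assume nj: "j \<notin> S' k"
        then have "j \<in> {1..n+1} - S' k" using index_collectionD(1)[OF S k] j by blast
        from wS[OF k j, THEN bspec, OF this] have "1 = (\<Sum>l\<in>S' k. x (k, j, l) * w j l)" by (simp add: w_def)
        also have "\<dots> = 0" using nj by (intro sum.neutral) (auto simp: w_def)
        finally show False by simp
      qed
    qed
    moreover have "card (S k) = card (S' k)" "finite (S' k)"
      using index_collectionD[OF S k] index_collectionD[OF S' k] by auto
    ultimately show ?thesis by (simp add: card_subset_eq)
  qed
  have "x (k, i, j) = 0" for k i j
  proof (cases "(k, i, j) \<in> chart_index n S'")
    case True
    then have k: "k \<in> {1..n}" and i: "i \<in> {1..n+1} - S' k" and j: "j \<in> S' k"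
      by (auto simp: chart_index_def)
    have "w j i = (\<Sum>l\<in>S' k. if l = j then x (k, i, l) else 0)"
      using wS[OF k, of j] i j * k by (auto simp: w_def intro!: sum.cong)
    moreover have "finite (S' k)" using index_collectionD[OF S' k] by auto
    ultimately show ?thesis using i j by (auto simp: w_def split: if_splits)
  qed (use x in \<open>auto simp: coord_space_def\<close>)
  then have "x = 0" by (auto simp: fun_eq_iff)
  then show ?thesis using * by auto
qed

lemma smooth_point_coord_point:
  assumes S: "index_collection n S"
  shows "smooth_point n X (coord_point n S) \<longleftrightarrow>
    affine_smooth_point (chart_index n S) {y \<in> coord_space (chart_index n S). chart n S y \<in> X} 0"
proof
  assume "smooth_point n X (coord_point n S)"
  then obtain S' x where S': "index_collection n S'" and x: "x \<in> coord_space (chart_index n S')"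
    "chart n S' x = coord_point n S"
    and aff: "affine_smooth_point (chart_index n S') {y \<in> coord_space (chart_index n S'). chart n S' y \<in> X} x"
    unfolding smooth_point_def by blast
  have eq: "\<forall>k\<in>{1..n}. S' k = S k" "x = 0" using chart_eq_coord_point[OF S S' x] by auto
  have "chart_index n S' = chart_index n S" using eq by (auto simp: chart_index_def)
  moreover have "chart n S' y = chart n S y" for y unfolding chart_def by (intro restrict_ext) (use eq in simp)
  ultimately show "affine_smooth_point (chart_index n S) {y \<in> coord_space (chart_index n S). chart n S y \<in> X} 0"
    using aff eq by simp
next
  assume "affine_smooth_point (chart_index n S) {y \<in> coord_space (chart_index n S). chart n S y \<in> X} 0"
  then show "smooth_point n X (coord_point n S)"
    unfolding smooth_point_def using S chart_zero[OF S]
    by (intro exI[of _ S] conjI bexI[of _ 0]) (auto simp: coord_space_def)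
qed

section \<open>The equations of the degenerate flag variety in a chart\<close>

locale admissible_collection =
  fixes n :: nat and S :: "nat \<Rightarrow> nat set"
  assumes adm: "admissible n S"
begin

abbreviation "U \<equiv> {1..n+1}"
abbreviation "J \<equiv> chart_index n S"

lemma index: "index_collection n S"
  using adm by (simp add: admissible_def)

lemma S_sub: "k \<in> {1..n} \<Longrightarrow> S k \<subseteq> U"
  and card_S: "k \<in> {1..n} \<Longrightarrow> card (S k) = k"
  and fin_S: "k \<in> {1..n} \<Longrightarrow> finite (S k)"
  using index_collectionD[OF index] by auto

lemma S_step: "1 \<le> k \<Longrightarrow> k < n \<Longrightarrow> j \<in> S k \<Longrightarrow> j \<noteq> k + 1 \<Longrightarrow> j \<in> S (k + 1)"
  using adm by (auto simp: admissible_def)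

text \<open>The index \<open>j\<close> can get lost only on the arrow into vertex \<open>j\<close>,
  which projects along \<open>w j\<close>. The last assumption says that this arrow does not lie
  between \<open>k\<close> and \<open>m\<close>.\<close>

lemma S_mono:
  assumes "j \<in> S k" "1 \<le> k" "k \<le> m" "m \<le> n" "j \<le> k \<or> m < j"
  shows "j \<in> S m"
  using assms(3,4,5)
proof (induction m rule: dec_induct)
  case (step m)
  then show ?case using S_step[of m j] assms(2) by auto
qed (use assms in auto)

lemma J_iff: "(k, i, j) \<in> J \<longleftrightarrow> 1 \<le> k \<and> k \<le> n \<and> i \<in> U \<and> i \<notin> S k \<and> j \<in> S k"
  by (auto simp: chart_index_def)

lemma finite_J: "finite J"
proof -
  have "J \<subseteq> {1..n} \<times> U \<times> U" using S_sub by (auto simp: chart_index_def)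
  then show ?thesis by (rule finite_subset) auto
qed

text \<open>\<open>(k, i, j)\<close> stands for the \<open>i\<close>-th coordinate of the condition
  that the graph vector with column \<open>j\<close> at vertex \<open>k\<close> is mapped into
  \<open>V (k + 1)\<close>. Its two parts are \<open>lin\<close> and \<open>quad\<close>.\<close>

definition Eqs :: "(nat \<times> nat \<times> nat) set"
  where "Eqs = {(k, i, j). 1 \<le> k \<and> k < n \<and> j \<in> S k \<and> i \<in> U - S (k + 1)}"

text \<open>The projection erases row \<open>k + 1\<close> of the source. It also erases the unit
  entry of column \<open>k + 1\<close>, so this column is not subtracted in the target.\<close>

fun lin :: "nat \<times> nat \<times> nat \<Rightarrow> (nat \<times> nat \<times> nat \<Rightarrow> complex) \<Rightarrow> complex"
  where "lin (k, i, j) y = (if i = k + 1 then 0 else y (k, i, j)) - (if j = k + 1 then 0 else y (k + 1, i, j))"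

fun quad :: "nat \<times> nat \<times> nat \<Rightarrow> (nat \<times> nat \<times> nat \<Rightarrow> complex) \<Rightarrow> complex"
  where "quad (k, i, j) y = (\<Sum>l\<in>S (k + 1) - S k - {k + 1}. y (k + 1, i, l) * y (k, l, j))"

definition Z :: "(nat \<times> nat \<times> nat \<Rightarrow> complex) set"
  where "Z = {y \<in> coord_space J. chart n S y \<in> degenerate_flag_variety n}"

lemma chart_in_degenerate_flag_variety:
  "chart n S y \<in> degenerate_flag_variety n \<longleftrightarrow> (\<forall>e\<in>Eqs. lin e y = quad e y)"
proof -
  define b where "b k = graph_basis U (S k) (\<lambda>i j. y (k, i, j))" for k
  have b: "b k j m = (if m = j then 1 else if m \<in> U - S k then y (k, m, j) else 0)"
    if "k \<in> {1..n}" "j \<in> S k" for k j m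
    unfolding b_def using that S_sub[of k] by (intro graph_basis_apply) auto
  have eq: "pr (k+1) ` chart n S y k \<subseteq> chart n S y (k+1) \<longleftrightarrow>
      (\<forall>j\<in>S k. \<forall>i\<in>U - S (k + 1). lin (k, i, j) y = quad (k, i, j) y)" if k: "1 \<le> k" "k < n" for k
  proof -
    have kk: "k \<in> {1..n}" "k + 1 \<in> {1..n}" using k by auto
    have "pr (k+1) ` chart n S y k \<subseteq> chart n S y (k+1) \<longleftrightarrow> (\<forall>j\<in>S k. pr (k+1) (b k j) \<in> chart n S y (k+1))"
    proof
      assume "pr (k+1) ` chart n S y k \<subseteq> chart n S y (k+1)"
      then show "\<forall>j\<in>S k. pr (k+1) (b k j) \<in> chart n S y (k+1)"
        using chart_eq_graph[OF kk(1)] by (auto simp: b_def intro: cvs.span_base)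
    next
      assume *: "\<forall>j\<in>S k. pr (k+1) (b k j) \<in> chart n S y (k+1)"
      have "pr (k+1) v \<in> chart n S y (k+1)" if "v \<in> chart n S y k" for v
        unfolding chart_eq_graph[OF kk(2)]
      proof (rule span_linear_image[where L = "pr (k+1)"])
        show "v \<in> cvs.span (b k ` S k)" using that unfolding chart_eq_graph[OF kk(1)] b_def .
        show "pr (k+1) a \<in> cvs.span (graph_basis U (S (k+1)) (\<lambda>i j. y (k+1, i, j)) ` S (k+1))"
          if "a \<in> b k ` S k" for a
          using that * unfolding chart_eq_graph[OF kk(2)] by blast
      qed (auto simp: pr_def fun_eq_iff fscale_def)
      then show "pr (k+1) ` chart n S y k \<subseteq> chart n S y (k+1)" by blast
    qed
    also have "\<dots> \<longleftrightarrow> (\<forall>j\<in>S k. \<forall>i\<in>U - S (k + 1). lin (k, i, j) y = quad (k, i, j) y)"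
    proof (intro ball_cong refl)
      fix j assume j: "j \<in> S k"
      have jU: "j \<in> U" using S_sub[OF kk(1)] j by auto
      have W: "pr (k+1) (b k j) \<in> W n"
        using b[OF kk(1) j] jU by (auto simp: W_def coord_space_def pr_def)
      have "pr (k+1) (b k j) i = (\<Sum>l\<in>S (k+1). y (k + 1, i, l) * pr (k+1) (b k j) l) \<longleftrightarrow> lin (k, i, j) y = quad (k, i, j) y"
        if i: "i \<in> U - S (k + 1)" for i
      proof -
        let ?Q = "S (k + 1) - S k - {k + 1}"
        have ij: "i \<noteq> j \<or> i = k + 1" using i j S_step k by auto
        have iS: "i \<notin> S k" if "i \<noteq> k + 1" using i S_step k that by auto
        have lhs: "pr (k+1) (b k j) i = (if i = k + 1 then 0 else y (k, i, j))"
          using b[OF kk(1) j, of i] i ij iS by (auto simp: pr_def)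
        \<comment> \<open>On \<open>S (k + 1)\<close> the projected vector has the entry 1 at
          \<open>j\<close> unless \<open>j = k + 1\<close>, chart coordinates at the indices of
          \<open>?Q\<close>, and 0 elsewhere.\<close>
        have "(\<Sum>l\<in>S (k+1). y (k + 1, i, l) * pr (k+1) (b k j) l) =
            (\<Sum>l\<in>S (k+1). (if l \<in> ?Q then y (k + 1, i, l) * y (k, l, j) else 0) +
               (if l = j then (if j = k + 1 then 0 else y (k + 1, i, j)) else 0))"
          using S_sub[OF kk(2)] j b[OF kk(1) j] by (intro sum.cong refl) (auto simp: pr_def split: if_splits)
        also have "\<dots> = quad (k, i, j) y + (if j = k + 1 then 0 else y (k + 1, i, j))"
        proof -
          have "(\<Sum>l\<in>S (k+1). if l \<in> ?Q then y (k + 1, i, l) * y (k, l, j) else 0) = quad (k, i, j) y"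
            unfolding quad.simps using fin_S[OF kk(2)] by (intro sum.mono_neutral_cong_right) auto
          moreover have "(\<Sum>l\<in>S (k+1). if l = j then (if j = k + 1 then 0 else y (k + 1, i, j)) else 0)
              = (if j = k + 1 then 0 else y (k + 1, i, j))"
            using fin_S[OF kk(2)] S_step[OF k j] by auto
          ultimately show ?thesis by (simp add: sum.distrib)
        qed
        finally show ?thesis using lhs by (auto simp: algebra_simps)
      qed
      then show "pr (k+1) (b k j) \<in> chart n S y (k+1) \<longleftrightarrow> (\<forall>i\<in>U - S (k + 1). lin (k, i, j) y = quad (k, i, j) y)"
        unfolding mem_chart[OF index kk(2)] using W by blast
    qed
    finally show ?thesis .
  qed
  show ?thesis
    unfolding degenerate_flag_variety_def Eqs_def
    using chart_in_prod_Gr[OF index, of y] eq by (auto simp del: lin.simps quad.simps)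
qed

lemma Z_iff: "y \<in> Z \<longleftrightarrow> y \<in> coord_space J \<and> (\<forall>e\<in>Eqs. lin e y = quad e y)"
  by (simp add: Z_def chart_in_degenerate_flag_variety)

lemma smooth_point_iff:
  "smooth_point n (degenerate_flag_variety n) (coord_point n S) \<longleftrightarrow> affine_smooth_point J Z 0"
  unfolding Z_def by (rule smooth_point_coord_point[OF index])

end

context admissible_collection begin

section \<open>Tangent spaces at coordinate points\<close>

text \<open>For fixed \<open>i\<close>, \<open>j\<close> the linearised equations identify the coordinates \<open>(k, i, j)\<close> along each
  maximal run of consecutive \<open>k\<close>, and they force the common value to be 0 if the run is cut off at
  its right end (\<open>right_cut\<close>) or at its left end. The set \<open>free\<close> contains the first coordinate
  of each run which is cut at neither end.\<close>

definition right_cut :: "nat \<Rightarrow> nat \<Rightarrow> nat \<Rightarrow> bool"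
  where "right_cut k i j \<longleftrightarrow> k < j \<and> j \<le> n \<and> (i \<le> k \<or> j < i) \<and> i \<notin> S j"

definition free :: "(nat \<times> nat \<times> nat) set"
  where "free = {(k, i, j) \<in> J. \<not> right_cut k i j \<and> (k = 1 \<or> j \<notin> S (k - 1) \<or> j = k)}"

definition smoothness_condition :: bool
  where "smoothness_condition \<longleftrightarrow> (\<forall>i j. 1 \<le> j \<and> j < i \<and> i \<le> n \<longrightarrow> i \<in> S j \<longrightarrow> j + 1 \<in> S i)"

lemma S_step_pred: "2 \<le> k \<Longrightarrow> k \<le> n \<Longrightarrow> j \<in> S (k - 1) \<Longrightarrow> j \<noteq> k \<Longrightarrow> j \<in> S k"
  using S_step[of "k - 1" j] by simp

lemma free_sub: "free \<subseteq> J"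
  by (auto simp: free_def)

lemma finite_free: "finite free"
  using finite_subset[OF free_sub finite_J] .

text \<open>A right-cut coordinate is passed on to the right until the arrow into vertex
  \<open>j\<close>, where column \<open>j\<close> drops out of the linear part and leaves the
  coordinate alone.\<close>

lemma right_cut_step:
  assumes "(k, i, j) \<in> J" "right_cut k i j"
  shows "(k, i, j) \<in> Eqs" "i \<noteq> k + 1" "j \<noteq> k + 1 \<Longrightarrow> (k + 1, i, j) \<in> J \<and> right_cut (k + 1) i j"
proof -
  have k: "1 \<le> k" "k < n" "i \<in> U" "i \<notin> S k" "j \<in> S k" "k < j" "j \<le> n" "i \<le> k \<or> j < i" "i \<notin> S j"
    using assms by (auto simp: J_iff right_cut_def)
  then have "i \<notin> S (k + 1)" using S_mono[of i "k + 1" j] by auto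
  then show "(k, i, j) \<in> Eqs" using k by (auto simp: Eqs_def)
  show "i \<noteq> k + 1" using k by auto
  assume "j \<noteq> k + 1"
  then show "(k + 1, i, j) \<in> J \<and> right_cut (k + 1) i j"
    using k S_step[of k j] \<open>i \<notin> S (k + 1)\<close> by (auto simp: J_iff right_cut_def)
qed

text \<open>A coordinate that is neither right-cut nor free is tied by the arrow on its left to its
  left neighbour, or to 0 if that arrow projects along \<open>w i\<close>.\<close>

lemma left_step:
  assumes "(k, i, j) \<in> J" "\<not> right_cut k i j" "(k, i, j) \<notin> free"
  shows "2 \<le> k" "(k - 1, i, j) \<in> Eqs" "j \<noteq> k"
    "i \<noteq> k \<Longrightarrow> (k - 1, i, j) \<in> J \<and> \<not> right_cut (k - 1) i j"
proof -
  have k: "1 \<le> k" "k \<le> n" "i \<in> U" "i \<notin> S k" "j \<in> S k" "k \<noteq> 1" "j \<in> S (k - 1)" "j \<noteq> k"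
    using assms by (auto simp: J_iff free_def)
  then show "2 \<le> k" "(k - 1, i, j) \<in> Eqs" "j \<noteq> k" by (auto simp: Eqs_def)
  assume "i \<noteq> k"
  then have "i \<notin> S (k - 1)" using k S_step_pred[of k i] by auto
  then show "(k - 1, i, j) \<in> J \<and> \<not> right_cut (k - 1) i j"
    using k assms(2) by (auto simp: J_iff right_cut_def)
qed

text \<open>Each coordinate outside \<open>free\<close> is determined by an equation.\<close>

definition eq_of :: "nat \<times> nat \<times> nat \<Rightarrow> nat \<times> nat \<times> nat"
  where "eq_of = (\<lambda>(k, i, j). if right_cut k i j then (k, i, j) else (k - 1, i, j))"

lemma eq_of_in_Eqs: "e \<in> J - free \<Longrightarrow> eq_of e \<in> Eqs"
  using right_cut_step(1) left_step(2) by (cases e) (auto simp: eq_of_def)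

text \<open>Two coordinates could share an equation only as a right-cut one at \<open>k\<close> and
  one at \<open>k + 1\<close>, with the same \<open>i\<close> and \<open>j\<close>, that is not
  right-cut. But being right-cut propagates to the right as long as
  \<open>j \<noteq> k + 1\<close>.\<close>

lemma inj_on_eq_of: "inj_on eq_of (J - free)"
proof (rule inj_onI)
  have *: False if "(k, i, j) \<in> J" "right_cut k i j" "(k', i, j) \<in> J" "(k', i, j) \<notin> free" "\<not> right_cut k' i j"
    "k = k' - 1" for k k' i j
    using that left_step[of k' i j] right_cut_step[of k i j] by auto
  fix e e' assume e: "e \<in> J - free" "e' \<in> J - free" "eq_of e = eq_of e'"
  obtain k i j k' i' j' where ee: "e = (k, i, j)" "e' = (k', i', j')" by (metis prod_cases3)
  have "k \<ge> 2" if "\<not> right_cut k i j" using left_step(1)[of k i j] that e ee by auto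
  moreover have "k' \<ge> 2" if "\<not> right_cut k' i' j'" using left_step(1)[of k' i' j'] that e ee by auto
  moreover have ij: "i' = i" "j' = j"
    using e(3) unfolding ee eq_of_def by (simp_all split: if_splits)
  moreover have "right_cut k i j \<longleftrightarrow> right_cut k' i j"
  proof (rule ccontr)
    assume "\<not> ?thesis"
    then consider "right_cut k i j" "\<not> right_cut k' i j" | "right_cut k' i j" "\<not> right_cut k i j" by blast
    then show False
    proof cases
      case 1
      then have "k = k' - 1" using e(3) unfolding ee eq_of_def ij by simp
      then show False using *[of k i j k'] 1 e(1,2) unfolding ee ij by blast
    next
      case 2
      then have "k' = k - 1" using e(3) unfolding ee eq_of_def ij by simp
      then show False using *[of k' i j k] 2 e(1,2) unfolding ee ij by blast
    qed
  qed
  ultimately show "e = e'" using e(3) unfolding ee eq_of_def by (auto split: if_splits)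
qed

text \<open>The equations left out have \<open>i = k + 1\<close>. For \<open>j = k + 1\<close> their
  linear part is 0; otherwise it consists of the coordinate \<open>(k + 1, k + 1, j)\<close>, which
  is right-cut and so matched with an equation further right.\<close>

lemma eq_of_image:
  "eq_of ` (J - free) = {(k, i, j) \<in> Eqs. \<not> (i = k + 1 \<and> (j = k + 1 \<or> k < j \<and> j \<le> n \<and> k + 1 \<notin> S j))}"
proof (intro equalityI subsetI)
  fix e assume "e \<in> eq_of ` (J - free)"
  then obtain k i j where e: "e = eq_of (k, i, j)" "(k, i, j) \<in> J" "(k, i, j) \<notin> free" by auto
  show "e \<in> {(k, i, j) \<in> Eqs. \<not> (i = k + 1 \<and> (j = k + 1 \<or> k < j \<and> j \<le> n \<and> k + 1 \<notin> S j))}"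
  proof (cases "right_cut k i j")
    case True
    then show ?thesis using right_cut_step[of k i j] e by (auto simp: eq_of_def right_cut_def)
  next
    case False
    then show ?thesis using left_step[of k i j] e by (auto simp: eq_of_def right_cut_def J_iff)
  qed
next
  fix e assume "e \<in> {(k, i, j) \<in> Eqs. \<not> (i = k + 1 \<and> (j = k + 1 \<or> k < j \<and> j \<le> n \<and> k + 1 \<notin> S j))}"
  then obtain k i j where e: "e = (k, i, j)" and k: "1 \<le> k" "k < n" "j \<in> S k" "i \<in> U" "i \<notin> S (k + 1)"
    and nb: "\<not> (i = k + 1 \<and> (j = k + 1 \<or> k < j \<and> j \<le> n \<and> k + 1 \<notin> S j))" by (auto simp: Eqs_def)
  have iS: "i \<notin> S k" if "i \<noteq> k + 1" using S_step[of k i] k that by auto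
  show "e \<in> eq_of ` (J - free)"
  proof (cases "i \<noteq> k + 1 \<and> right_cut k i j")
    case True
    then have "(k, i, j) \<in> J - free" using k iS by (auto simp: J_iff free_def)
    then show ?thesis using True e by (intro image_eqI[of _ _ "(k, i, j)"]) (auto simp: eq_of_def)
  next
    case False
    have j: "j \<noteq> k + 1"
    proof
      assume "j = k + 1"
      then show False using False k nb by (auto simp: right_cut_def)
    qed
    have "\<not> right_cut (k + 1) i j" using False k nb j by (cases "i = k + 1") (auto simp: right_cut_def)
    moreover have "(k + 1, i, j) \<in> J - free" using calculation k j S_step[of k j] by (auto simp: J_iff free_def)
    ultimately show ?thesis using e by (intro image_eqI[of _ _ "(k + 1, i, j)"]) (auto simp: eq_of_def)
  qed
qed

section \<open>Numbers of coordinates, equations and free coordinates\<close>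

lemma finite_Eqs: "finite Eqs"
proof -
  have "(k, i, j) \<in> {1..n} \<times> U \<times> U" if "(k, i, j) \<in> Eqs" for k i j
    using S_sub[of k] that by (auto simp: Eqs_def)
  then have "Eqs \<subseteq> {1..n} \<times> U \<times> U" by auto
  then show ?thesis by (rule finite_subset) auto
qed

text \<open>Vertex \<open>k\<close> has \<open>(n + 1 - k) * k\<close> coordinates, and the arrow
  leaving it gives \<open>(n - k) * k\<close> equations; the difference is \<open>k\<close>.\<close>

lemma card_J_Eqs: "card J = card Eqs + \<Sum>{1..n}"
proof -
  have "J = (\<Union>k\<in>{1..n}. {k} \<times> (U - S k) \<times> S k)" by (auto simp: chart_index_def)
  then have "card J = (\<Sum>k\<in>{1..n}. card ({k} \<times> (U - S k) \<times> S k))"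
    by (simp only:, subst card_UN_disjoint) (auto simp: fin_S)
  also have "\<dots> = (\<Sum>k\<in>{1..n}. (n + 1 - k) * k)"
  proof (rule sum.cong)
    fix k assume k: "k \<in> {1..n}"
    then show "card ({k} \<times> (U - S k) \<times> S k) = (n + 1 - k) * k"
      using fin_S[OF k] S_sub[OF k] card_S[OF k] by (simp add: card_cartesian_product card_Diff_subset)
  qed simp
  also have "\<dots> = (\<Sum>k\<in>{1..n}. (n - k) * k + k)"
    by (rule sum.cong) (auto simp: Suc_diff_le)
  also have "\<dots> = (\<Sum>k\<in>{1..<n}. (n - k) * k) + \<Sum>{1..n}"
  proof -
    have "(\<Sum>k\<in>{1..n}. (n - k) * k) = (\<Sum>k\<in>{1..<n}. (n - k) * k)"
      by (rule sum.mono_neutral_right) auto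
    then show ?thesis by (simp add: sum.distrib)
  qed
  finally have J: "card J = (\<Sum>k\<in>{1..<n}. (n - k) * k) + \<Sum>{1..n}" .
  have "Eqs = (\<Union>k\<in>{1..<n}. {k} \<times> (U - S (k + 1)) \<times> S k)" by (auto simp: Eqs_def)
  then have "card Eqs = (\<Sum>k\<in>{1..<n}. card ({k} \<times> (U - S (k + 1)) \<times> S k))"
    by (simp only:, subst card_UN_disjoint) (auto simp: fin_S)
  also have "\<dots> = (\<Sum>k\<in>{1..<n}. (n - k) * k)"
  proof (rule sum.cong)
    fix k assume "k \<in> {1..<n}"
    then have k: "k \<in> {1..n}" "k + 1 \<in> {1..n}" by auto
    then show "card ({k} \<times> (U - S (k + 1)) \<times> S k) = (n - k) * k"
      using fin_S[OF k(2)] S_sub[OF k(2)] card_S[OF k(2)] card_S[OF k(1)]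
      by (simp add: card_cartesian_product card_Diff_subset)
  qed simp
  finally show ?thesis using J by simp
qed

text \<open>The coordinates outside \<open>free\<close> are matched injectively with equations. So
  \<open>card free\<close> exceeds the expected value by the number of unmatched equations, and
  these are the violations of the condition.\<close>

lemma card_free:
  "smoothness_condition \<Longrightarrow> card free = \<Sum>{1..n}"
  "\<not> smoothness_condition \<Longrightarrow> card free > \<Sum>{1..n}"
proof -
  have "card J = card free + card (J - free)"
    using card_Diff_subset[OF finite_free free_sub] card_mono[OF finite_J free_sub] by simp
  moreover have c: "card (J - free) = card (eq_of ` (J - free))"
    by (simp add: card_image inj_on_eq_of)
  ultimately have *: "card free + card (eq_of ` (J - free)) = card Eqs + \<Sum>{1..n}"
    using card_J_Eqs by simp
  have sub: "eq_of ` (J - free) \<subseteq> Eqs" using eq_of_in_Eqs by blast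
  show "card free = \<Sum>{1..n}" if "smoothness_condition"
  proof -
    have "\<not> (i = k + 1 \<and> (j = k + 1 \<or> k < j \<and> j \<le> n \<and> k + 1 \<notin> S j))" if e: "(k, i, j) \<in> Eqs" for k i j
    proof
      assume a: "i = k + 1 \<and> (j = k + 1 \<or> k < j \<and> j \<le> n \<and> k + 1 \<notin> S j)"
      have k: "1 \<le> k" "k < n" "j \<in> S k" "i \<notin> S (k + 1)" using e by (auto simp: Eqs_def)
      then have "k + 1 \<in> S j" using \<open>smoothness_condition\<close> a unfolding smoothness_condition_def by auto
      then show False using a k by auto
    qed
    then have "eq_of ` (J - free) = Eqs" unfolding eq_of_image by auto
    then show ?thesis using * by simp
  qed
  show "card free > \<Sum>{1..n}" if ns: "\<not> smoothness_condition"
  proof -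
    obtain i j where ij: "1 \<le> j" "j < i" "i \<le> n" "i \<in> S j" "j + 1 \<notin> S i"
      using ns by (auto simp: smoothness_condition_def)
    then have "j + 1 \<notin> S (j + 1)" using S_mono[of "j + 1" "j + 1" i] by auto
    \<comment> \<open>The violating pair appears as arrow \<open>j\<close>, row \<open>j + 1\<close>
      and column \<open>i\<close>.\<close>
    then have "(j, j + 1, i) \<in> Eqs" using ij by (auto simp: Eqs_def)
    moreover have "(j, j + 1, i) \<notin> eq_of ` (J - free)" unfolding eq_of_image using ij by auto
    ultimately have "eq_of ` (J - free) \<subset> Eqs" using sub by blast
    then have "card (eq_of ` (J - free)) < card Eqs" using finite_Eqs by (intro psubset_card_mono)
    then show ?thesis using * by simp
  qed
qed

text \<open>The tangent direction carried by a run: the coordinates that the linearised equations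
  link to \<open>(k, i, j)\<close> on its right get the common value 1. The run ends where it
  crosses the arrow into vertex \<open>i\<close> or \<open>j\<close>, or where \<open>i\<close>
  enters the collection.\<close>

definition run :: "nat \<times> nat \<times> nat \<Rightarrow> nat \<times> nat \<times> nat \<Rightarrow> complex"
  where "run = (\<lambda>(k, i, j) (m, i', j'). if i' = i \<and> j' = j \<and> k \<le> m \<and> m \<le> n \<and> i \<notin> S m \<and>
    i \<notin> {k<..m} \<and> j \<notin> {k<..m} then 1 else 0)"

lemma run_in_coord_space: 
  assumes "e \<in> J" shows "run e \<in> coord_space J"
proof -
  obtain k i j where e: "e = (k, i, j)" by (metis prod_cases3)
  have "(m, i, j) \<in> J" if "k \<le> m" "m \<le> n" "i \<notin> S m" "j \<notin> {k<..m}" for m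
    using that assms S_mono[of j k m] unfolding e J_iff by auto
  then show ?thesis by (auto simp: run_def coord_space_def e)
qed

lemma lin_run:
  assumes e: "e \<in> free" and c: "c \<in> Eqs"
  shows "lin c (run e) = 0"
proof -
  obtain k i j where e': "e = (k, i, j)" by (metis prod_cases3)
  obtain m i' j' where c': "c = (m, i', j')" by (metis prod_cases3)
  have k: "1 \<le> k" "k \<le> n" "i \<in> U" "i \<notin> S k" "j \<in> S k" "k = 1 \<or> j \<notin> S (k - 1) \<or> j = k"
    "k < j \<Longrightarrow> j \<le> n \<Longrightarrow> i \<notin> S j \<Longrightarrow> k < i \<and> i \<le> j"
    using e unfolding e' by (auto simp: free_def J_iff right_cut_def)
  have m: "1 \<le> m" "m < n" "j' \<in> S m" "i' \<in> U" "i' \<notin> S (m + 1)"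
    using c unfolding c' by (auto simp: Eqs_def)
  have iS: "i' \<notin> S m" if "i' \<noteq> m + 1" using S_step[of m i'] m that by auto
  show ?thesis
  proof (cases "i' = i \<and> j' = j")
    case True
    consider "k \<le> m" | "m + 1 = k" | "m + 1 < k" by linarith
    then show ?thesis
    proof cases
      case 1
      \<comment> \<open>At the arrow into vertex \<open>j\<close> the equation demands the value 0
        at \<open>m\<close>. As \<open>e\<close> is not right-cut, the arrow into vertex
        \<open>i\<close> was crossed earlier, so the run has already ended.\<close>
      have "i \<in> {k<..m}" if "i \<noteq> m + 1" "j = m + 1"
        using k(7) m True 1 that by auto
      then show ?thesis using True 1 m iS unfolding e' c' by (auto simp: run_def)
    next
      case 2
      then show ?thesis using True k m unfolding e' c' by (auto simp: run_def)
    qed (auto simp: run_def e' c')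
  qed (auto simp: run_def e' c')
qed

text \<open>Only coordinates with one fixed row \<open>i\<close> and column \<open>j\<close> are
  nonzero. A nonzero product would need its middle index to equal both of them, but row and column
  indices are disjoint. Thus the whole line spanned by a run satisfies the quadratic
  equations.\<close>

lemma quad_run:
  assumes e: "e \<in> J"
  shows "quad c (fscale t (run e)) = 0"
proof -
  obtain k i j where e': "e = (k, i, j)" by (metis prod_cases3)
  obtain m i' j' where c': "c = (m, i', j')" by (metis prod_cases3)
  have "i \<noteq> j" using e unfolding e' by (auto simp: J_iff)
  then show ?thesis unfolding c' e' by (auto simp: run_def fscale_def intro!: sum.neutral split: if_splits)
qed

text \<open>A run that starts at a free coordinate meets no other one: at a later coordinate of the
  run, \<open>j\<close> is inherited from the vertex before and is not the vertex itself, which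
  excludes it from \<open>free\<close>.\<close>

lemma run_free:
  assumes e: "e \<in> free" and e': "e' \<in> free"
  shows "run e e' = (if e = e' then 1 else 0)"
proof -
  obtain k i j m i' j' where ee: "e = (k, i, j)" "e' = (m, i', j')" by (metis prod_cases3)
  have k: "1 \<le> k" "k \<le> n" "i \<in> U" "i \<notin> S k" "j \<in> S k"
    using e unfolding ee by (auto simp: free_def J_iff)
  have m: "1 \<le> m" "m \<le> n" "i' \<in> U" "i' \<notin> S m" "j' \<in> S m" "m = 1 \<or> j' \<notin> S (m - 1) \<or> j' = m"
    using e' unfolding ee by (auto simp: free_def J_iff)
  have "False" if "i' = i" "j' = j" "k < m" "j \<notin> {k<..m}"
  proof -
    have "j \<in> S (m - 1)" by (rule S_mono[of j k]) (use that k m in auto)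
    then show False using that k m by auto
  qed
  then show ?thesis using k m unfolding ee run_def by (cases "k < m") auto
qed

lemma lin_add: "lin e (u + v) = lin e u + lin e v"
  and lin_scale: "lin e (fscale c v) = c * lin e v"
  by (cases e; auto simp: fscale_def algebra_simps)+

lemma lin_sum: "lin e (\<Sum>a\<in>A. f a) = (\<Sum>a\<in>A. lin e (f a))"
  by (cases e) (auto simp: sum_fun_apply sum_subtractf)

text \<open>Right-cut coordinates vanish by induction from the right end of their run. All others
  are traced to the left, until a free coordinate or a left cut is reached.\<close>

lemma linear_solution_zero:
  assumes v: "\<And>e. e \<in> Eqs \<Longrightarrow> lin e v = 0" and E: "\<And>e. e \<in> free \<Longrightarrow> v e = 0"
  shows "(k, i, j) \<in> J \<Longrightarrow> v (k, i, j) = 0"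
proof -
  have rc: "v (k, i, j) = 0" if "(k, i, j) \<in> J" "right_cut k i j" for k
    using that
  proof (induction "j - k" arbitrary: k rule: less_induct)
    case less
    have "k < j" using less.prems by (auto simp: right_cut_def)
    note step = right_cut_step[OF less.prems]
    have "v (k, i, j) = (if j = k + 1 then 0 else v (k + 1, i, j))"
      using v[OF step(1)] step(2) by (auto split: if_splits)
    moreover have "v (k + 1, i, j) = 0" if "j \<noteq> k + 1"
      using less.hyps[of "k + 1"] step(3)[OF that] \<open>k < j\<close> by auto
    ultimately show ?case by simp
  qed
  have nrc: "v (k, i, j) = 0" if "(k, i, j) \<in> J" "\<not> right_cut k i j" for k
    using that
  proof (induction k rule: less_induct)
    case (less k)
    show ?case
    proof (cases "(k, i, j) \<in> free")
      case False
      note step = left_step[OF less.prems False]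
      have "v (k, i, j) = (if i = k then 0 else v (k - 1, i, j))"
        using v[OF step(2)] step(1,3) by (auto split: if_splits)
      moreover have "v (k - 1, i, j) = 0" if "i \<noteq> k"
        using less.IH[of "k - 1"] step(1) step(4)[OF that] by auto
      ultimately show ?thesis by simp
    qed (use E in auto)
  qed
  show "(k, i, j) \<in> J \<Longrightarrow> v (k, i, j) = 0" using rc nrc by blast
qed

lemma linear_solution_expand:
  assumes v: "v \<in> coord_space J" "\<And>e. e \<in> Eqs \<Longrightarrow> lin e v = 0"
  shows "v = (\<Sum>e\<in>free. fscale (v e) (run e))"
proof
  fix x
  define u where "u = v + fscale (-1) (\<Sum>e\<in>free. fscale (v e) (run e))"
  have u1: "lin e u = 0" if "e \<in> Eqs" for e
    unfolding u_def lin_add lin_scale lin_sum using v(2)[OF that] lin_run[OF _ that]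
    by (simp del: lin.simps)
  have u2: "u e = 0" if "e \<in> free" for e
  proof -
    have "(\<Sum>e'\<in>free. fscale (v e') (run e')) e = (\<Sum>e'\<in>free. if e' = e then v e' else 0)"
      unfolding sum_fun_apply fscale_def using that by (intro sum.cong) (auto simp: run_free)
    then show ?thesis using that finite_free by (simp add: u_def fscale_def)
  qed
  show "v x = (\<Sum>e\<in>free. fscale (v e) (run e)) x"
  proof (cases "x \<in> J")
    case True
    obtain k i j where "x = (k, i, j)" by (metis prod_cases3)
    then have "u x = 0" using linear_solution_zero[of u, OF u1 u2] True by blast
    then show ?thesis by (simp add: u_def fscale_def)
  next
    case False
    have "run e x = 0" if "e \<in> free" for e
      using run_in_coord_space[of e] free_sub that False unfolding coord_space_def by blast
    moreover have "v x = 0" using v(1) False unfolding coord_space_def by blast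
    ultimately show ?thesis by (simp add: sum_fun_apply fscale_def)
  qed
qed

section \<open>The tangent space as the kernel of the linear parts\<close>

lemma J_of_Eqs:
  assumes "(k, i, j) \<in> Eqs"
  shows "i \<noteq> k + 1 \<Longrightarrow> (k, i, j) \<in> J" "j \<noteq> k + 1 \<Longrightarrow> (k + 1, i, j) \<in> J"
    "l \<in> S (k + 1) - S k - {k + 1} \<Longrightarrow> (k + 1, i, l) \<in> J \<and> (k, l, j) \<in> J"
  using assms S_step[of k i] S_step[of k j] S_sub[of "k + 1"] by (auto simp: Eqs_def J_iff)

lemma equation_poly_fun:
  assumes e: "e \<in> Eqs"
  shows "(\<lambda>y. lin e y - quad e y) \<in> poly_funs J"
proof -
  obtain k i j where e': "e = (k, i, j)" by (metis prod_cases3)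
  note J = J_of_Eqs[OF e[unfolded e']]
  have "(\<lambda>y. if i = k + 1 then 0 else y (k, i, j)) \<in> poly_funs J"
    using J(1) by (cases "i = k + 1") (auto intro: poly_funs.intros)
  moreover have "(\<lambda>y. if j = k + 1 then 0 else y (k + 1, i, j)) \<in> poly_funs J"
    using J(2) by (cases "j = k + 1") (auto intro: poly_funs.intros)
  moreover have "quad e \<in> poly_funs J" unfolding e' quad.simps
    using J(3) by (intro poly_funs_sum poly_funs.mult poly_funs.var) auto
  ultimately show ?thesis unfolding e' lin.simps by (intro poly_funs_diff)
qed

lemma tangent_space_eq:
  "tangent_space J Z 0 = {v \<in> coord_space J. \<forall>e\<in>Eqs. lin e v = 0}"
proof (intro equalityI subsetI CollectI conjI ballI)
  fix v assume v: "v \<in> tangent_space J Z 0"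
  then show "v \<in> coord_space J" by (auto simp: tangent_space_def)
  fix e assume e: "e \<in> Eqs"
  \<comment> \<open>Along a line through the origin the quadratic part is of second order, so the
    derivative of the equation at 0 is its linear part.\<close>
  have q: "quad e (fscale t v) = t * t * quad e v" for t
    by (cases e) (auto simp: fscale_def sum_distrib_left algebra_simps intro!: sum.cong)
  have "((\<lambda>t::complex. lin e (0 + fscale t v) - quad e (0 + fscale t v)) has_field_derivative 0) (at 0)"
  proof -
    have D: "\<forall>f \<in> poly_funs J. (\<forall>x\<in>Z. f x = 0) \<longrightarrow>
        ((\<lambda>t::complex. f (0 + fscale t v)) has_field_derivative 0) (at 0)"
      using v unfolding tangent_space_def by blast
    have "\<forall>y\<in>Z. lin e y - quad e y = 0" using e by (simp add: Z_iff del: lin.simps quad.simps)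
    then show ?thesis using D[THEN bspec, OF equation_poly_fun[OF e]] by simp
  qed
  then have "((\<lambda>t. t * lin e v - t * t * quad e v) has_field_derivative 0) (at 0)"
    by (simp add: lin_scale q del: lin.simps quad.simps)
  moreover have "((\<lambda>t. t * lin e v - t * t * quad e v) has_field_derivative lin e v) (at 0)"
    by (auto intro!: derivative_eq_intros simp del: lin.simps quad.simps)
  ultimately show "lin e v = 0" using DERIV_unique by blast
next
  fix v assume v: "v \<in> {v \<in> coord_space J. \<forall>e\<in>Eqs. lin e v = 0}"
  \<comment> \<open>The whole line through \<open>run e\<close> lies in \<open>Z\<close>, so every
    polynomial that vanishes on \<open>Z\<close> is constant along it. This avoids having to know
    whether the equations generate a radical ideal.\<close>
  have "run e \<in> tangent_space J Z 0" if e: "e \<in> free" for e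
  proof -
    have eJ: "e \<in> J" using e free_sub by auto
    have "fscale t (run e) \<in> coord_space J" for t
      using run_in_coord_space[OF eJ] by (auto simp: coord_space_def fscale_def)
    then have "fscale t (run e) \<in> Z" for t
      unfolding Z_iff using lin_run[OF e] quad_run[OF eJ]
      by (auto simp: lin_scale simp del: lin.simps quad.simps)
    then show ?thesis using run_in_coord_space[OF eJ] by (auto simp: tangent_space_def)
  qed
  then have 1: "(\<Sum>e\<in>free. fscale (v e) (run e)) \<in> tangent_space J Z 0"
    using subspace_tangent_space[of J Z 0] by (intro cvs.subspace_sum cvs.subspace_scale)
  have "v = (\<Sum>e\<in>free. fscale (v e) (run e))" using v by (intro linear_solution_expand) auto
  then show "v \<in> tangent_space J Z 0" using 1 by metis
qed

lemma dim_tangent_space: "cvs.dim (tangent_space J Z 0) = card free"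
proof -
  have "inj_on run free \<and> cvs.independent (run ` free)"
  proof (rule cvs_independent_family[OF finite_free], intro ballI)
    fix c e assume 0: "(\<Sum>a\<in>free. fscale (c a) (run a)) = 0" and e: "e \<in> free"
    have "(\<Sum>a\<in>free. fscale (c a) (run a)) e = (\<Sum>a\<in>free. if a = e then c a else 0)"
      unfolding sum_fun_apply fscale_def using e by (intro sum.cong) (auto simp: run_free)
    then show "c e = 0" using 0 e finite_free by simp
  qed
  moreover have "run ` free \<subseteq> tangent_space J Z 0"
    unfolding tangent_space_eq using run_in_coord_space free_sub lin_run by auto
  moreover have "tangent_space J Z 0 \<subseteq> cvs.span (run ` free)"
  proof
    fix v assume v: "v \<in> tangent_space J Z 0"
    then have "v = (\<Sum>e\<in>free. fscale (v e) (run e))"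
      unfolding tangent_space_eq by (intro linear_solution_expand) auto
    also have "\<dots> \<in> cvs.span (run ` free)"
      by (intro cvs.span_sum cvs.span_scale cvs.span_base) auto
    finally show "v \<in> cvs.span (run ` free)" .
  qed
  ultimately show ?thesis
    using cvs.dim_unique[of "run ` free" "tangent_space J Z 0" "card free"] by (simp add: card_image)
qed

end

section \<open>Graphs over coordinate subspaces\<close>

lemma triangular_system:
  fixes \<mu> :: "'a \<Rightarrow> nat"
  assumes F: "\<And>v. v \<in> J - E \<Longrightarrow> F v \<in> poly_funs {u\<in>J. \<mu> u < \<mu> v}"
  shows "\<exists>G. (\<forall>v\<in>J. G v \<in> poly_funs E) \<and> (\<forall>z. \<forall>e\<in>E. G e z = z e) \<and>
    (\<forall>z. \<forall>v\<in>J - E. G v z = F v (\<lambda>u. if u \<in> J then G u z else 0))"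
proof -
  \<comment> \<open>\<open>H m\<close> substitutes the equations into one another \<open>m\<close>
    times. Its initial value 0 is immaterial: by \<open>stable\<close> the component
    \<open>v\<close> no longer changes after \<open>Suc (\<mu> v)\<close> rounds, since it depends
    only on components of smaller rank.\<close>
  define H where "H = rec_nat (\<lambda>v z. if v \<in> E then z v else 0)
     (\<lambda>_ h v z. if v \<in> E then z v else F v (\<lambda>u. h u z))"
  have H0: "H 0 v z = (if v \<in> E then z v else 0)" for v z by (simp add: H_def)
  have HS: "H (Suc m) v z = (if v \<in> E then z v else F v (\<lambda>u. H m u z))" for m v z by (simp add: H_def)
  have poly: "H m v \<in> poly_funs E" if "v \<in> J" for m v
    using that
  proof (induction m arbitrary: v)
    case 0
    show ?case by (cases "v \<in> E") (auto simp: H0[abs_def] intro: poly_funs.intros)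
  next
    case (Suc m)
    show ?case
    proof (cases "v \<in> E")
      case False
      then have "(\<lambda>z. F v (\<lambda>u. H m u z)) \<in> poly_funs E"
        using Suc by (intro poly_funs_compose[OF F[of v]]) auto
      then show ?thesis using False by (simp add: HS[abs_def])
    qed (auto simp: HS[abs_def] intro: poly_funs.intros)
  qed
  have stable: "H (Suc m) v z = H (Suc (\<mu> v)) v z" if "v \<in> J" "\<mu> v \<le> m" for m v z
    using that
  proof (induction "\<mu> v" arbitrary: v m rule: less_induct)
    case less
    show ?case
    proof (cases "v \<in> E")
      case False
      have "F v (\<lambda>u. H m u z) = F v (\<lambda>u. H (\<mu> v) u z)"
      proof (rule poly_funs_cong[OF F])
        fix u assume "u \<in> {u \<in> J. \<mu> u < \<mu> v}"
        then have u: "u \<in> J" "\<mu> u < \<mu> v" by auto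
        obtain m' k where m: "m = Suc m'" "\<mu> v = Suc k" using u(2) less.prems(2) by (metis less_imp_Suc_add Suc_le_D)
        show "H m u z = H (\<mu> v) u z"
          using less.hyps[OF u(2) u(1), of m'] less.hyps[OF u(2) u(1), of k] u(2) less.prems(2) m by simp
      qed (use False less.prems in auto)
      then show ?thesis using False by (simp add: HS)
    qed (simp add: HS)
  qed
  define G where "G v = H (Suc (\<mu> v)) v" for v
  have "G v z = F v (\<lambda>u. if u \<in> J then G u z else 0)" if v: "v \<in> J - E" for v z
  proof -
    have "G v z = F v (\<lambda>u. H (\<mu> v) u z)" using v by (simp add: G_def HS)
    also have "\<dots> = F v (\<lambda>u. if u \<in> J then G u z else 0)"
    proof (rule poly_funs_cong[OF F[OF v]])
      fix u assume "u \<in> {u \<in> J. \<mu> u < \<mu> v}"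
      then have u: "u \<in> J" "\<mu> u < \<mu> v" by auto
      then obtain k where "\<mu> v = Suc k" by (metis less_imp_Suc_add)
      then show "H (\<mu> v) u z = (if u \<in> J then G u z else 0)"
        using u stable[of u k z] by (simp add: G_def)
    qed
    finally show ?thesis .
  qed
  moreover have "G e z = z e" if "e \<in> E" for e z using that by (simp add: G_def HS)
  ultimately show ?thesis using poly by (intro exI[of _ G]) (auto simp: G_def)
qed

text \<open>The flag of coordinate subspaces of the parameter space, lifted to the graph, is a chain
  of irreducible closed sets through the origin.\<close>

lemma local_dim_graph_ge:
  fixes G :: "'a \<Rightarrow> ('a \<Rightarrow> complex) \<Rightarrow> complex"
  assumes E: "finite E" "E \<subseteq> J" and G: "\<And>v. v \<in> J \<Longrightarrow> G v \<in> poly_funs E"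
    and GE: "\<And>e z. e \<in> E \<Longrightarrow> G e z = z e" and G0: "\<And>v. v \<in> J \<Longrightarrow> G v 0 = 0"
    and Z: "\<And>z. (\<lambda>v. if v \<in> J then G v z else 0) \<in> Z"
  shows "enat (card E) \<le> local_dim J Z 0"
proof -
  define \<gamma> where "\<gamma> z = (\<lambda>v. if v \<in> J then G v z else 0)" for z
  \<comment> \<open>The part of the graph over the coordinate subspace of \<open>K\<close>. A point
    \<open>x\<close> can serve as its own parameter vector, because \<open>G v\<close> only reads
    coordinates in \<open>E\<close>.\<close>
  define D where "D K = {x \<in> coord_space J. (\<forall>v\<in>J. x v = G v x) \<and> (\<forall>e\<in>E - K. x e = 0)}" for K
  have \<gamma>: "\<gamma> z \<in> D K" if "\<forall>e\<in>E - K. z e = 0" for z K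
  proof -
    have "G v (\<gamma> z) = G v z" if "v \<in> J" for v
      by (rule poly_funs_cong[OF G[OF that]]) (use E GE in \<open>auto simp: \<gamma>_def\<close>)
    then show ?thesis using that GE E by (auto simp: D_def coord_space_def \<gamma>_def)
  qed
  have D: "\<gamma> x = x" if "x \<in> D K" for x K
    using that by (auto simp: D_def \<gamma>_def fun_eq_iff coord_space_def)
  have closed: "zariski_closed J (D K)" for K
    unfolding zariski_closed_def
  proof (intro exI[of _ "(\<lambda>v x. x v - G v x) ` J \<union> (\<lambda>e x. x e) ` (E - K)"] conjI)
    have "poly_funs E \<subseteq> poly_funs J"
      using poly_funs_compose[of _ E "\<lambda>x. x" J] E(2) by (auto intro: poly_funs.intros)
    then show "(\<lambda>v x. x v - G v x) ` J \<union> (\<lambda>e x. x e) ` (E - K) \<subseteq> poly_funs J"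
      using G E(2) by (auto intro!: poly_funs_diff intro: poly_funs.intros)
  qed (simp add: D_def ball_Un)
  have irr: "irreducible_closed J (D K)" if K: "K \<subseteq> E" for K
    unfolding irreducible_closed_def
  proof (intro conjI allI impI closed)
    have "\<gamma> 0 \<in> D K" by (rule \<gamma>) simp
    then show "D K \<noteq> {}" by blast
    fix A B assume A: "zariski_closed J A" and B: "zariski_closed J B" and AB: "D K = A \<union> B"
    show "A = D K \<or> B = D K"
    proof (rule ccontr)
      assume "\<not> ?thesis"
      then obtain a b where ab: "a \<in> D K" "a \<notin> A" "b \<in> D K" "b \<notin> B" using AB by blast
      then have abJ: "a \<in> coord_space J" "b \<in> coord_space J" by (auto simp: D_def)
      obtain f where f: "f \<in> poly_funs J" "\<forall>x\<in>A. f x = 0" "f a \<noteq> 0"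
        using A ab(2) abJ unfolding zariski_closed_def by blast
      obtain g where g: "g \<in> poly_funs J" "\<forall>x\<in>B. g x = 0" "g b \<noteq> 0"
        using B ab(4) abJ unfolding zariski_closed_def by blast
      \<comment> \<open>Cutting off the parameters outside \<open>K\<close> turns functions on
        \<open>D K\<close> into polynomials in the variables \<open>K\<close>. Irreducibility then
        follows from the absence of zero divisors among these.\<close>
      define r where "r z = (\<lambda>e. if e \<in> K then z e else 0 :: complex)" for z
      have r: "\<gamma> (r z) \<in> D K" for z by (rule \<gamma>) (auto simp: r_def)
      have pull: "(\<lambda>z. h (\<gamma> (r z))) \<in> poly_funs K" if "h \<in> poly_funs J" for h
      proof -
        have "(\<lambda>z. r z e) \<in> poly_funs K" for e
          by (cases "e \<in> K") (auto simp: r_def intro: poly_funs.intros)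
        then have "(\<lambda>z. G v (r z)) \<in> poly_funs K" if "v \<in> J" for v
          using poly_funs_compose[OF G[OF that]] by blast
        then show ?thesis using that by (intro poly_funs_compose[OF that]) (auto simp: \<gamma>_def)
      qed
      have "f (\<gamma> (r z)) * g (\<gamma> (r z)) = 0" for z using r[of z] AB f(2) g(2) by auto
      then have "(\<forall>z\<in>coord_space K. f (\<gamma> (r z)) = 0) \<or> (\<forall>z\<in>coord_space K. g (\<gamma> (r z)) = 0)"
        using poly_funs_mult_eq_0[OF pull[OF f(1)] pull[OF g(1)]] by blast
      moreover have "\<gamma> (r (r x)) = x \<and> r x \<in> coord_space K" if x: "x \<in> D K" for x
      proof -
        have "\<gamma> (r (r x)) = \<gamma> x"
        proof
          fix v show "\<gamma> (r (r x)) v = \<gamma> x v"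
            using poly_funs_cong[OF G, of v "r (r x)" x] x unfolding \<gamma>_def
            by (auto simp: r_def D_def)
        qed
        then show ?thesis using D[OF x] by (simp add: r_def coord_space_def)
      qed
      ultimately show False using ab f(3) g(3) by metis
    qed
  qed
  obtain en where en: "bij_betw en {..<card E} E"
    using ex_bij_betw_nat_finite[OF E(1)] by (auto simp: lessThan_atLeast0)
  define C where "C d = D (en ` {..<d})" for d
  have enE: "en ` {..<d} \<subseteq> E" if "d \<le> card E" for d
    using en that by (auto simp: bij_betw_def)
  have 1: "irreducible_closed J (C d) \<and> 0 \<in> C d \<and> C d \<subseteq> Z" if "d \<le> card E" for d
  proof (intro conjI)
    show "irreducible_closed J (C d)" unfolding C_def by (rule irr[OF enE[OF that]])
    have "\<gamma> 0 = 0" using G0 by (auto simp: \<gamma>_def fun_eq_iff)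
    then show "0 \<in> C d" unfolding C_def using \<gamma>[of "en ` {..<d}" 0] by simp
    show "C d \<subseteq> Z"
    proof
      fix x assume "x \<in> C d"
      then have "\<gamma> x = x" using D unfolding C_def by blast
      moreover have "\<gamma> x \<in> Z" unfolding \<gamma>_def by (rule Z)
      ultimately show "x \<in> Z" by simp
    qed
  qed
  have 2: "C d \<subset> C (Suc d)" if "d < card E" for d
  proof
    show "C d \<subseteq> C (Suc d)" unfolding C_def D_def by auto
    let ?z = "\<lambda>e. if e = en d then 1 else 0 :: complex"
    have "en d \<noteq> en x" if "x < d" for x
      using inj_onD[of en "{..<card E}" d x] en that \<open>d < card E\<close> by (auto simp: bij_betw_def)
    then have d: "en d \<in> E" "en d \<notin> en ` {..<d}"
      using en that by (auto simp: bij_betw_def)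
    have "\<gamma> ?z \<in> C (Suc d)" unfolding C_def by (rule \<gamma>) auto
    moreover have "\<gamma> ?z (en d) = 1" using d E GE by (auto simp: \<gamma>_def)
    then have "\<gamma> ?z \<notin> C d" using d unfolding C_def D_def by auto
    ultimately show "C d \<noteq> C (Suc d)" by blast
  qed
  show ?thesis unfolding local_dim_def
    by (rule Sup_upper, rule CollectI, rule exI[of _ "card E"], intro conjI refl exI[of _ C])
      (use 1 2 in blast)+
qed

section \<open>The chart at a point satisfying the smoothness condition\<close>

context admissible_collection begin

text \<open>The copies of \<open>w i\<close> at consecutive vertices form the summands of \<open>M\<close>; \<open>threshold k i\<close> is the
  first vertex of the summand through the copy of \<open>w i\<close> at vertex \<open>k\<close> from which on the collection
  contains the summand. The equations are homogeneous if \<open>(k, i, j)\<close> has weight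
  \<open>threshold k i - threshold k j\<close>, which is positive on the chart.\<close>

definition threshold :: "nat \<Rightarrow> nat \<Rightarrow> nat"
  where "threshold k i = (if i \<le> k then LEAST m. i \<le> m \<and> (m = n + 1 \<or> i \<in> S m)
    else LEAST m. 1 \<le> m \<and> (m = i \<or> i \<in> S m))"

lemma threshold_le:
  assumes "i \<in> S k" "1 \<le> k"
  shows "threshold k i \<le> k"
  using assms unfolding threshold_def by (auto intro!: Least_le)

lemma threshold_gt:
  assumes "i \<notin> S k" "i \<in> U" "1 \<le> k" "k \<le> n"
  shows "k < threshold k i"
proof (cases "i \<le> k")
  case True
  let ?P = "\<lambda>m. i \<le> m \<and> (m = n + 1 \<or> i \<in> S m)"
  have "?P (Least ?P)" by (rule LeastI[of ?P "n + 1"]) (use assms in auto)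
  then have "?P (threshold k i)" using True by (simp add: threshold_def)
  then show ?thesis using S_mono[of i "threshold k i" k] assms by (cases "threshold k i \<le> k") auto
next
  case False
  let ?P = "\<lambda>m. 1 \<le> m \<and> (m = i \<or> i \<in> S m)"
  have "?P (Least ?P)" by (rule LeastI[of ?P i]) (use assms in auto)
  then have "?P (threshold k i)" using False by (simp add: threshold_def)
  then show ?thesis using S_mono[of i "threshold k i" k] assms False by (cases "threshold k i \<le> k") auto
qed

lemma threshold_step: "i \<noteq> k + 1 \<Longrightarrow> threshold (k + 1) i = threshold k i"
  by (auto simp: threshold_def)

text \<open>The grading serves as leading digit in base \<open>n + 1\<close>. The last digit, at
  most \<open>n\<close> for a chart coordinate, breaks ties along a run, where right-cut coordinates
  are solved from the right and all others from the left.\<close>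

definition weight :: "nat \<times> nat \<times> nat \<Rightarrow> nat"
  where "weight = (\<lambda>(k, i, j). (threshold k i - threshold k j) * (n + 1) + (if right_cut k i j then n - k else k))"

text \<open>The comparison of gradings is written with sums to avoid truncated subtraction; the last
  assumption makes the larger grading positive.\<close>

lemma weight_less:
  assumes "1 \<le> k" "k \<le> n" "1 \<le> m" "m \<le> n" "threshold k i + threshold m j' < threshold m i' + threshold k j"
    "threshold m j' < threshold m i'"
  shows "weight (k, i, j) < weight (m, i', j')"
proof -
  let ?a = "threshold k i - threshold k j" and ?b = "threshold m i' - threshold m j'"
  have "?a < ?b" using assms by linarith
  have "weight (k, i, j) < (?a + 1) * (n + 1)" using assms(1,2) by (auto simp: weight_def)
  also have "\<dots> \<le> ?b * (n + 1)" using \<open>?a < ?b\<close> by (intro mult_right_mono) auto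
  also have "\<dots> \<le> weight (m, i', j')" by (simp add: weight_def)
  finally show ?thesis .
qed

text \<open>An index \<open>l\<close> that is new at vertex \<open>k + 1\<close> has threshold
  exactly \<open>k + 1\<close>. So the gradings of the two factors are
  \<open>threshold (k + 1) i - (k + 1)\<close> and \<open>k + 1 - threshold k j\<close>. Both are
  positive and they add up to the grading of \<open>v\<close>, hence each is smaller.\<close>

lemma quad_poly_fun:
  assumes e: "(k, i, j) \<in> Eqs" and v: "v = (k, i, j) \<and> i \<noteq> k + 1 \<or> v = (k + 1, i, j) \<and> j \<noteq> k + 1"
  shows "quad (k, i, j) \<in> poly_funs {u \<in> J. weight u < weight v}"
proof -
  have k: "1 \<le> k" "k < n" "j \<in> S k" "i \<in> U" "i \<notin> S (k + 1)"
    using e by (auto simp: Eqs_def)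
  have i: "k + 1 < threshold (k + 1) i" using threshold_gt[of i "k + 1"] k by auto
  have j: "threshold k j \<le> k" using threshold_le[of j k] k by auto
  have *: "(k + 1, i, l) \<in> {u \<in> J. weight u < weight v} \<and> (k, l, j) \<in> {u \<in> J. weight u < weight v}"
    if l: "l \<in> S (k + 1) - S k - {k + 1}" for l
  proof -
    have J: "(k + 1, i, l) \<in> J" "(k, l, j) \<in> J" using J_of_Eqs(3)[OF e l] by auto
    have tl: "threshold (k + 1) l = threshold k l" using l threshold_step by auto
    have "threshold (k + 1) l \<le> k + 1" using threshold_le[of l "k + 1"] l by auto
    moreover have "k < threshold k l" using threshold_gt[of l k] l k J by (auto simp: J_iff)
    ultimately have "threshold k l = k + 1" "threshold (k + 1) l = k + 1" using tl by auto
    moreover have "threshold (k + 1) i = threshold k i" if "i \<noteq> k + 1" using that threshold_step by auto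
    moreover have "threshold (k + 1) j = threshold k j" if "j \<noteq> k + 1" using that threshold_step by auto
    ultimately have "weight (k + 1, i, l) < weight v" "weight (k, l, j) < weight v"
      using v i j k by (auto intro!: weight_less)
    then show ?thesis using J by auto
  qed
  then show ?thesis unfolding quad.simps by (intro poly_funs_sum poly_funs.mult poly_funs.var) auto
qed

definition solve :: "nat \<times> nat \<times> nat \<Rightarrow> (nat \<times> nat \<times> nat \<Rightarrow> complex) \<Rightarrow> complex"
  where "solve = (\<lambda>(k, i, j) y. if right_cut k i j
    then (if j = k + 1 then 0 else y (k + 1, i, j)) + quad (k, i, j) y
    else (if i = k then 0 else y (k - 1, i, j)) - quad (k - 1, i, j) y)"

lemma solve_poly_fun:
  assumes v: "v \<in> J - free"
  shows "solve v \<in> poly_funs {u \<in> J. weight u < weight v}"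
proof -
  obtain k i j where v': "v = (k, i, j)" by (metis prod_cases3)
  have vJ: "(k, i, j) \<in> J" "(k, i, j) \<notin> free" using v v' by auto
  let ?P = "poly_funs {u \<in> J. weight u < weight v}"
  show ?thesis
  proof (cases "right_cut k i j")
    case True
    note step = right_cut_step[OF vJ(1) True]
    have kn: "k < n" using step(1) by (auto simp: Eqs_def)
    have "(\<lambda>y. if j = k + 1 then 0 else y (k + 1, i, j)) \<in> ?P"
    proof (cases "j = k + 1")
      case False
      have "weight (k + 1, i, j) < weight v"
        using False step True kn threshold_step[of i k] threshold_step[of j k] unfolding weight_def v' by auto
      then show ?thesis using False step by (auto intro: poly_funs.intros)
    qed (auto intro: poly_funs.intros)
    moreover have "quad (k, i, j) \<in> ?P" using step v' by (intro quad_poly_fun) auto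
    ultimately show ?thesis using True by (auto simp: solve_def v' intro: poly_funs.add simp del: quad.simps)
  next
    case False
    note step = left_step[OF vJ(1) False vJ(2)]
    have k: "k - 1 + 1 = k" "1 \<le> k" using step(1) by auto
    have "(\<lambda>y. if i = k then 0 else y (k - 1, i, j)) \<in> ?P"
    proof (cases "i = k")
      case ik: False
      have "weight (k - 1, i, j) < weight v"
        using ik step False k threshold_step[of i "k - 1"] threshold_step[of j "k - 1"] unfolding weight_def v' by auto
      then show ?thesis using ik step by (auto intro: poly_funs.intros)
    qed (auto intro: poly_funs.intros)
    moreover have "quad (k - 1, i, j) \<in> ?P"
      using step(2,3) v' k by (intro quad_poly_fun) auto
    ultimately show ?thesis using False by (auto simp: solve_def v' intro: poly_funs_diff simp del: quad.simps)
  qed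
qed

lemma solve_iff:
  assumes v: "v \<in> J - free"
  shows "y v = solve v y \<longleftrightarrow> lin (eq_of v) y = quad (eq_of v) y"
proof -
  obtain k i j where v': "v = (k, i, j)" by (metis prod_cases3)
  have vJ: "(k, i, j) \<in> J" "(k, i, j) \<notin> free" using v v' by auto
  show ?thesis
  proof (cases "right_cut k i j")
    case True
    then show ?thesis using right_cut_step[OF vJ(1) True]
      by (auto simp: v' solve_def eq_of_def algebra_simps simp del: quad.simps)
  next
    case False
    note step = left_step[OF vJ(1) False vJ(2)]
    have "k - 1 + 1 = k" using step(1) by simp
    then show ?thesis using False step(3)
      by (auto simp: v' solve_def eq_of_def algebra_simps simp del: quad.simps)
  qed
qed

lemma local_dim_ge:
  assumes "smoothness_condition"
  shows "enat (card free) \<le> local_dim J Z 0"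
proof -
  obtain G where G: "\<forall>v\<in>J. G v \<in> poly_funs free" "\<forall>z. \<forall>e\<in>free. G e z = z e"
    "\<forall>z. \<forall>v\<in>J - free. G v z = solve v (\<lambda>u. if u \<in> J then G u z else 0)"
    using triangular_system[of J free solve weight, OF solve_poly_fun] by blast
  show ?thesis
  proof (rule local_dim_graph_ge[OF finite_free free_sub, of G])
    show "G v 0 = 0" if "v \<in> J" for v
      using that
    proof (induction "weight v" arbitrary: v rule: less_induct)
      case less
      show ?case
      proof (cases "v \<in> free")
        case False
        then have "G v 0 = solve v (\<lambda>u. if u \<in> J then G u 0 else 0)" using G(3) less.prems by auto
        also have "\<dots> = solve v 0"
          by (rule poly_funs_cong[OF solve_poly_fun]) (use False less in auto)
        also have "\<dots> = 0" by (cases v) (auto simp: solve_def)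
        finally show ?thesis .
      qed (use G(2) in auto)
    qed
    show "(\<lambda>v. if v \<in> J then G v z else 0) \<in> Z" for z
    proof -
      let ?y = "\<lambda>v. if v \<in> J then G v z else 0"
      have "lin (eq_of v) ?y = quad (eq_of v) ?y" if "v \<in> J - free" for v
        using solve_iff[OF that, of ?y] G(3) that by auto
      \<comment> \<open>Under the condition the matching uses up all equations by cardinality, so
        solving for the coordinates outside \<open>free\<close> satisfies every one of them.\<close>
      moreover have "Eqs = eq_of ` (J - free)"
      proof -
        have "card (eq_of ` (J - free)) = card (J - free)" by (rule card_image[OF inj_on_eq_of])
        also have "\<dots> = card Eqs"
          using card_free(1)[OF assms] card_J_Eqs card_Diff_subset[OF finite_free free_sub]
            card_mono[OF finite_J free_sub] by simp
        finally show ?thesis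
          using eq_of_in_Eqs by (intro card_subset_eq[OF finite_Eqs, symmetric]) auto
      qed
      ultimately show ?thesis unfolding Z_iff by (auto simp: coord_space_def simp del: lin.simps quad.simps)
    qed
  qed (use G in auto)
qed

end

section \<open>Cramer's rule for polynomial coefficients\<close>

lemma poly_funs_det:
  assumes M: "\<And>z. M z \<in> carrier_mat k k"
    and e: "\<And>a b. a < k \<Longrightarrow> b < k \<Longrightarrow> (\<lambda>z. M z $$ (a, b)) \<in> poly_funs K"
  shows "(\<lambda>z. det (M z)) \<in> poly_funs K"
proof -
  have "det (M z) = (\<Sum>p\<in>{p. p permutes {0..<k}}. signof p * (\<Prod>i = 0..<k. M z $$ (i, p i)))" for z
    using M[of z] by (simp add: det_def)
  moreover have "(\<lambda>z. \<Sum>p\<in>{p. p permutes {0..<k}}. signof p * (\<Prod>i = 0..<k. M z $$ (i, p i))) \<in> poly_funs K"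
    using permutes_in_image[of _ "{0..<k}"]
    by (intro poly_funs_sum poly_funs.mult poly_funs_prod e) (auto intro: poly_funs.intros)
  ultimately show ?thesis by simp
qed

text \<open>\<open>g\<close> is the determinant of the system after numbering \<open>S\<close> and
  \<open>T\<close>, and \<open>h\<close> consists of the Cramer numerators. They are fixed before
  \<open>z\<close>, so one pair serves all parameters at which the system has a solution and a
  trivial kernel.\<close>

lemma cramer_poly_funs:
  assumes fin: "finite S" "finite T" and card: "card S = card T"
    and B: "\<And>t j. t \<in> T \<Longrightarrow> j \<in> S \<Longrightarrow> B t j \<in> poly_funs K" and r: "\<And>t. t \<in> T \<Longrightarrow> r t \<in> poly_funs K"
  shows "\<exists>g\<in>poly_funs K. \<exists>h. (\<forall>j\<in>S. h j \<in> poly_funs K) \<and>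
    (\<forall>z y. (\<forall>t\<in>T. (\<Sum>j\<in>S. B t j z * y j) = r t z) \<and>
       (\<forall>c. (\<forall>t\<in>T. (\<Sum>j\<in>S. B t j z * c j) = 0) \<longrightarrow> (\<forall>j\<in>S. c j = 0)) \<longrightarrow>
       g z \<noteq> 0 \<and> (\<forall>j\<in>S. y j = h j z / g z))"
proof -
  define k where "k = card S"
  obtain p where p: "bij_betw p {0..<k} S"
    using ex_bij_betw_nat_finite[OF fin(1)] unfolding k_def by blast
  obtain q where q: "bij_betw q {0..<k} T"
    using ex_bij_betw_nat_finite[OF fin(2)] unfolding k_def card by blast
  have pS: "p a \<in> S" and qT: "q a \<in> T" if "a < k" for a
    using p q that by (auto simp: bij_betw_def)
  define A where "A z = mat k k (\<lambda>(a, b). B (q a) (p b) z)" for z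
  define R where "R z = vec k (\<lambda>a. r (q a) z)" for z
  define ip where "ip = the_inv_into {0..<k} p"
  have ip: "ip j < k" "p (ip j) = j" if "j \<in> S" for j
    using p that the_inv_into_into[of p "{0..<k}" j "{0..<k}"] f_the_inv_into_f[of p "{0..<k}" j]
    by (auto simp: bij_betw_def ip_def)
  define g where "g z = det (A z)" for z
  define h where "h j z = det (replace_col (A z) (R z) (ip j))" for j z
  have A: "A z \<in> carrier_mat k k" for z by (simp add: A_def)
  have g: "g \<in> poly_funs K" unfolding g_def
    by (rule poly_funs_det[OF A]) (auto simp: A_def intro: B pS qT)
  have h: "h j \<in> poly_funs K" if "j \<in> S" for j unfolding h_def
  proof (rule poly_funs_det)
    show "replace_col (A z) (R z) (ip j) \<in> carrier_mat k k" for z using A[of z] by (simp add: replace_col_def)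
    show "(\<lambda>z. replace_col (A z) (R z) (ip j) $$ (a, b)) \<in> poly_funs K" if "a < k" "b < k" for a b
      using that by (cases "b = ip j") (auto simp: replace_col_def A_def R_def intro: B r pS qT)
  qed
  have mult: "(A z *\<^sub>v vec k (\<lambda>b. y (p b))) $ a = (\<Sum>j\<in>S. B (q a) j z * y j)" if "a < k" for z y a
  proof -
    have "(A z *\<^sub>v vec k (\<lambda>b. y (p b))) $ a = (\<Sum>b = 0..<k. B (q a) (p b) z * y (p b))"
      using that by (simp add: A_def scalar_prod_def)
    also have "\<dots> = (\<Sum>j\<in>S. B (q a) j z * y j)"
      by (rule sum.reindex_bij_betw[OF p])
    finally show ?thesis .
  qed
  have sol: "g z \<noteq> 0 \<and> (\<forall>j\<in>S. y j = h j z / g z)"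
    if y: "\<forall>t\<in>T. (\<Sum>j\<in>S. B t j z * y j) = r t z"
      and inj: "\<forall>c. (\<forall>t\<in>T. (\<Sum>j\<in>S. B t j z * c j) = 0) \<longrightarrow> (\<forall>j\<in>S. c j = 0)" for z y
  proof -
    have gz: "g z \<noteq> 0"
    proof
      assume "g z = 0"
      then obtain v where v: "v \<in> carrier_vec k" "v \<noteq> 0\<^sub>v k" "A z *\<^sub>v v = 0\<^sub>v k"
        using det_0_iff_vec_prod_zero_field[OF A] unfolding g_def by blast
      define c where "c j = v $ ip j" for j
      have ipp: "ip (p b) = b" if "b < k" for b
        using p that by (auto simp: bij_betw_def ip_def the_inv_into_f_f)
      have vc: "v = vec k (\<lambda>b. c (p b))" using v(1) by (auto simp: c_def ipp)
      have "(\<Sum>j\<in>S. B t j z * c j) = 0" if t: "t \<in> T" for t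
      proof -
        obtain a where a: "a < k" "t = q a" using q t by (auto simp: bij_betw_def)
        have "(\<Sum>j\<in>S. B t j z * c j) = (A z *\<^sub>v v) $ a" using mult[OF a(1), of z c] a(2) vc by simp
        then show ?thesis using v(3) a(1) by simp
      qed
      then have "\<forall>j\<in>S. c j = 0" using inj by blast
      then have "v = 0\<^sub>v k" using vc pS by (auto simp: vec_eq_iff)
      then show False using v(2) by simp
    qed
    moreover have "y j = h j z / g z" if j: "j \<in> S" for j
    proof -
      let ?v = "vec k (\<lambda>b. y (p b))"
      have "A z *\<^sub>v ?v = R z"
      proof (rule eq_vecI)
        show "(A z *\<^sub>v ?v) $ a = R z $ a" if "a < dim_vec (R z)" for a
          using that mult[of a z y] y qT[of a] by (simp add: R_def)
      qed (simp add: A_def R_def)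
      then have "h j z = y j * g z"
        using cramer_lemma_mat[OF A, of ?v "ip j" z] ip[OF j] by (simp add: h_def g_def)
      then show ?thesis using gz by simp
    qed
    ultimately show ?thesis by blast
  qed
  show ?thesis using g h sol by (intro bexI[of _ g] exI[of _ h]) auto
qed

section \<open>Reduced echelon bases\<close>

text \<open>The set of pivots of \<open>V\<close> for the order given by \<open>\<rho>\<close>,
  which specifies the Schubert cell of \<open>V\<close>.\<close>

definition leading :: "'i set \<Rightarrow> ('i \<Rightarrow> nat) \<Rightarrow> ('i \<Rightarrow> complex) set \<Rightarrow> 'i set"
  where "leading U \<rho> V = {j \<in> U. \<exists>v\<in>V. v j \<noteq> 0 \<and> (\<forall>i. v i \<noteq> 0 \<longrightarrow> \<rho> i \<le> \<rho> j)}"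

lemma zero_on_leading:
  assumes U: "finite U" and V: "V \<subseteq> coord_space U" and v: "v \<in> V" "\<forall>i\<in>leading U \<rho> V. v i = 0"
  shows "v = 0"
proof (rule ccontr)
  assume "v \<noteq> 0"
  let ?N = "{i. v i \<noteq> 0}"
  have sub: "?N \<subseteq> U" using V v(1) by (auto simp: coord_space_def)
  then have fin: "finite ?N" using U finite_subset by blast
  have ne: "?N \<noteq> {}" using \<open>v \<noteq> 0\<close> by (auto simp: fun_eq_iff)
  have "Max (\<rho> ` ?N) \<in> \<rho> ` ?N" using fin ne by (intro Max_in) auto
  then obtain j where "j \<in> ?N" "\<rho> j = Max (\<rho> ` ?N)" by auto
  then have j: "j \<in> ?N" "\<forall>i\<in>?N. \<rho> i \<le> \<rho> j" using fin by auto
  then have "j \<in> leading U \<rho> V" using sub v(1) unfolding leading_def by blast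
  then show False using v(2) j(1) by blast
qed

text \<open>By induction on the rank of the pivot: normalise a vector with leading index
  \<open>j\<close> and clear its entries at smaller pivots with the vectors already found. Its
  entries at larger pivots are 0 from the start.\<close>

lemma echelon_basis:
  assumes U: "finite U" and \<rho>: "inj_on \<rho> U" and sub: "cvs.subspace V" and V: "V \<subseteq> coord_space U"
  defines "T \<equiv> leading U \<rho> V"
  shows "\<exists>b. \<forall>j\<in>T. b j \<in> V \<and> (\<forall>l\<in>T. b j l = (if l = j then 1 else 0)) \<and> (\<forall>i. b j i \<noteq> 0 \<longrightarrow> \<rho> i \<le> \<rho> j)"
proof -
  have TU: "T \<subseteq> U" by (auto simp: T_def leading_def)
  have fT: "finite T" using TU U finite_subset by blast
  let ?P = "\<lambda>j u. u \<in> V \<and> (\<forall>l\<in>T. u l = (if l = j then 1 else 0)) \<and> (\<forall>i. u i \<noteq> 0 \<longrightarrow> \<rho> i \<le> \<rho> j)"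
  have "\<exists>u. ?P j u" if "j \<in> T" for j
    using that
  proof (induction "\<rho> j" arbitrary: j rule: less_induct)
    case less
    define K where "K = {i\<in>T. \<rho> i < \<rho> j}"
    have "\<forall>i\<in>K. \<exists>u. ?P i u" using less.hyps by (auto simp: K_def)
    then obtain b where b: "\<forall>i\<in>K. ?P i (b i)" by (metis (no_types, lifting))
    obtain v0 where v0: "v0 \<in> V" "v0 j \<noteq> 0" "\<forall>i. v0 i \<noteq> 0 \<longrightarrow> \<rho> i \<le> \<rho> j"
      using less.prems by (auto simp: T_def leading_def)
    define v where "v = fscale (1 / v0 j) v0"
    have v: "v \<in> V" "v j = 1" "\<And>i. v i \<noteq> 0 \<Longrightarrow> \<rho> i \<le> \<rho> j"
      using v0 cvs.subspace_scale[OF sub v0(1), of "1 / v0 j"] by (auto simp: v_def fscale_def)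
    define u where "u = v - (\<Sum>i\<in>K. fscale (v i) (b i))"
    have u: "u l = v l - (\<Sum>i\<in>K. v i * b i l)" for l
      by (simp add: u_def sum_fun_apply fscale_def)
    have fK: "finite K" using fT by (simp add: K_def)
    have "u \<in> V" unfolding u_def using b v(1) sub
      by (intro cvs.subspace_diff cvs.subspace_sum cvs.subspace_scale) auto
    moreover have "u l = (if l = j then 1 else 0)" if l: "l \<in> T" for l
    proof (cases "\<rho> l < \<rho> j")
      case True
      then have lK: "l \<in> K" using l by (simp add: K_def)
      have "(\<Sum>i\<in>K. v i * b i l) = (\<Sum>i\<in>K. if i = l then v i else 0)"
        using b l by (intro sum.cong) auto
      then show ?thesis using u lK fK True by auto
    next
      case False
      have "(\<Sum>i\<in>K. v i * b i l) = 0"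
      proof (rule sum.neutral, rule ballI)
        fix i assume i: "i \<in> K"
        then have "b i l = 0" using b False unfolding K_def by fastforce
        then show "v i * b i l = 0" by simp
      qed
      moreover have "v l = 0" if "l \<noteq> j"
      proof (rule ccontr)
        assume "v l \<noteq> 0"
        then have "\<rho> l = \<rho> j" using v(3)[of l] False by simp
        then show False using \<rho> l less.prems TU that by (auto simp: inj_on_def)
      qed
      ultimately show ?thesis using u v(2) by auto
    qed
    moreover have "\<rho> i \<le> \<rho> j" if "u i \<noteq> 0" for i
    proof (rule ccontr)
      assume i: "\<not> \<rho> i \<le> \<rho> j"
      have "b l i = 0" if "l \<in> K" for l
        using b that i unfolding K_def by fastforce
      moreover have "v i = 0" using v(3) i by blast
      ultimately show False using that u by simp
    qed
    ultimately show ?case by blast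
  qed
  then show ?thesis by (metis (no_types, lifting))
qed

lemma echelon_expand:
  fixes \<rho> :: "'i \<Rightarrow> nat"
  assumes U: "finite U" and sub: "cvs.subspace V" and V: "V \<subseteq> coord_space U"
  defines "T \<equiv> leading U \<rho> V"
  assumes b: "\<forall>j\<in>T. b j \<in> V \<and> (\<forall>l\<in>T. b j l = (if l = j then 1 else 0))" and v: "v \<in> V"
  shows "v = (\<Sum>j\<in>T. fscale (v j) (b j))"
proof -
  have "T \<subseteq> U" by (auto simp: T_def leading_def)
  then have fT: "finite T" using U finite_subset by blast
  define u where "u = v - (\<Sum>j\<in>T. fscale (v j) (b j))"
  have "u \<in> V" unfolding u_def using b v sub
    by (intro cvs.subspace_diff cvs.subspace_sum cvs.subspace_scale) auto
  moreover have "u l = 0" if l: "l \<in> T" for l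
  proof -
    have "(\<Sum>j\<in>T. fscale (v j) (b j)) l = (\<Sum>j\<in>T. if j = l then v j else 0)"
      unfolding sum_fun_apply fscale_def using b l by (intro sum.cong) auto
    then show ?thesis using fT l by (simp add: u_def)
  qed
  ultimately have "u = 0" using zero_on_leading[OF U V, of u \<rho>] by (auto simp: T_def)
  then show ?thesis by (simp add: u_def)
qed

lemma card_leading:
  assumes U: "finite U" and \<rho>: "inj_on \<rho> U" and sub: "cvs.subspace V" and V: "V \<subseteq> coord_space U"
  shows "card (leading U \<rho> V) = cvs.dim V"
proof -
  let ?T = "leading U \<rho> V"
  obtain b where b: "\<forall>j\<in>?T. b j \<in> V \<and> (\<forall>l\<in>?T. b j l = (if l = j then 1 else 0))"
    using echelon_basis[OF assms] by blast
  have "?T \<subseteq> U" by (auto simp: leading_def)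
  then have fT: "finite ?T" using U finite_subset by blast
  have "inj_on b ?T \<and> cvs.independent (b ` ?T)"
  proof (rule cvs_independent_family[OF fT], rule ballI)
    fix c l assume 0: "(\<Sum>a\<in>?T. fscale (c a) (b a)) = 0" and l: "l \<in> ?T"
    have "(\<Sum>j\<in>?T. fscale (c j) (b j)) l = (\<Sum>j\<in>?T. if j = l then c j else 0)"
      unfolding sum_fun_apply fscale_def using b l by (intro sum.cong) auto
    then show "c l = 0" using fT l 0 by simp
  qed
  moreover have "V \<subseteq> cvs.span (b ` ?T)"
  proof
    fix v assume "v \<in> V"
    then have "v = (\<Sum>j\<in>?T. fscale (v j) (b j))" by (rule echelon_expand[OF U sub V b])
    also have "\<dots> \<in> cvs.span (b ` ?T)" by (intro cvs.span_sum cvs.span_scale cvs.span_base) auto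
    finally show "v \<in> cvs.span (b ` ?T)" .
  qed
  moreover have "b ` ?T \<subseteq> V" using b by auto
  ultimately show ?thesis using cvs.dim_unique[of "b ` ?T" V "card ?T"] by (simp add: card_image)
qed

section \<open>The cells of the degenerate flag variety\<close>

text \<open>At vertex \<open>k\<close> the indices are ordered as \<open>k+1 < \<dots> < n+1 < 1 < \<dots> < k\<close>. As \<open>pr (k+1)\<close> kills the
  smallest index and \<open>k+1\<close> becomes the largest index at vertex \<open>k+1\<close>, these orders are compatible
  with the maps.\<close>

definition vertex_order :: "nat \<Rightarrow> nat \<Rightarrow> nat \<Rightarrow> nat"
  where "vertex_order n k i = (if i \<le> k then i + n + 1 else i)"

lemma inj_vertex_order: "inj_on (vertex_order n k) {1..n+1}"
  by (auto simp: inj_on_def vertex_order_def)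

text \<open>The pivots that are not inherited along the arrow into vertex \<open>k\<close>. That
  arrow kills \<open>w k\<close>, so a pivot \<open>k\<close> counts as new even if it was present
  before.\<close>

definition new_indices :: "(nat \<Rightarrow> nat set) \<Rightarrow> nat \<Rightarrow> nat set"
  where "new_indices T k = (if k = 1 then T 1 else T k - (T (k - 1) - {k}))"

text \<open>These are the parameters of the cell: columns of inherited pivots are determined by the
  previous vertex, and within a new column only entries below the pivot can be nonzero.\<close>

definition cell_index :: "nat \<Rightarrow> (nat \<Rightarrow> nat set) \<Rightarrow> (nat \<times> nat \<times> nat) set"
  where "cell_index n T = {(k, i, j). k \<in> {1..n} \<and> j \<in> new_indices T k \<and> i \<in> {1..n+1} - T k \<and>
    vertex_order n k i < vertex_order n k j}"

text \<open>The entries of the reduced echelon bases as functions of the entries in the columns that are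
  new at their vertex.\<close>

primrec cell_entry :: "nat \<Rightarrow> (nat \<Rightarrow> nat set) \<Rightarrow> nat \<Rightarrow> nat \<Rightarrow> nat \<Rightarrow> (nat \<times> nat \<times> nat \<Rightarrow> complex) \<Rightarrow> complex"
  where
    "cell_entry n T 0 i j z = 0"
  | "cell_entry n T (Suc k) i j z = (if j \<in> new_indices T (Suc k)
      then (if (Suc k, i, j) \<in> cell_index n T then z (Suc k, i, j) else 0)
      else (if i = Suc k then 0 else cell_entry n T k i j z) -
        (\<Sum>l\<in>new_indices T (Suc k) - {Suc k}. cell_entry n T k l j z *
          (if (Suc k, i, l) \<in> cell_index n T then z (Suc k, i, l) else 0)))"

lemma cell_entry_poly_fun: "cell_entry n T k i j \<in> poly_funs (cell_index n T)"
proof (induction k arbitrary: i j)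
  case 0
  have "cell_entry n T 0 i j = (\<lambda>z. 0)" by (simp add: fun_eq_iff)
  then show ?case by (simp add: poly_funs.const)
next
  case (Suc k)
  have v: "(\<lambda>z. if e \<in> cell_index n T then z e else 0) \<in> poly_funs (cell_index n T)" for e
    by (cases "e \<in> cell_index n T") (auto intro: poly_funs.intros)
  have u: "(\<lambda>z. if i = Suc k then 0 else cell_entry n T k i j z) \<in> poly_funs (cell_index n T)" for i
    using Suc by (cases "i = Suc k") (auto intro: poly_funs.intros)
  have d: "(\<lambda>z. (if i = Suc k then 0 else cell_entry n T k i j z) -
        (\<Sum>l\<in>new_indices T (Suc k) - {Suc k}. cell_entry n T k l j z *
          (if (Suc k, i, l) \<in> cell_index n T then z (Suc k, i, l) else 0))) \<in> poly_funs (cell_index n T)"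
    by (intro poly_funs_diff poly_funs_sum poly_funs.mult u v Suc)
  show ?case
  proof (cases "j \<in> new_indices T (Suc k)")
    case True
    then have "cell_entry n T (Suc k) i j = (\<lambda>z. if (Suc k, i, j) \<in> cell_index n T then z (Suc k, i, j) else 0)"
      by (simp add: fun_eq_iff)
    then show ?thesis using v[of "(Suc k, i, j)"] by simp
  next
    case False
    then have "cell_entry n T (Suc k) i j = (\<lambda>z. (if i = Suc k then 0 else cell_entry n T k i j z) -
        (\<Sum>l\<in>new_indices T (Suc k) - {Suc k}. cell_entry n T k l j z *
          (if (Suc k, i, l) \<in> cell_index n T then z (Suc k, i, l) else 0)))"
      by (simp add: fun_eq_iff)
    then show ?thesis using d by simp
  qed
qed

text \<open>The dimension grows by one, and a further pivot must replace \<open>k\<close> if the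
  arrow into vertex \<open>k\<close> kills it.\<close>

lemma card_new_indices:
  assumes T: "admissible n T" and k: "k \<in> {1..n}"
  shows "card (new_indices T k) = 1 + (if 2 \<le> k \<and> k \<in> T (k - 1) then 1 else 0)"
proof -
  have i: "index_collection n T" using T by (simp add: admissible_def)
  note Tk = index_collectionD[OF i k]
  show ?thesis
  proof (cases "k = 1")
    case False
    then have k1: "k - 1 \<in> {1..n}" "k - 1 + 1 = k" "k - 1 < n" using k by auto
    note Tk1 = index_collectionD[OF i k1(1)]
    have "\<forall>k. 1 \<le> k \<and> k < n \<longrightarrow> T k \<subseteq> T (k + 1) \<union> {k + 1}"
      using T unfolding admissible_def by blast
    from this[rule_format, of "k - 1"] have sub: "T (k - 1) - {k} \<subseteq> T k" using k1 by auto
    have "card (new_indices T k) = card (T k) - card (T (k - 1) - {k})"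
      using False sub Tk1 by (simp add: new_indices_def card_Diff_subset)
    also have "card (T (k - 1) - {k}) = k - 1 - (if k \<in> T (k - 1) then 1 else 0)"
      using Tk1 by (simp add: card_Diff_singleton_if)
    finally show ?thesis using Tk(2) Tk1 False k
      by (cases "k \<in> T (k - 1)") (auto simp: card_gt_0_iff)
  qed (use Tk in \<open>auto simp: new_indices_def\<close>)
qed

lemma finite_cell_index: 
  assumes "admissible n T" shows "finite (cell_index n T)"
proof -
  have "(k, i, j) \<in> {1..n} \<times> {1..n+1} \<times> {1..n+1}" if "(k, i, j) \<in> cell_index n T" for k i j
    using that index_collectionD(1)[of n T k] assms
    by (auto simp: cell_index_def new_indices_def admissible_def split: if_splits)
  then have "cell_index n T \<subseteq> {1..n} \<times> {1..n+1} \<times> {1..n+1}" by auto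
  then show ?thesis by (rule finite_subset) auto
qed

text \<open>A new column at \<open>k\<close> has at most \<open>n + 1 - k\<close> parameters, so one
  column per vertex gives the claimed sum. A second one, at a vertex in \<open>Q\<close>, is
  compensated by a pair in \<open>P\<close>: a pivot \<open>j > k\<close> falls short of the bound
  by at least \<open>n + 2 - j\<close>.\<close>

lemma card_cell_index_le:
  assumes T: "admissible n T"
  shows "card (cell_index n T) \<le> \<Sum>{1..n}"
proof -
  have ic: "index_collection n T" using T by (simp add: admissible_def)
  define c where "c k j = {i \<in> {1..n+1} - T k. vertex_order n k i < vertex_order n k j}" for k j
  define P where "P = (SIGMA k:{1..n}. {j \<in> new_indices T k. k < j})"
  define Q where "Q = {k \<in> {2..n}. k \<in> T (k - 1)}"
  have new_sub: "new_indices T k \<subseteq> T k" for k by (auto simp: new_indices_def)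
  have fin_new: "finite (new_indices T k)" if "k \<in> {1..n}" for k
    using finite_subset[OF new_sub] index_collectionD(3)[OF ic that] by blast
  have fin_c: "finite (c k j)" for k j by (simp add: c_def)
  have "cell_index n T = (\<Union>k\<in>{1..n}. \<Union>j\<in>new_indices T k. {k} \<times> c k j \<times> {j})"
    by (auto simp: cell_index_def c_def)
  then have "card (cell_index n T) \<le> (\<Sum>k\<in>{1..n}. card (\<Union>j\<in>new_indices T k. {k} \<times> c k j \<times> {j}))"
    using card_UN_le[of "{1..n}"] by simp
  also have "\<dots> \<le> (\<Sum>k\<in>{1..n}. \<Sum>j\<in>new_indices T k. card (c k j))"
  proof (rule sum_mono)
    fix k assume "k \<in> {1..n}"
    then show "card (\<Union>j\<in>new_indices T k. {k} \<times> c k j \<times> {j}) \<le> (\<Sum>j\<in>new_indices T k. card (c k j))"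
      using card_UN_le[OF fin_new, of k "\<lambda>j. {k} \<times> c k j \<times> {j}"] by (simp add: card_cartesian_product)
  qed
  finally have 1: "card (cell_index n T) \<le> (\<Sum>k\<in>{1..n}. \<Sum>j\<in>new_indices T k. card (c k j))" .
  \<comment> \<open>For \<open>k < j\<close> only the indices from \<open>k + 1\<close> to
    \<open>j - 1\<close> precede \<open>j\<close>. For \<open>j \<le> k\<close> the bound is the
    size of the complement of \<open>T k\<close>.\<close>
  have cell: "card (c k j) + (if k < j then n + 2 - j else 0) \<le> n + 1 - k"
    if k: "k \<in> {1..n}" and j: "j \<in> new_indices T k" for k j
  proof (cases "k < j")
    case True
    have jn: "j \<le> n + 1" using index_collectionD(1)[OF ic k] new_sub[of k] j by auto
    then have "c k j \<subseteq> {k+1..<j}" using True by (auto simp: c_def vertex_order_def split: if_splits)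
    then have "card (c k j) \<le> j - (k + 1)" using card_mono[of "{k+1..<j}" "c k j"] by simp
    moreover note jn
    ultimately show ?thesis using True by simp
  next
    case False
    have "card (c k j) \<le> card ({1..n+1} - T k)" by (intro card_mono) (auto simp: c_def)
    then show ?thesis using index_collectionD[OF ic k] False by (simp add: card_Diff_subset)
  qed
  have X: "(\<Sum>k\<in>{1..n}. \<Sum>j\<in>new_indices T k. if k < j then n + 2 - j else 0) = (\<Sum>(k, j)\<in>P. n + 2 - j)"
    unfolding P_def using fin_new
    by (subst sum.Sigma[symmetric]) (auto simp: sum.If_cases Int_def conj_commute intro!: sum.cong)
  have "(\<Sum>k\<in>{1..n}. \<Sum>j\<in>new_indices T k. card (c k j)) + (\<Sum>(k, j)\<in>P. n + 2 - j)
      = (\<Sum>k\<in>{1..n}. \<Sum>j\<in>new_indices T k. card (c k j) + (if k < j then n + 2 - j else 0))"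
    unfolding X[symmetric] by (simp add: sum.distrib)
  also have "\<dots> \<le> (\<Sum>k\<in>{1..n}. \<Sum>j\<in>new_indices T k. n + 1 - k)"
    by (intro sum_mono cell)
  also have "\<dots> = (\<Sum>k\<in>{1..n}. (n + 1 - k) + (if k \<in> Q then n + 1 - k else 0))"
    by (intro sum.cong refl) (simp add: card_new_indices[OF T] Q_def)
  also have "\<dots> = (\<Sum>k\<in>{1..n}. n + 1 - k) + (\<Sum>k\<in>Q. n + 1 - k)"
  proof -
    have "(\<Sum>k\<in>{1..n}. if k \<in> Q then n + 1 - k else 0) = (\<Sum>k\<in>Q. n + 1 - k)"
      by (rule sum.mono_neutral_cong_right) (auto simp: Q_def)
    then show ?thesis by (simp only: sum.distrib)
  qed
  also have "(\<Sum>k\<in>Q. n + 1 - k) \<le> (\<Sum>(k, j)\<in>P. n + 2 - j)"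
  proof -
    \<comment> \<open>An index killed by the arrow into vertex \<open>j\<close> must have become a
      pivot at an earlier vertex; \<open>m\<close> is the first vertex that has it. Since
      \<open>m < j\<close>, its shortfall there, \<open>n + 2 - j\<close>, covers the surplus
      \<open>n + 1 - j\<close> at vertex \<open>j\<close>.\<close>
    have "\<exists>m. (m, j) \<in> P" if j: "j \<in> Q" for j
    proof -
      let ?R = "\<lambda>m. 1 \<le> m \<and> j \<in> T m"
      define m where "m = (LEAST m. ?R m)"
      have Rj: "?R (j - 1)" using j by (auto simp: Q_def)
      have m: "?R m" "m \<le> j - 1"
        using LeastI[of ?R, OF Rj] Least_le[of ?R, OF Rj] by (simp_all add: m_def)
      have "\<not> ?R (m - 1)" using m(1) not_less_Least[of "m - 1" ?R] by (auto simp: m_def)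
      then have "j \<in> new_indices T m" using m by (auto simp: new_indices_def)
      then show ?thesis using m j by (auto simp: P_def Q_def intro!: exI[of _ m])
    qed
    then obtain f where f: "\<And>j. j \<in> Q \<Longrightarrow> (f j, j) \<in> P" by metis
    have "(\<Sum>k\<in>Q. n + 1 - k) \<le> (\<Sum>j\<in>Q. n + 2 - j)" by (intro sum_mono) auto
    also have "\<dots> = (\<Sum>(k, j)\<in>(\<lambda>j. (f j, j)) ` Q. n + 2 - j)"
      by (subst sum.reindex) (auto simp: inj_on_def)
    also have "\<dots> \<le> (\<Sum>(k, j)\<in>P. n + 2 - j)"
      by (rule sum_mono2) (use f fin_new in \<open>auto simp: P_def\<close>)
    finally show ?thesis .
  qed
  finally have "(\<Sum>k\<in>{1..n}. \<Sum>j\<in>new_indices T k. card (c k j)) \<le> (\<Sum>k\<in>{1..n}. n + 1 - k)" by simp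
  also have "\<dots> = \<Sum>{1..n}"
    by (rule sum.reindex_bij_witness[of _ "\<lambda>k. n + 1 - k" "\<lambda>k. n + 1 - k"]) auto
  finally show ?thesis using 1 by simp
qed

lemma cell_of_point:
  assumes V: "V \<in> degenerate_flag_variety n"
  defines "T \<equiv> (\<lambda>k\<in>{1..n}. leading {1..n+1} (vertex_order n k) (V k))"
  shows "admissible n T" and "\<exists>b z. \<forall>k\<in>{1..n}. \<forall>j\<in>T k. b k j \<in> V k \<and>
      (\<forall>m. b k j m = (if m = j then 1 else if m \<in> {1..n+1} - T k then cell_entry n T k m j z else 0)) \<and>
      (\<forall>v\<in>V k. v = (\<Sum>j\<in>T k. fscale (v j) (b k j)))"
proof -
  let ?U = "{1..n+1}"
  have Vk: "cvs.subspace (V k)" "V k \<subseteq> coord_space ?U" "cvs.dim (V k) = k" if "k \<in> {1..n}" for k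
    using V that by (auto simp: degenerate_flag_variety_def prod_Gr_def Gr_def W_def dest!: PiE_mem)
  have Tk: "T k = leading ?U (vertex_order n k) (V k)" if "k \<in> {1..n}" for k
    using that by (simp add: T_def)
  have TU: "T k \<subseteq> ?U" if "k \<in> {1..n}" for k using Tk[OF that] by (auto simp: leading_def)
  have pr_V: "pr (k+1) v \<in> V (k+1)" if "1 \<le> k" "k < n" "v \<in> V k" for k v
    using V that by (auto simp: degenerate_flag_variety_def)
  have ind: "index_collection n T"
    using Tk TU card_leading[OF _ inj_vertex_order Vk(1,2)] Vk(3) by (auto simp: index_collection_def)
  \<comment> \<open>A projected vector keeps its leading index \<open>j\<close>, as only index
    \<open>k + 1\<close> is erased and the order of the others is the same at both vertices. Thus
    pivots form an admissible collection.\<close>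
  have step: "j \<in> T (k+1)" if k: "1 \<le> k" "k < n" and j: "j \<in> T k" "j \<noteq> k+1" for k j
  proof -
    have kk: "k \<in> {1..n}" "k+1 \<in> {1..n}" using k by auto
    obtain v where v: "v \<in> V k" "v j \<noteq> 0" "\<forall>i. v i \<noteq> 0 \<longrightarrow> vertex_order n k i \<le> vertex_order n k j"
      using j(1) Tk[OF kk(1)] by (auto simp: leading_def)
    have vo: "vertex_order n (k+1) i = vertex_order n k i" if "i \<noteq> k+1" for i
      using that by (auto simp: vertex_order_def)
    have "\<forall>i. pr (k+1) v i \<noteq> 0 \<longrightarrow> vertex_order n (k+1) i \<le> vertex_order n (k+1) j"
    proof (intro allI impI)
      fix i assume "pr (k+1) v i \<noteq> 0"
      then have "i \<noteq> k+1" "v i \<noteq> 0" by (auto simp: pr_def split: if_splits)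
      then show "vertex_order n (k+1) i \<le> vertex_order n (k+1) j" using v(3) vo j(2) by simp
    qed
    moreover have "pr (k+1) v j \<noteq> 0" using v(2) j(2) by (simp add: pr_def)
    ultimately show ?thesis using pr_V[OF k v(1)] j(1) TU[OF kk(1)] unfolding Tk[OF kk(2)] leading_def by blast
  qed
  show adm: "admissible n T" unfolding admissible_def using ind step by blast
  have "\<forall>k\<in>{1..n}. \<exists>b. \<forall>j\<in>T k. b j \<in> V k \<and> (\<forall>l\<in>T k. b j l = (if l = j then 1 else 0)) \<and>
      (\<forall>i. b j i \<noteq> 0 \<longrightarrow> vertex_order n k i \<le> vertex_order n k j)"
    using echelon_basis[OF _ inj_vertex_order Vk(1,2)] Tk by simp
  from bchoice[OF this] obtain b where "\<forall>k\<in>{1..n}. \<forall>j\<in>T k. b k j \<in> V k \<and>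
      (\<forall>l\<in>T k. b k j l = (if l = j then 1 else 0)) \<and>
      (\<forall>i. b k j i \<noteq> 0 \<longrightarrow> vertex_order n k i \<le> vertex_order n k j)" by blast
  then have b: "\<And>k j. k \<in> {1..n} \<Longrightarrow> j \<in> T k \<Longrightarrow> b k j \<in> V k"
    "\<And>k j l. k \<in> {1..n} \<Longrightarrow> j \<in> T k \<Longrightarrow> l \<in> T k \<Longrightarrow> b k j l = (if l = j then 1 else 0)"
    "\<And>k j i. k \<in> {1..n} \<Longrightarrow> j \<in> T k \<Longrightarrow> b k j i \<noteq> 0 \<Longrightarrow> vertex_order n k i \<le> vertex_order n k j"
    by blast+
  have expand: "v = (\<Sum>j\<in>T k. fscale (v j) (b k j))" if k: "k \<in> {1..n}" and v: "v \<in> V k" for k v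
    unfolding Tk[OF k] using b[OF k] v unfolding Tk[OF k] by (intro echelon_expand[OF _ Vk(1,2)[OF k]]) auto
  define z where "z = (\<lambda>(k, i, j). b k j i)"
  \<comment> \<open>Entries of new columns that are not parameters vanish, because the basis is in
    echelon form.\<close>
  have zb: "(if (k, i, j) \<in> cell_index n T then z (k, i, j) else 0) = b k j i"
    if k: "k \<in> {1..n}" and j: "j \<in> new_indices T k" and i: "i \<in> ?U - T k" for k i j
  proof -
    have jT: "j \<in> T k" using j by (auto simp: new_indices_def split: if_splits)
    have "b k j i = 0" if "\<not> vertex_order n k i < vertex_order n k j"
    proof (rule ccontr)
      assume "b k j i \<noteq> 0"
      then have "vertex_order n k i = vertex_order n k j" using b(3)[OF k jT] that by fastforce
      then have "i = j" using inj_vertex_order[of n k] i jT TU[OF k] by (auto simp: inj_on_def)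
      then show False using i jT by auto
    qed
    then show ?thesis using k j i by (auto simp: cell_index_def z_def)
  qed
  have entry: "b k j i = cell_entry n T k i j z" if "1 \<le> k" "k \<le> n" "j \<in> T k" "i \<in> ?U - T k" for k i j
    using that
  proof (induction k arbitrary: i j)
    case (Suc k)
    have k1: "Suc k \<in> {1..n}" using Suc.prems by auto
    show ?case
    proof (cases "j \<in> new_indices T (Suc k)")
      case True
      then show ?thesis using zb[OF k1 True Suc.prems(4)] by simp
    next
      case False
      then have k: "1 \<le> k" "k < n" "k \<in> {1..n}" and j: "j \<in> T k" "j \<noteq> Suc k"
        using Suc.prems by (auto simp: new_indices_def split: if_splits)
      let ?Nw = "new_indices T (Suc k)"
      have Nw: "?Nw = T (Suc k) - (T k - {Suc k})" using k by (simp add: new_indices_def)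
      have old: "T k - {Suc k} \<subseteq> T (Suc k)" using step[OF k(1,2)] by auto
      have fT: "finite (T (Suc k))" using index_collectionD(3)[OF ind k1] .
      define u where "u = pr (k+1) (b k j)"
      have uV: "u \<in> V (Suc k)" unfolding u_def using pr_V[OF k(1,2) b(1)[OF k(3) j(1)]] by simp
      have u_old: "u l = (if l = j then 1 else 0)" if "l \<in> T k - {Suc k}" for l
        using that b(2)[OF k(3) j(1), of l] by (auto simp: u_def pr_def)
      have u_new: "u l = (if l = Suc k then 0 else cell_entry n T k l j z)" if "l \<in> ?Nw" for l
        using that Suc.IH[OF k(1) _ j(1), of l] k TU[OF k1] by (auto simp: u_def pr_def Nw)
      have iT: "i \<notin> T k" if "i \<noteq> Suc k" using that Suc.prems(4) old by auto
      have ui: "u i = (if i = Suc k then 0 else cell_entry n T k i j z)"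
        using Suc.IH[OF k(1) _ j(1), of i] k iT Suc.prems(4) by (auto simp: u_def pr_def)
      \<comment> \<open>Expand the image of the old basis vector in the basis at the next vertex. On
        inherited pivots its coefficients are a unit vector at \<open>j\<close>, so the new basis
        vector is the image minus a combination of new columns; the pivot \<open>Suc k\<close> does
        not contribute because the projection erases it.\<close>
      have "u i = (\<Sum>l\<in>T (Suc k). u l * b (Suc k) l i)"
        using fun_cong[OF expand[OF k1 uV], of i] by (simp add: sum_fun_apply fscale_def)
      also have "\<dots> = (\<Sum>l\<in>?Nw. u l * b (Suc k) l i) + (\<Sum>l\<in>T k - {Suc k}. u l * b (Suc k) l i)"
        unfolding Nw using sum.subset_diff[OF old fT] by simp
      also have "(\<Sum>l\<in>T k - {Suc k}. u l * b (Suc k) l i) = (\<Sum>l\<in>T k - {Suc k}. if l = j then b (Suc k) l i else 0)"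
        by (intro sum.cong refl) (simp add: u_old)
      also have "\<dots> = b (Suc k) j i" using j finite_subset[OF old fT] by simp
      also have "(\<Sum>l\<in>?Nw. u l * b (Suc k) l i) = (\<Sum>l\<in>?Nw - {Suc k}. cell_entry n T k l j z *
          (if (Suc k, i, l) \<in> cell_index n T then z (Suc k, i, l) else 0))"
        using fT zb[OF k1 _ Suc.prems(4)] by (intro sum.mono_neutral_cong_right) (auto simp: Nw u_new)
      finally show ?thesis using ui False by simp
    qed
  qed simp
  have "b k j m = (if m = j then 1 else if m \<in> ?U - T k then cell_entry n T k m j z else 0)"
    if k: "k \<in> {1..n}" and j: "j \<in> T k" for k j m
  proof (cases "m \<in> ?U")
    case True
    then show ?thesis using b(2)[OF k j, of m] entry[of k j m] k j by (cases "m \<in> T k") auto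
  next
    case False
    then have "b k j m = 0" using b(1)[OF k j] Vk(2)[OF k] by (auto simp: coord_space_def)
    then show ?thesis using False TU[OF k] j by auto
  qed
  then show "\<exists>b z. \<forall>k\<in>{1..n}. \<forall>j\<in>T k. b k j \<in> V k \<and>
      (\<forall>m. b k j m = (if m = j then 1 else if m \<in> {1..n+1} - T k then cell_entry n T k m j z else 0)) \<and>
      (\<forall>v\<in>V k. v = (\<Sum>j\<in>T k. fscale (v j) (b k j)))"
    using b(1) expand by (intro exI[of _ b] exI[of _ z]) blast
qed

text \<open>Fix a cell. The rows of chart coordinates solve square linear systems whose coefficients
  are entries of the reduced echelon basis, hence polynomials in the cell parameters. Cramer's rule
  makes the chart coordinates rational functions of these, as \<open>chain_length_le\<close>
  requires.\<close>

lemma local_dim_chart_le: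
  assumes S: "index_collection n S"
  shows "local_dim (chart_index n S) {y \<in> coord_space (chart_index n S). chart n S y \<in> degenerate_flag_variety n} p
    \<le> enat (\<Sum>{1..n})"
proof -
  let ?U = "{1..n+1}" and ?J = "chart_index n S"
  \<comment> \<open>Pivot collections are taken extensional, so that there are finitely many of
    them.\<close>
  define A where "A = {T \<in> {1..n} \<rightarrow>\<^sub>E Pow ?U. admissible n T}"
  have finA: "finite A" unfolding A_def by (rule finite_subset[of _ "{1..n} \<rightarrow>\<^sub>E Pow ?U"]) (auto intro: finite_PiE)
  define B where "B T k t m z = (if m = t then 1 else if m \<in> ?U - T k then cell_entry n T k m t z else 0)" for T k t m z
  have B: "B T k t m \<in> poly_funs (cell_index n T)" for T k t m
  proof -
    have "B T k t m = (if m = t then (\<lambda>z. 1) else if m \<in> ?U - T k then cell_entry n T k m t else (\<lambda>z. 0))"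
      by (auto simp: B_def fun_eq_iff)
    then show ?thesis by (simp add: poly_funs.const cell_entry_poly_fun)
  qed
  define Sol where "Sol T k i g h \<longleftrightarrow> g \<in> poly_funs (cell_index n T) \<and>
    (\<forall>j\<in>S k. h j \<in> poly_funs (cell_index n T)) \<and>
    (\<forall>z y. (\<forall>t\<in>T k. (\<Sum>j\<in>S k. B T k t j z * y j) = B T k t i z) \<and>
       (\<forall>c. (\<forall>t\<in>T k. (\<Sum>j\<in>S k. B T k t j z * c j) = 0) \<longrightarrow> (\<forall>j\<in>S k. c j = 0)) \<longrightarrow>
       g z \<noteq> 0 \<and> (\<forall>j\<in>S k. y j = h j z / g z))" for T k i g h
  have "\<exists>g h. Sol T k i g h" if "T \<in> A" "k \<in> {1..n}" for T k i
  proof -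
    have "index_collection n T" using that by (simp add: A_def admissible_def)
    then show ?thesis
      using cramer_poly_funs[of "S k" "T k" "B T k" "cell_index n T" "\<lambda>t. B T k t i"] B
        index_collectionD[OF S that(2)] index_collectionD[of n T k] that(2)
      unfolding Sol_def by auto
  qed
  then obtain g h where gh: "\<And>T k i. T \<in> A \<Longrightarrow> k \<in> {1..n} \<Longrightarrow> Sol T k i (g T k i) (h T k i)" by metis
  define G where "G T = (\<lambda>(k, i, j :: nat). g T k i)" for T
  define H where "H T = (\<lambda>(k, i, j). h T k i j)" for T
  have cover: "\<exists>T\<in>A. \<exists>z. \<forall>e\<in>?J. G T e z \<noteq> 0 \<and> x e = H T e z / G T e z"
    if x: "chart n S x \<in> degenerate_flag_variety n" for x
  proof -
    define V where "V = chart n S x"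
    define T where "T = (\<lambda>k\<in>{1..n}. leading ?U (vertex_order n k) (V k))"
    have V: "V \<in> degenerate_flag_variety n" using x by (simp add: V_def)
    have T: "admissible n T" unfolding T_def by (rule cell_of_point(1)[OF V])
    then have TA: "T \<in> A" using index_collectionD(1)[of n T] by (auto simp: A_def T_def admissible_def leading_def)
    obtain b z where b: "\<And>k j. k\<in>{1..n} \<Longrightarrow> j\<in>T k \<Longrightarrow> b k j \<in> V k" "\<And>k j m. k\<in>{1..n} \<Longrightarrow> j\<in>T k \<Longrightarrow> b k j m = B T k j m z"
      "\<And>k v. k\<in>{1..n} \<Longrightarrow> T k \<noteq> {} \<Longrightarrow> v\<in>V k \<Longrightarrow> v = (\<Sum>j\<in>T k. fscale (v j) (b k j))"
      using cell_of_point(2)[OF V, folded T_def] unfolding B_def by blast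
    have "g T k i z \<noteq> 0 \<and> x (k, i, j) = h T k i j z / g T k i z" if e: "(k, i, j) \<in> ?J" for k i j
    proof -
      have k: "k \<in> {1..n}" and i: "i \<in> ?U - S k" and j: "j \<in> S k" using e by (auto simp: chart_index_def)
      \<comment> \<open>The expansion in \<open>cell_of_point\<close> stands under a quantifier over
        \<open>T k\<close>, so a pivot is needed to extract it.\<close>
      have ne: "T k \<noteq> {}" using index_collectionD(2)[of n T k] T k by (auto simp: admissible_def)
      have "(\<Sum>j\<in>S k. B T k t j z * x (k, i, j)) = B T k t i z" if t: "t \<in> T k" for t
      proof -
        have "b k t \<in> chart n S x k" using b(1)[OF k t] by (simp add: V_def)
        then have "b k t i = (\<Sum>j\<in>S k. x (k, i, j) * b k t j)" using i unfolding mem_chart[OF S k] by blast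
        then show ?thesis by (simp add: b(2)[OF k t] mult.commute)
      qed
      then have eqs: "\<forall>t\<in>T k. (\<Sum>j\<in>S k. B T k t j z * x (k, i, j)) = B T k t i z" by blast
      \<comment> \<open>A linear form in the coordinates \<open>S k\<close> that vanishes on a basis
        of \<open>V k\<close> vanishes on all of \<open>V k\<close>. This space contains the graph
        vector whose coordinates in \<open>S k\<close> are the unit vector at
        \<open>j\<close>.\<close>
      have "c j = 0" if c: "\<forall>t\<in>T k. (\<Sum>j\<in>S k. B T k t j z * c j) = 0" and j: "j \<in> S k" for c j
      proof -
        note Sk = index_collectionD[OF S k]
        define u where "u = graph_basis ?U (S k) (\<lambda>i j. x (k, i, j)) j"
        have "u \<in> V k" unfolding V_def chart_eq_graph[OF k] u_def using j by (intro cvs.span_base) auto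
        then have u: "u = (\<Sum>t\<in>T k. fscale (u t) (b k t))" using b(3)[OF k ne] by blast
        have "(\<Sum>l\<in>S k. u l * c l) = (\<Sum>l\<in>S k. (\<Sum>t\<in>T k. u t * b k t l) * c l)"
          by (subst u) (simp add: sum_fun_apply fscale_def)
        also have "\<dots> = (\<Sum>t\<in>T k. u t * (\<Sum>l\<in>S k. b k t l * c l))"
          unfolding sum_distrib_right sum_distrib_left by (subst sum.swap) (simp add: mult.assoc)
        also have "\<dots> = 0" using c b(2)[OF k] by (intro sum.neutral) simp
        finally have "(\<Sum>l\<in>S k. u l * c l) = 0" .
        moreover have "(\<Sum>l\<in>S k. u l * c l) = (\<Sum>l\<in>S k. if l = j then c l else 0)"
          unfolding u_def using Sk j by (intro sum.cong) (auto simp: graph_basis_apply)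
        ultimately show ?thesis using j Sk by simp
      qed
      then have inj: "\<forall>c. (\<forall>t\<in>T k. (\<Sum>j\<in>S k. B T k t j z * c j) = 0) \<longrightarrow> (\<forall>j\<in>S k. c j = 0)" by blast
      have "\<forall>z y. (\<forall>t\<in>T k. (\<Sum>j\<in>S k. B T k t j z * y j) = B T k t i z) \<and>
         (\<forall>c. (\<forall>t\<in>T k. (\<Sum>j\<in>S k. B T k t j z * c j) = 0) \<longrightarrow> (\<forall>j\<in>S k. c j = 0)) \<longrightarrow>
         g T k i z \<noteq> 0 \<and> (\<forall>j\<in>S k. y j = h T k i j z / g T k i z)"
        using gh[OF TA k, of i] unfolding Sol_def by blast
      from this[THEN spec[of _ z], THEN spec[of _ "\<lambda>j. x (k, i, j)"]] eqs inj j show ?thesis by blast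
    qed
    then show ?thesis using TA by (intro bexI[of _ T] exI[of _ z]) (auto simp: G_def H_def)
  qed
  show ?thesis unfolding local_dim_def
  proof (rule Sup_least)
    fix e assume "e \<in> {enat d |d. \<exists>C. (\<forall>i\<le>d. irreducible_closed ?J (C i) \<and> p \<in> C i \<and>
       C i \<subseteq> {y \<in> coord_space ?J. chart n S y \<in> degenerate_flag_variety n}) \<and> (\<forall>i<d. C i \<subset> C (Suc i))}"
    then obtain d C where e: "e = enat d" and C: "\<forall>i\<le>d. irreducible_closed ?J (C i)" "\<forall>i<d. C i \<subset> C (Suc i)"
      "C d \<subseteq> {y \<in> coord_space ?J. chart n S y \<in> degenerate_flag_variety n}" by blast
    have "d \<le> \<Sum>{1..n}"
    proof (rule chain_length_le[OF finA _ _ cover C])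
      show "finite (cell_index n T) \<and> card (cell_index n T) \<le> \<Sum>{1..n}" if "T \<in> A" for T
        using that finite_cell_index card_cell_index_le by (auto simp: A_def)
      show "G T e \<in> poly_funs (cell_index n T) \<and> H T e \<in> poly_funs (cell_index n T)" if T: "T \<in> A" and eJ: "e \<in> ?J" for T e
      proof -
        obtain k i j where e: "e = (k, i, j)" "k \<in> {1..n}" "j \<in> S k" using eJ by (auto simp: chart_index_def)
        then show ?thesis using gh[OF T e(2), of i] unfolding Sol_def by (simp add: G_def H_def)
      qed
    qed auto
    then show "e \<le> enat (\<Sum>{1..n})" by (simp add: e)
  qed
qed

section \<open>Counting the collections satisfying the smoothness condition\<close>

definition smooth_collections :: "nat \<Rightarrow> (nat \<Rightarrow> nat set) set"
  where "smooth_collections n = {S \<in> {1..n} \<rightarrow>\<^sub>E Pow {1..n+1}. admissible n S \<and>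
    (\<forall>i j. 1 \<le> j \<and> j < i \<and> i \<le> n \<longrightarrow> i \<in> S j \<longrightarrow> j + 1 \<in> S i)}"

text \<open>\<open>smooth_collections r\<close> with elements renamed by \<open>e\<close> while the
  vertices stay \<open>1, ..., r\<close>. The two halves of a decomposed collection live on index
  sets that are not initial segments and need this form.\<close>

definition relabelled :: "nat \<Rightarrow> (nat \<Rightarrow> nat) \<Rightarrow> (nat \<Rightarrow> nat set) set"
  where "relabelled r e = {S \<in> {1..r} \<rightarrow>\<^sub>E Pow (e ` {1..r+1}).
    (\<forall>k\<in>{1..r}. card (S k) = k) \<and> (\<forall>k. 1 \<le> k \<and> k < r \<longrightarrow> S k \<subseteq> S (k + 1) \<union> {e (k + 1)}) \<and>
    (\<forall>i j. 1 \<le> j \<and> j < i \<and> i \<le> r \<longrightarrow> e i \<in> S j \<longrightarrow> e (j + 1) \<in> S i)}"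

lemma smooth_collections_eq: "smooth_collections n = relabelled n (\<lambda>i. i)"
  by (auto simp: smooth_collections_def relabelled_def admissible_def index_collection_def)

lemma finite_relabelled: "finite (relabelled r e)"
  by (rule finite_subset[of _ "{1..r} \<rightarrow>\<^sub>E Pow (e ` {1..r+1})"]) (auto simp: relabelled_def intro: finite_PiE)

lemma card_relabelled:
  assumes e: "inj_on e {1..r+1}"
  shows "card (relabelled r e) = card (smooth_collections r)"
proof -
  let ?X = "{1..r+1}"
  define f where "f T = (\<lambda>k\<in>{1..r}. e ` T k)" for T :: "nat \<Rightarrow> nat set"
  define g where "g S = (\<lambda>k\<in>{1..r}. {i\<in>?X. e i \<in> S k})" for S
  have eT: "e x \<in> e ` A \<longleftrightarrow> x \<in> A" if "x \<in> ?X" "A \<subseteq> ?X" for x A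
    using inj_on_image_mem_iff[OF e that] .
  have fT: "f T \<in> relabelled r e \<and> g (f T) = T" if T: "T \<in> smooth_collections r" for T
  proof -
    have T1: "T \<in> {1..r} \<rightarrow>\<^sub>E Pow ?X" "\<And>k. k \<in> {1..r} \<Longrightarrow> card (T k) = k"
      "\<And>k. 1 \<le> k \<Longrightarrow> k < r \<Longrightarrow> T k \<subseteq> T (k + 1) \<union> {k + 1}"
      "\<And>i j. 1 \<le> j \<Longrightarrow> j < i \<Longrightarrow> i \<le> r \<Longrightarrow> i \<in> T j \<Longrightarrow> j + 1 \<in> T i"
      using T by (auto simp: smooth_collections_eq relabelled_def)
    have TX: "T k \<subseteq> ?X" if "k \<in> {1..r}" for k using PiE_mem[OF T1(1) that] by blast
    have "f T \<in> {1..r} \<rightarrow>\<^sub>E Pow (e ` ?X)" unfolding f_def restrict_PiE_iff by (intro ballI PowI image_mono TX)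
    moreover have "card (f T k) = k" if "k \<in> {1..r}" for k
      using that T1(2)[OF that] inj_on_subset[OF e TX[OF that]] by (simp add: f_def card_image)
    moreover have "f T k \<subseteq> f T (k + 1) \<union> {e (k + 1)}" if "1 \<le> k" "k < r" for k
      using T1(3)[OF that] that by (auto simp: f_def)
    moreover have "e (j + 1) \<in> f T i" if "1 \<le> j" "j < i" "i \<le> r" "e i \<in> f T j" for i j
      using T1(4)[of j i] that eT[of i "T j"] TX[of j] by (auto simp: f_def)
    moreover have "g (f T) = T"
    proof
      fix k show "g (f T) k = T k"
      proof (cases "k \<in> {1..r}")
        case True
        then show ?thesis using eT TX[OF True] by (auto simp: g_def f_def)
      next
        case False
        then show ?thesis by (simp only: g_def restrict_def if_False PiE_arb[OF T1(1) False])
      qed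
    qed
    ultimately show ?thesis by (simp add: relabelled_def)
  qed
  have gS: "g S \<in> smooth_collections r \<and> f (g S) = S" if S: "S \<in> relabelled r e" for S
  proof -
    have S1: "S \<in> {1..r} \<rightarrow>\<^sub>E Pow (e ` ?X)" "\<And>k. k \<in> {1..r} \<Longrightarrow> card (S k) = k"
      "\<And>k. 1 \<le> k \<Longrightarrow> k < r \<Longrightarrow> S k \<subseteq> S (k + 1) \<union> {e (k + 1)}"
      "\<And>i j. 1 \<le> j \<Longrightarrow> j < i \<Longrightarrow> i \<le> r \<Longrightarrow> e i \<in> S j \<Longrightarrow> e (j + 1) \<in> S i"
      using S by (auto simp: relabelled_def)
    have SX: "S k \<subseteq> e ` ?X" if "k \<in> {1..r}" for k using PiE_mem[OF S1(1) that] by blast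
    have eg: "e ` g S k = S k" if "k \<in> {1..r}" for k using SX[OF that] that by (auto simp: g_def)
    have "g S \<in> {1..r} \<rightarrow>\<^sub>E Pow ?X" by (auto simp: g_def)
    moreover have "card (g S k) = k" if "k \<in> {1..r}" for k
    proof -
      have "g S k \<subseteq> ?X" using that by (auto simp: g_def)
      then have "card (e ` g S k) = card (g S k)" using e inj_on_subset by (intro card_image) blast
      then show ?thesis using eg[OF that] S1(2)[OF that] by simp
    qed
    moreover have "g S k \<subseteq> g S (k + 1) \<union> {k + 1}" if k: "1 \<le> k" "k < r" for k
    proof
      fix i assume i: "i \<in> g S k"
      then have "i \<in> ?X" "e i \<in> S (k + 1) \<or> e i = e (k + 1)" using S1(3)[OF k] k by (auto simp: g_def)
      then show "i \<in> g S (k + 1) \<union> {k + 1}" using e k by (auto simp: g_def inj_on_def)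
    qed
    moreover have "j + 1 \<in> g S i" if "1 \<le> j" "j < i" "i \<le> r" "i \<in> g S j" for i j
      using S1(4)[of j i] that by (auto simp: g_def)
    moreover have "f (g S) = S"
    proof
      fix k show "f (g S) k = S k"
      proof (cases "k \<in> {1..r}")
        case False
        then show ?thesis by (simp only: f_def restrict_def if_False PiE_arb[OF S1(1) False])
      qed (use eg in \<open>simp add: f_def\<close>)
    qed
    ultimately show ?thesis by (simp add: smooth_collections_eq relabelled_def)
  qed
  have "bij_betw f (smooth_collections r) (relabelled r e)"
    by (rule bij_betw_byWitness[where f' = g]) (use fT gS in auto)
  then show ?thesis using bij_betw_same_card by metis
qed

section \<open>Recursion over the element missing at the last vertex\<close>

lemma smooth_collectionsD:
  assumes "S \<in> smooth_collections n"
  shows "S \<in> {1..n} \<rightarrow>\<^sub>E Pow {1..n+1}" "\<And>k. k \<in> {1..n} \<Longrightarrow> S k \<subseteq> {1..n+1}"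
    "\<And>k. k \<in> {1..n} \<Longrightarrow> card (S k) = k" "\<And>k. k \<in> {1..n} \<Longrightarrow> finite (S k)"
    "\<And>k. 1 \<le> k \<Longrightarrow> k < n \<Longrightarrow> S k \<subseteq> S (k + 1) \<union> {k + 1}"
    "\<And>i j. 1 \<le> j \<Longrightarrow> j < i \<Longrightarrow> i \<le> n \<Longrightarrow> i \<in> S j \<Longrightarrow> j + 1 \<in> S i"
    "\<And>j k m. j \<in> S k \<Longrightarrow> 1 \<le> k \<Longrightarrow> k \<le> m \<Longrightarrow> m \<le> n \<Longrightarrow> j \<le> k \<or> m < j \<Longrightarrow> j \<in> S m"
proof -
  interpret admissible_collection n S
    using assms by unfold_locales (simp add: smooth_collections_def)
  show "S \<in> {1..n} \<rightarrow>\<^sub>E Pow {1..n+1}" using assms by (simp add: smooth_collections_def)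
  show "S k \<subseteq> {1..n+1}" "card (S k) = k" "finite (S k)" if "k \<in> {1..n}" for k
    using S_sub card_S fin_S that by auto
  show "S k \<subseteq> S (k + 1) \<union> {k + 1}" if "1 \<le> k" "k < n" for k
    using adm that by (auto simp: admissible_def)
  show "j + 1 \<in> S i" if "1 \<le> j" "j < i" "i \<le> n" "i \<in> S j" for i j
    using assms that by (auto simp: smooth_collections_def)
  show "j \<in> S m" if "j \<in> S k" "1 \<le> k" "k \<le> m" "m \<le> n" "j \<le> k \<or> m < j" for j k m
    using S_mono that by blast
qed

lemma smooth_collectionsI:
  assumes "S \<in> {1..n} \<rightarrow>\<^sub>E Pow {1..n+1}" "\<And>k. 1 \<le> k \<Longrightarrow> k \<le> n \<Longrightarrow> card (S k) = k"
    "\<And>k. 1 \<le> k \<Longrightarrow> k < n \<Longrightarrow> S k \<subseteq> S (k + 1) \<union> {k + 1}"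
    "\<And>i j. 1 \<le> j \<Longrightarrow> j < i \<Longrightarrow> i \<le> n \<Longrightarrow> i \<in> S j \<Longrightarrow> j + 1 \<in> S i"
  shows "S \<in> smooth_collections n"
  using assms by (auto simp: smooth_collections_eq relabelled_def)

abbreviation missing :: "nat \<Rightarrow> nat \<Rightarrow> (nat \<Rightarrow> nat set) set"
  where "missing n m \<equiv> {S \<in> smooth_collections n. S n = {1..n+1} - {m}}"

text \<open>If \<open>n + 1\<close> occurred anywhere it would persist to vertex \<open>n\<close>.
  So all sets lie in \<open>{1..n}\<close>, and the full set \<open>{1..n}\<close> at vertex
  \<open>n\<close> puts no further constraint on the earlier ones.\<close>

lemma card_missing_top:
  assumes n: "n \<ge> 1"
  shows "card (missing n (n + 1)) = card (smooth_collections (n - 1))"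
proof -
  define f where "f S = restrict S {1..n-1}" for S :: "nat \<Rightarrow> nat set"
  define g where "g T = T(n := {1..n})" for T :: "nat \<Rightarrow> nat set"
  have top: "{1..n+1} - {n+1} = {1..n}" by auto
  have f: "f S \<in> smooth_collections (n - 1) \<and> g (f S) = S" if S: "S \<in> missing n (n + 1)" for S
  proof -
    have Sn: "S n = {1..n}" and Sm: "S \<in> smooth_collections n" using S top by auto
    note D = smooth_collectionsD[OF Sm]
    have sub: "S k \<subseteq> {1..n}" if "1 \<le> k" "k \<le> n" for k
      using D(2)[of k] D(7)[of "n+1" k n] Sn that n by (fastforce simp: le_Suc_eq)
    have "f S \<in> smooth_collections (n - 1)"
    proof (rule smooth_collectionsI)
      show "f S \<in> {1..n-1} \<rightarrow>\<^sub>E Pow {1..n-1+1}" unfolding f_def restrict_PiE_iff by (intro ballI PowI order_trans[OF sub]) (use n in auto)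
      show "card (f S k) = k" if "1 \<le> k" "k \<le> n - 1" for k using D(3)[of k] that by (simp add: f_def)
      show "f S k \<subseteq> f S (k + 1) \<union> {k + 1}" if "1 \<le> k" "k < n - 1" for k
        using D(5)[of k] that by (simp add: f_def)
      show "j + 1 \<in> f S i" if "1 \<le> j" "j < i" "i \<le> n - 1" "i \<in> f S j" for i j
        using D(6)[of j i] that by (simp add: f_def)
    qed
    moreover have "g (f S) k = S k" for k
      using Sn PiE_arb[OF D(1), of k] n by (auto simp: g_def f_def restrict_def)
    ultimately show ?thesis by blast
  qed
  have g: "g T \<in> missing n (n + 1) \<and> f (g T) = T" if T: "T \<in> smooth_collections (n - 1)" for T
  proof -
    note D = smooth_collectionsD[OF T]
    have TX: "T k \<subseteq> {1..n}" if "1 \<le> k" "k \<le> n - 1" for k using D(2)[of k] that n by auto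
    have "g T \<in> smooth_collections n"
    proof (rule smooth_collectionsI)
      have "g T k \<in> Pow {1..n+1}" if k: "k \<in> {1..n}" for k
      proof (cases "k = n")
        case False
        then have "1 \<le> k" "k \<le> n - 1" using k by auto
        from TX[OF this] show ?thesis using False by (auto simp: g_def)
      qed (auto simp: g_def)
      moreover have "g T k = undefined" if "k \<notin> {1..n}" for k
        using PiE_arb[OF D(1), of k] that n by (auto simp: g_def)
      ultimately show "g T \<in> {1..n} \<rightarrow>\<^sub>E Pow {1..n+1}" by blast
      show "card (g T k) = k" if "1 \<le> k" "k \<le> n" for k using D(3)[of k] that by (auto simp: g_def)
      show "g T k \<subseteq> g T (k + 1) \<union> {k + 1}" if "1 \<le> k" "k < n" for k
      proof (cases "k + 1 = n")
        case True
        then have "g T k = T k" "g T (k + 1) = {1..n}" by (auto simp: g_def)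
        moreover have "k \<le> n - 1" using that by arith
        ultimately show ?thesis using TX[of k] that by auto
      next
        case False
        then show ?thesis using D(5)[of k] that by (simp add: g_def)
      qed
      show "j + 1 \<in> g T i" if "1 \<le> j" "j < i" "i \<le> n" "i \<in> g T j" for i j
        using D(6)[of j i] that by (auto simp: g_def)
    qed
    moreover have "f (g T) k = T k" for k
      using PiE_arb[OF D(1), of k] n by (auto simp: g_def f_def restrict_def)
    ultimately show ?thesis using top by (auto simp: g_def)
  qed
  have "bij_betw f (missing n (n + 1)) (smooth_collections (n - 1))"
    by (rule bij_betw_byWitness[where f' = g]) (use f g in auto)
  then show ?thesis by (rule bij_betw_same_card)
qed

text \<open>If \<open>S n\<close> misses \<open>m \<le> n\<close>, then \<open>S 1, \<dots>, S (m-1)\<close> are contained in \<open>{1..m-1} \<union> {n+1}\<close>, where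
  \<open>n+1\<close> takes the part of \<open>m\<close>. Let \<open>t\<close> be the element missing in \<open>S (m-1)\<close>. Removing \<open>S (m-1)\<close> from
  \<open>S m, \<dots>, S (n-1)\<close> leaves subsets of \<open>{t, m+1, \<dots>, n}\<close>, where \<open>t\<close> takes the part of 1.\<close>

lemma card_missing:
  assumes m: "1 \<le> m" "m \<le> n"
  shows "card (missing n m) = card (smooth_collections (m - 1)) * card (smooth_collections (n - m))"
proof -
  let ?U = "{1..n+1}"
  define e1 where "e1 k = (if k = m then n + 1 else k)" for k
  define e2 where "e2 t k = (if k = 1 then t else m + k - 1)" for t k :: nat
  define X1 where "X1 = insert (n + 1) {1..<m}"
  \<comment> \<open>For \<open>m = 1\<close> there is no preceding vertex. The empty set is the
    correct value, as then \<open>X1\<close> has the single element \<open>n + 1\<close>, which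
    becomes \<open>t S\<close>.\<close>
  define B where "B S = (if m = 1 then {} else S (m - 1))" for S :: "nat \<Rightarrow> nat set"
  define t where "t S = the_elem (X1 - B S)" for S
  define R1 where "R1 = relabelled (m - 1) e1"
  define R2 where "R2 S = relabelled (n - m) (e2 (t S))" for S
  have e1X: "e1 ` {1..m-1+1} = X1"
  proof -
    have "{1..m-1+1} = insert m {1..<m}" using m by auto
    then show ?thesis by (auto simp: e1_def X1_def)
  qed
  have e1_lt: "e1 k = k" if "k < m" for k using that by (simp add: e1_def)
  have cardX1: "card X1 = m" "finite X1" using m by (auto simp: X1_def)
  have e2X: "e2 u ` {1..n-m+1} = insert u {m+1..n}" for u
  proof -
    have "{1..n-m+1} = insert 1 {2..n-m+1}" using m by auto
    moreover have "e2 u ` {2..n-m+1} = {m+1..n}"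
    proof
      show "{m+1..n} \<subseteq> e2 u ` {2..n-m+1}"
      proof
        fix x assume "x \<in> {m+1..n}"
        then show "x \<in> e2 u ` {2..n-m+1}" by (intro image_eqI[of _ _ "x - m + 1"]) (auto simp: e2_def)
      qed
    qed (auto simp: e2_def)
    moreover have "e2 u 1 = u" by (simp add: e2_def)
    ultimately show ?thesis by (simp only: image_insert)
  qed
  have tB: "X1 - B S = {t S}" if "B S \<subseteq> X1" "card (B S) = m - 1" for S
  proof -
    have "card (X1 - B S) = 1" using that cardX1 m finite_subset[OF that(1)] by (simp add: card_Diff_subset)
    then obtain a where "X1 - B S = {a}" using card_1_singletonE by blast
    then show ?thesis by (simp add: t_def)
  qed
  have BR1: "B S \<subseteq> X1 \<and> card (B S) = m - 1" if "S \<in> R1" for S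
    using that m e1X by (cases "m = 1") (auto simp: B_def R1_def relabelled_def PiE_iff)
  define f where "f S = (restrict S {1..m-1}, \<lambda>k\<in>{1..n-m}. S (m + k - 1) - B S)" for S :: "nat \<Rightarrow> nat set"
  define g where "g = (\<lambda>(S1, S2). \<lambda>k\<in>{1..n}. if k < m then S1 k else if k < n then B S1 \<union> S2 (k - m + 1)
     else ?U - {m} :: nat set)"
  have f: "f S \<in> Sigma R1 R2 \<and> g (f S) = S" if S: "S \<in> missing n m" for S
  proof -
    have Sn: "S n = ?U - {m}" and Sm: "S \<in> smooth_collections n" using S by auto
    note D = smooth_collectionsD[OF Sm]
    have mS: "m \<notin> S k" if "m \<le> k" "k \<le> n" for k
      using D(7)[of m k n] that m Sn by auto
    have low: "S k \<subseteq> X1" if k: "1 \<le> k" "k < m" for k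
    proof
      fix x assume x: "x \<in> S k"
      have xU: "x \<in> ?U" using D(2)[of k] k m x by auto
      show "x \<in> X1"
      proof (rule ccontr)
        assume "x \<notin> X1"
        then have mx: "m \<le> x" "x \<le> n" using xU by (auto simp: X1_def)
        \<comment> \<open>An element from \<open>m\<close> to \<open>n\<close> persists up to vertex
          \<open>m - 1\<close>. The smoothness condition for that vertex then puts \<open>m\<close>
          into \<open>S x\<close>, from where it would persist to \<open>S n\<close>.\<close>
        then have "x \<in> S (m - 1)" using D(7)[of x k "m - 1"] x k m by auto
        then have "m \<in> S x" using D(6)[of "m - 1" x] mx k by auto
        then show False using mS mx by blast
      qed
    qed
    have BX: "B S \<subseteq> X1" using low m by (auto simp: B_def)
    have "m - 1 \<in> {1..n}" if "m \<noteq> 1" using that m by (cases m) auto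
    then have cardB: "card (B S) = m - 1" using D(3)[of "m - 1"] by (auto simp: B_def)
    have finB: "finite (B S)" using BX cardX1 finite_subset by blast
    note tS = tB[OF BX cardB]
    have BS: "B S \<subseteq> S k" if k: "m \<le> k" "k \<le> n" for k
    proof
      fix x assume x: "x \<in> B S"
      then have "m \<noteq> 1" "x \<in> S (m - 1)" by (auto simp: B_def split: if_splits)
      moreover have "1 \<le> m - 1" "m - 1 \<le> k" using calculation(1) m k by auto
      moreover have "x = n + 1 \<or> x < m" using BX x by (auto simp: X1_def)
      then have "x \<le> m - 1 \<or> k < x" using k by arith
      ultimately show "x \<in> S k" using D(7)[of x "m - 1" k] k by blast
    qed
    have 1: "restrict S {1..m-1} \<in> R1"
      unfolding R1_def relabelled_def e1X
    proof (intro CollectI conjI ballI allI impI)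
      show "restrict S {1..m-1} \<in> {1..m-1} \<rightarrow>\<^sub>E Pow X1" unfolding restrict_PiE_iff by (intro ballI PowI low) auto
      show "card (restrict S {1..m-1} k) = k" if "k \<in> {1..m-1}" for k using D(3)[of k] that m by auto
      show "restrict S {1..m-1} k \<subseteq> restrict S {1..m-1} (k + 1) \<union> {e1 (k + 1)}"
        if k: "1 \<le> k \<and> k < m - 1" for k
      proof -
        have "k < n" "k + 1 \<in> {1..m-1}" "k \<in> {1..m-1}" "k + 1 < m" using k m by auto
        then show ?thesis using D(5)[of k] k by (simp only: e1_lt restrict_apply if_True)
      qed
      show "e1 (j + 1) \<in> restrict S {1..m-1} i"
        if "1 \<le> j \<and> j < i \<and> i \<le> m - 1" "e1 i \<in> restrict S {1..m-1} j" for i j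
        using D(6)[of j i] that m by (auto simp: e1_lt)
    qed
    have Bres: "B (restrict S {1..m-1}) = B S" using m by (auto simp: B_def)
    then have tres: "t (restrict S {1..m-1}) = t S" by (simp only: t_def)
    have 2: "(\<lambda>k\<in>{1..n-m}. S (m + k - 1) - B S) \<in> R2 S"
      unfolding R2_def relabelled_def e2X
    proof (intro CollectI conjI ballI allI impI)
      let ?S2 = "\<lambda>k\<in>{1..n-m}. S (m + k - 1) - B S"
      have "S (m + k - 1) - B S \<subseteq> insert (t S) {m+1..n}" if k: "k \<in> {1..n-m}" for k
      proof
        fix x assume x: "x \<in> S (m + k - 1) - B S"
        have "m + k - 1 \<in> {1..n}" "m \<le> m + k - 1" "m + k - 1 \<le> n" using k m by auto
        then have "x \<in> ?U" "x \<noteq> m" using D(2)[of "m + k - 1"] mS x by auto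
        moreover have "x \<in> X1 \<Longrightarrow> x = t S" using tS x by auto
        ultimately show "x \<in> insert (t S) {m+1..n}" by (cases "x \<in> X1") (auto simp: X1_def)
      qed
      then show "?S2 \<in> {1..n-m} \<rightarrow>\<^sub>E Pow (insert (t S) {m+1..n})" by auto
      show "card (?S2 k) = k" if k: "k \<in> {1..n-m}" for k
      proof -
        have kk: "m + k - 1 \<in> {1..n}" "m \<le> m + k - 1" "m + k - 1 \<le> n" using k m by auto
        show ?thesis using card_Diff_subset[OF finB BS[OF kk(2,3)]] D(3)[OF kk(1)] cardB k m by auto
      qed
      show "?S2 k \<subseteq> ?S2 (k + 1) \<union> {e2 (t S) (k + 1)}" if k: "1 \<le> k \<and> k < n - m" for k
      proof -
        have kk: "1 \<le> m + k - 1" "m + k - 1 < n" "m + k - 1 + 1 = m + k" using k m by auto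
        have "S (m + k - 1) \<subseteq> S (m + k) \<union> {m + k}" using D(5)[OF kk(1,2)] kk(3) by simp
        then show ?thesis using k by (auto simp: e2_def)
      qed
      show "e2 (t S) (j + 1) \<in> ?S2 i" if ij: "1 \<le> j \<and> j < i \<and> i \<le> n - m" "e2 (t S) i \<in> ?S2 j" for i j
      proof -
        have "m + i - 1 \<in> S (m + j - 1)" using ij by (auto simp: e2_def)
        then have "m + j \<in> S (m + i - 1)" using D(6)[of "m + j - 1" "m + i - 1"] ij m by auto
        moreover have "m + j \<notin> B S" using BX ij by (auto simp: X1_def)
        ultimately show ?thesis using ij by (auto simp: e2_def)
      qed
    qed
    have "R2 (restrict S {1..m-1}) = R2 S" by (simp only: R2_def tres)
    then have "f S \<in> Sigma R1 R2" using 1 2 by (simp add: f_def)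
    moreover have "g (f S) k = S k" for k
    proof (cases "k \<in> {1..n}")
      case True
      consider "k < m" | "m \<le> k" "k < n" | "k = n" "m \<le> k" using True by fastforce
      then show ?thesis
      proof cases
        case 1
        then have "k \<in> {1..m-1}" using True by auto
        then show ?thesis using 1 True unfolding g_def f_def prod.case by simp
      next
        case 2
        then have "m + (k - m + 1) - 1 = k" "k - m + 1 \<in> {1..n-m}" using m by auto
        moreover have "B S \<union> (S k - B S) = S k" using BS[of k] 2 by auto
        ultimately show ?thesis using 2 True unfolding g_def f_def prod.case Bres by simp
      next
        case 3
        then show ?thesis using True Sn unfolding g_def f_def prod.case by simp
      qed
    next
      case False
      then show ?thesis by (simp only: g_def f_def prod.case restrict_def if_False PiE_arb[OF D(1) False])
    qed
    ultimately show ?thesis by blast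
  qed
  have g: "g p \<in> missing n m \<and> f (g p) = p" if p: "p \<in> Sigma R1 R2" for p
  proof -
    obtain S1 S2 where p': "p = (S1, S2)" "S1 \<in> R1" "S2 \<in> R2 S1" using p by auto
    note B = BR1[OF p'(2)]
    note tS = tB[OF B[THEN conjunct1] B[THEN conjunct2]]
    have finB: "finite (B S1)" using B cardX1 finite_subset by blast
    have A0: "S1 \<in> {1..m-1} \<rightarrow>\<^sub>E Pow X1" "\<forall>k\<in>{1..m-1}. card (S1 k) = k"
      "\<forall>k. 1 \<le> k \<and> k < m - 1 \<longrightarrow> S1 k \<subseteq> S1 (k + 1) \<union> {e1 (k + 1)}"
      "\<forall>i j. 1 \<le> j \<and> j < i \<and> i \<le> m - 1 \<longrightarrow> e1 i \<in> S1 j \<longrightarrow> e1 (j + 1) \<in> S1 i"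
      using p'(2) unfolding R1_def relabelled_def e1X by blast+
    have A: "S1 \<in> {1..m-1} \<rightarrow>\<^sub>E Pow X1" "\<And>k. k \<in> {1..m-1} \<Longrightarrow> card (S1 k) = k"
      "\<And>k. 1 \<le> k \<Longrightarrow> k + 1 < m \<Longrightarrow> S1 k \<subseteq> S1 (k + 1) \<union> {k + 1}"
      "\<And>i j. 1 \<le> j \<Longrightarrow> j < i \<Longrightarrow> i < m \<Longrightarrow> i \<in> S1 j \<Longrightarrow> j + 1 \<in> S1 i"
    proof -
      show "S1 k \<subseteq> S1 (k + 1) \<union> {k + 1}" if "1 \<le> k" "k + 1 < m" for k
        using A0(3)[rule_format, of k] e1_lt[of "k + 1"] that by simp
      show "j + 1 \<in> S1 i" if "1 \<le> j" "j < i" "i < m" "i \<in> S1 j" for i j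
        using A0(4)[rule_format, of j i] e1_lt[of "j + 1"] e1_lt[of i] that by simp
    qed (use A0 in blast)+
    have C: "S2 \<in> {1..n-m} \<rightarrow>\<^sub>E Pow (insert (t S1) {m+1..n})" "\<And>k. k \<in> {1..n-m} \<Longrightarrow> card (S2 k) = k"
      "\<And>k. 1 \<le> k \<Longrightarrow> k < n - m \<Longrightarrow> S2 k \<subseteq> S2 (k + 1) \<union> {m + k}"
      "\<And>i j. 1 \<le> j \<Longrightarrow> j < i \<Longrightarrow> i \<le> n - m \<Longrightarrow> m + i - 1 \<in> S2 j \<Longrightarrow> m + j \<in> S2 i"
      using p'(3) unfolding R2_def relabelled_def e2X by (auto simp: e2_def)
    have S1X: "S1 k \<subseteq> X1" if "1 \<le> k" "k < m" for k using PiE_mem[OF A(1), of k] that by auto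
    have S2X: "S2 k \<subseteq> insert (t S1) {m+1..n}" if "1 \<le> k" "k \<le> n - m" for k
      using PiE_mem[OF C(1), of k] that by auto
    have tX: "t S1 \<in> X1" "t S1 \<notin> B S1" using tS by auto
    have disj: "B S1 \<inter> S2 k = {}" if "1 \<le> k" "k \<le> n - m" for k
    proof -
      have "X1 \<inter> {m+1..n} = {}" by (auto simp: X1_def)
      then show ?thesis using S2X[OF that] B tX by blast
    qed
    have X1U: "X1 \<subseteq> ?U - {m}" using m by (auto simp: X1_def)
    define S where "S = g p"
    have S_low: "S k = S1 k" if "1 \<le> k" "k < m" for k using that m by (simp add: S_def g_def p')
    have S_mid: "S k = B S1 \<union> S2 (k - m + 1)" if "m \<le> k" "k < n" for k
      using that m by (simp add: S_def g_def p')
    have S_top: "S n = ?U - {m}" using m by (simp add: S_def g_def p')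
    have S_out: "S k = undefined" if "k \<notin> {1..n}" for k using that by (simp only: S_def g_def p' prod.case restrict_def if_False)
    have BU: "B S1 \<subseteq> ?U - {m}" using B X1U by auto
    have midU: "S k \<subseteq> ?U - {m}" if k: "m \<le> k" "k < n" for k
    proof -
      have "S2 (k - m + 1) \<subseteq> ?U - {m}" using S2X[of "k - m + 1"] tX X1U k m by fastforce
      then show ?thesis using S_mid[OF k] BU by auto
    qed
    have Sm: "S \<in> smooth_collections n"
    proof (rule smooth_collectionsI)
      have "S k \<in> Pow ?U" if k: "k \<in> {1..n}" for k
      proof -
        consider "k < m" | "m \<le> k" "k < n" | "k = n" "m \<le> k" using k by fastforce
        then show ?thesis
          using S1X[of k] S_low[of k] X1U midU[of k] S_top k by cases auto
      qed
      then show "S \<in> {1..n} \<rightarrow>\<^sub>E Pow ?U" using S_out by blast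
      show "card (S k) = k" if k: "1 \<le> k" "k \<le> n" for k
      proof -
        consider "k < m" | "m \<le> k" "k < n" | "k = n" "m \<le> k" using k by fastforce
        then show ?thesis
        proof cases
          case 1
          then show ?thesis using S_low[of k] A(2)[of k] k by simp
        next
          case 2
          then have k': "1 \<le> k - m + 1" "k - m + 1 \<le> n - m" by auto
          have "finite (S2 (k - m + 1))" using S2X[OF k'] finite_subset by blast
          then show ?thesis using card_Un_disjoint[OF finB _ disj[OF k']] C(2)[of "k - m + 1"] B S_mid[OF 2] 2 m k'
            by simp
        next
          case 3
          then show ?thesis using S_top m by simp
        qed
      qed
      show "S k \<subseteq> S (k + 1) \<union> {k + 1}" if k: "1 \<le> k" "k < n" for k
      proof -
        consider "k + 1 < m" | "k + 1 = m" | "m \<le> k" "k + 1 < n" | "m \<le> k" "k + 1 = n" using k by linarith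
        then show ?thesis
        proof cases
          case 1
          then show ?thesis using A(3)[of k] S_low[of k] S_low[of "k + 1"] k by simp
        next
          case 2
          then have "m - 1 = k" "m \<noteq> 1" "k < m" using k by auto
          then have "S k = B S1" using S_low[OF k(1)] by (simp add: B_def)
          moreover have "B S1 \<subseteq> S m"
          proof (cases "m = n")
            case True
            then show ?thesis using S_top BU by blast
          next
            case False
            then show ?thesis using S_mid[of m] m by simp
          qed
          ultimately show ?thesis using 2 by blast
        next
          case 3
          then have "S2 (k - m + 1) \<subseteq> S2 (k - m + 1 + 1) \<union> {k + 1}" using C(3)[of "k - m + 1"] by simp
          moreover have "k + 1 - m + 1 = k - m + 1 + 1" using 3 by simp
          then have "S (k + 1) = B S1 \<union> S2 (k - m + 1 + 1)" using S_mid[of "k + 1"] 3 by simp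
          moreover have "S k = B S1 \<union> S2 (k - m + 1)" using S_mid[of k] 3 by simp
          ultimately show ?thesis by blast
        next
          case 4
          then have "S k \<subseteq> ?U - {m}" "S (k + 1) = ?U - {m}" using midU[of k] S_top by simp_all
          then show ?thesis by blast
        qed
      qed
      show "j + 1 \<in> S i" if ij: "1 \<le> j" "j < i" "i \<le> n" "i \<in> S j" for i j
      proof (cases "j < m")
        case True
        then have iS: "i \<in> S1 j" using S_low[of j] ij by simp
        then have "i \<in> X1" using S1X[of j] True ij by auto
        then have "i < m" using ij by (auto simp: X1_def)
        then show ?thesis using A(4)[of j i] iS ij S_low[of i] by simp
      next
        case False
        show ?thesis
        proof (cases "i = n")
          case True
          then show ?thesis using S_top False ij by auto
        next
          case i: False
          then have iS: "i \<in> B S1 \<union> S2 (j - m + 1)" using S_mid[of j] False ij by auto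
          have "i \<notin> B S1" using B ij False by (auto simp: X1_def)
          then have "m + (i - m + 1) - 1 \<in> S2 (j - m + 1)" using iS ij False by auto
          then have "m + (j - m + 1) \<in> S2 (i - m + 1)" using C(4)[of "j - m + 1" "i - m + 1"] ij i False by auto
          then show ?thesis using S_mid[of i] ij i False by auto
        qed
      qed
    qed
    have BS: "B S = B S1" using S_low[of "m - 1"] m by (auto simp: B_def)
    have "restrict S {1..m-1} k = S1 k" for k
      using S_low[of k] PiE_arb[OF A(1), of k] m by (auto simp: restrict_def)
    moreover have "(\<lambda>k\<in>{1..n-m}. S (m + k - 1) - B S) k = S2 k" for k
    proof (cases "k \<in> {1..n-m}")
      case True
      then have "S (m + k - 1) = B S1 \<union> S2 k" using S_mid[of "m + k - 1"] m by auto
      then show ?thesis using True BS disj[of k] by auto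
    next
      case False
      then show ?thesis using PiE_arb[OF C(1) False] by auto
    qed
    ultimately have "f S = p" unfolding f_def p' by (auto simp: fun_eq_iff)
    then show ?thesis using Sm S_top by (simp add: S_def)
  qed
  have "bij_betw f (missing n m) (Sigma R1 R2)"
  proof (rule bij_betw_byWitness[where f' = g])
    show "\<forall>S\<in>missing n m. g (f S) = S" "f ` missing n m \<subseteq> Sigma R1 R2" using f by blast+
    show "\<forall>p\<in>Sigma R1 R2. f (g p) = p" "g ` Sigma R1 R2 \<subseteq> missing n m" using g by blast+
  qed
  then have "card (missing n m) = card (Sigma R1 R2)" by (rule bij_betw_same_card)
  also have "\<dots> = (\<Sum>S\<in>R1. card (R2 S))"
    by (rule card_SigmaI) (auto simp: R1_def R2_def finite_relabelled)
  also have "\<dots> = (\<Sum>S\<in>R1. card (smooth_collections (n - m)))"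
  proof (rule sum.cong[OF refl])
    fix S assume S: "S \<in> R1"
    have "t S \<in> X1" using tB[of S] BR1[OF S] by auto
    then have "inj_on (e2 (t S)) {1..n-m+1}" by (auto simp: inj_on_def e2_def X1_def split: if_splits)
    then show "card (R2 S) = card (smooth_collections (n - m))" unfolding R2_def by (rule card_relabelled)
  qed
  also have "\<dots> = card R1 * card (smooth_collections (n - m))" by simp
  also have "card R1 = card (smooth_collections (m - 1))"
  proof -
    have "inj_on e1 {1..m-1+1}" using m by (auto simp: inj_on_def e1_def)
    then show ?thesis unfolding R1_def by (rule card_relabelled)
  qed
  finally show ?thesis .
qed

lemma card_smooth_collections_rec:
  assumes n: "n \<ge> 1"
  shows "card (smooth_collections n) = card (smooth_collections (n - 1)) +
    (\<Sum>m\<in>{1..n}. card (smooth_collections (m - 1)) * card (smooth_collections (n - m)))"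
proof -
  have fin: "finite (smooth_collections n)" by (simp add: smooth_collections_eq finite_relabelled)
  have "smooth_collections n = (\<Union>m\<in>{1..n+1}. missing n m)"
  proof
    show "smooth_collections n \<subseteq> (\<Union>m\<in>{1..n+1}. missing n m)"
    proof
      fix S assume S: "S \<in> smooth_collections n"
      have "S n \<subseteq> {1..n+1}" "card (S n) = n" "finite (S n)" using smooth_collectionsD(2-4)[OF S, of n] n by auto
      then have "card ({1..n+1} - S n) = 1" by (simp add: card_Diff_subset)
      then obtain m where m: "{1..n+1} - S n = {m}" using card_1_singletonE by blast
      then have "S n = {1..n+1} - {m}" "m \<in> {1..n+1}" using \<open>S n \<subseteq> {1..n+1}\<close> by blast+
      then show "S \<in> (\<Union>m\<in>{1..n+1}. missing n m)" using S by blast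
    qed
  qed auto
  then have "card (smooth_collections n) = card (\<Union>m\<in>{1..n+1}. missing n m)" by simp
  also have "\<dots> = (\<Sum>m\<in>{1..n+1}. card (missing n m))"
  proof (rule card_UN_disjoint)
    show "\<forall>i\<in>{1..n+1}. \<forall>j\<in>{1..n+1}. i \<noteq> j \<longrightarrow> missing n i \<inter> missing n j = {}" by auto
  qed (use fin in auto)
  also have "\<dots> = card (missing n (n + 1)) + (\<Sum>m\<in>{1..n}. card (missing n m))" by simp
  finally show ?thesis using card_missing_top[OF n] card_missing by simp
qed

section \<open>First-return decomposition of Schroeder paths\<close>

abbreviation steps :: "(nat \<times> nat) set"
  where "steps \<equiv> {(1, 0), (0, 1), (1, 1)}"

text \<open>The slack \<open>h\<close> allows for a part of a path already traversed: after an
  initial step \<open>(1, 0)\<close> the rest is tested with \<open>h = 1\<close>.\<close>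

definition below_diagonal :: "nat \<Rightarrow> (nat \<times> nat) list \<Rightarrow> bool"
  where "below_diagonal h p \<longleftrightarrow> (\<forall>m\<le>length p. snd (end_point (take m p)) \<le> fst (end_point (take m p)) + h)"

lemma end_point_append: "end_point (p @ q) = (fst (end_point p) + fst (end_point q), snd (end_point p) + snd (end_point q))"
  by (simp add: end_point_def)

lemma end_point_Cons: "end_point (s # q) = (fst s + fst (end_point q), snd s + snd (end_point q))"
  by (simp add: end_point_def)

lemma end_point_Nil: "end_point [] = (0, 0)"
  by (simp add: end_point_def)

lemma schroeder_paths_iff:
  "p \<in> schroeder_paths n \<longleftrightarrow> set p \<subseteq> steps \<and> end_point p = (n, n) \<and> below_diagonal 0 p"
  by (simp add: schroeder_paths_def below_diagonal_def)

lemma below_diagonal_append: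
  "below_diagonal h (p @ q) \<longleftrightarrow> below_diagonal h p \<and>
    (\<forall>m\<le>length q. snd (end_point p) + snd (end_point (take m q)) \<le> fst (end_point p) + fst (end_point (take m q)) + h)"
proof -
  have "(\<forall>m\<le>length (p @ q). P (take m (p @ q))) \<longleftrightarrow>
      (\<forall>m\<le>length p. P (take m p)) \<and> (\<forall>m\<le>length q. P (p @ take m q))" for P
  proof (intro iffI conjI allI impI)
    fix m assume l: "\<forall>m\<le>length (p @ q). P (take m (p @ q))"
    show "P (take m p)" if "m \<le> length p" using l[rule_format, of m] that by simp
    show "P (p @ take m q)" if "m \<le> length q" using l[rule_format, of "length p + m"] that by simp
  next
    fix m assume "(\<forall>m\<le>length p. P (take m p)) \<and> (\<forall>m\<le>length q. P (p @ take m q))" "m \<le> length (p @ q)"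
    then show "P (take m (p @ q))" by (cases "m \<le> length p") auto
  qed
  from this[of "\<lambda>p. snd (end_point p) \<le> fst (end_point p) + h"] show ?thesis
    by (simp add: below_diagonal_def end_point_append)
qed

lemma below_diagonal_Cons:
  "below_diagonal h (s # q) \<longleftrightarrow>
    (\<forall>m\<le>length q. snd s + snd (end_point (take m q)) \<le> fst s + fst (end_point (take m q)) + h)"
proof -
  have "below_diagonal h ([s] @ q) \<longleftrightarrow> below_diagonal h [s] \<and>
    (\<forall>m\<le>length q. snd s + snd (end_point (take m q)) \<le> fst s + fst (end_point (take m q)) + h)"
    unfolding below_diagonal_append by (simp add: end_point_Cons end_point_Nil)
  moreover have "below_diagonal h [s]"
    if "\<forall>m\<le>length q. snd s + snd (end_point (take m q)) \<le> fst s + fst (end_point (take m q)) + h"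
    using that[rule_format, of 0] by (auto simp: below_diagonal_def le_Suc_eq take_Cons' end_point_Cons end_point_Nil)
  ultimately show ?thesis by auto
qed

text \<open>Cut at the first prefix that exceeds its own diagonal by 1. The prefix before it does
  not exceed the diagonal, so the step in between is vertical and starts on the diagonal.\<close>

lemma first_return:
  assumes q: "set q \<subseteq> steps" "below_diagonal 1 q" "snd (end_point q) = fst (end_point q) + 1"
  shows "\<exists>u v. q = u @ (0, 1) # v \<and> below_diagonal 0 u \<and> snd (end_point u) = fst (end_point u)"
proof -
  let ?R = "\<lambda>m. m \<le> length q \<and> snd (end_point (take m q)) = fst (end_point (take m q)) + 1"
  define m where "m = (LEAST m. ?R m)"
  have Rq: "?R (length q)" using q(3) by simp
  have m: "?R m" unfolding m_def by (rule LeastI[of ?R, OF Rq])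
  have min: "\<not> ?R k" if "k < m" for k using that not_less_Least unfolding m_def by blast
  have "m \<noteq> 0" using m by (cases m) (auto simp: end_point_Nil)
  then obtain k where k: "m = Suc k" by (cases m) auto
  then have kq: "k < length q" using m by simp
  define u where "u = take k q"
  have split: "q = u @ q ! k # drop (Suc k) q" using kq by (simp add: u_def id_take_nth_drop)
  have low: "snd (end_point (take l q)) \<le> fst (end_point (take l q))" if "l \<le> k" for l
    using min[of l] that k kq q(2)[unfolded below_diagonal_def, rule_format, of l] by auto
  have u: "below_diagonal 0 u" using low kq by (auto simp: below_diagonal_def u_def min_def)
  have "take m q = u @ [q ! k]" using kq k by (simp add: u_def take_Suc_conv_app_nth)
  then have "snd (end_point u) + snd (q ! k) = fst (end_point u) + fst (q ! k) + 1"
    using m by (simp add: end_point_append end_point_Cons end_point_Nil)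
  moreover have "snd (end_point u) \<le> fst (end_point u)" using low[of k] by (simp add: u_def)
  moreover have "q ! k \<in> steps" using kq q(1) nth_mem by blast
  ultimately have "q ! k = (0, 1)" "snd (end_point u) = fst (end_point u)" by auto
  then show ?thesis using split u by metis
qed

lemma schroeder_paths_diagonal: "(1, 1) # q \<in> schroeder_paths (Suc n) \<longleftrightarrow> q \<in> schroeder_paths n"
  unfolding schroeder_paths_iff below_diagonal_Cons
  by (auto simp: below_diagonal_def end_point_Cons prod_eq_iff)

text \<open>The path may return to the diagonal earlier than after \<open>u\<close>, hence the slack
  1. That the return after \<open>u\<close> is the first one is expressed by slack 0, which is
  imposed separately in the decomposition.\<close>

lemma schroeder_paths_return:
  assumes "end_point u = (k, k)" "k \<le> n"
  shows "(1, 0) # u @ (0, 1) # v \<in> schroeder_paths (Suc n) \<longleftrightarrow>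
    set u \<subseteq> steps \<and> below_diagonal 1 u \<and> v \<in> schroeder_paths (n - k)"
proof -
  have 1: "below_diagonal 0 ((1, 0) # p) \<longleftrightarrow> below_diagonal 1 p" for p
    unfolding below_diagonal_Cons by (simp add: below_diagonal_def)
  have 2: "below_diagonal 1 (u @ (0, 1) # v) \<longleftrightarrow> below_diagonal 1 u \<and> below_diagonal 0 v"
  proof -
    have "below_diagonal 1 ((u @ [(0, 1)]) @ v) \<longleftrightarrow> below_diagonal 1 (u @ [(0, 1)]) \<and> below_diagonal 0 v"
      unfolding below_diagonal_append[of _ "u @ [(0, 1)]"] using assms
      by (simp add: end_point_append end_point_Cons end_point_Nil below_diagonal_def)
    moreover have "below_diagonal 1 (u @ [(0, 1)]) \<longleftrightarrow> below_diagonal 1 u"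
      unfolding below_diagonal_append using assms
      by (auto simp: end_point_Cons end_point_Nil le_Suc_eq)
    ultimately show ?thesis by simp
  qed
  show ?thesis unfolding schroeder_paths_iff 1 2 using assms
    by (auto simp: end_point_append end_point_Cons prod_eq_iff)
qed

lemma finite_schroeder_paths: "finite (schroeder_paths n)"
proof -
  have "length p \<le> fst (end_point p) + snd (end_point p)" if "set p \<subseteq> steps" for p
    using that by (induction p) (auto simp: end_point_def)
  then have "schroeder_paths n \<subseteq> {p. set p \<subseteq> steps \<and> length p \<le> 2 * n}"
    by (fastforce simp: schroeder_paths_iff)
  then show ?thesis by (rule finite_subset) (simp add: finite_lists_length_le)
qed

text \<open>If \<open>u\<close> were shorter, then \<open>u @ [(0, 1)]\<close>, which ends above the
  diagonal, would be a prefix of \<open>u'\<close>.\<close>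

lemma return_unique:
  assumes "u @ (0, 1) # v = u' @ (0, 1) # v'" "end_point u = (k, k)" "below_diagonal 0 u'"
  shows "length u' \<le> length u"
proof (rule ccontr)
  assume "\<not> ?thesis"
  then have l: "length u < length u'" by simp
  have "take (Suc (length u)) (u' @ (0, 1) # v') = u @ [(0, 1)]" unfolding assms(1)[symmetric] by simp
  then have "take (Suc (length u)) u' = u @ [(0, 1)]" using l by simp
  then show False using assms(2,3) l unfolding below_diagonal_def
    by (auto simp: end_point_append end_point_Cons end_point_Nil dest: spec[of _ "Suc (length u)"])
qed

lemma large_schroeder_0: "large_schroeder 0 = 1"
proof -
  have "p = []" if "p \<in> schroeder_paths 0" for p
    using that by (cases p) (auto simp: schroeder_paths_iff end_point_Cons)
  moreover have "[] \<in> schroeder_paths 0" by (simp add: schroeder_paths_iff end_point_Nil below_diagonal_def)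
  ultimately have "schroeder_paths 0 = {[]}" by auto
  then show ?thesis by (simp add: large_schroeder_def)
qed

lemma large_schroeder_Suc:
  "large_schroeder (Suc n) = large_schroeder n + (\<Sum>k\<le>n. large_schroeder k * large_schroeder (n - k))"
proof -
  define D where "D = (\<lambda>q. (1, 1) # q) ` schroeder_paths n"
  define R where "R k = (\<lambda>(u, v). (1, 0) # u @ (0, 1) # v) ` (schroeder_paths k \<times> schroeder_paths (n - k))" for k
  have mono: "below_diagonal 1 u" if "below_diagonal 0 u" for u using that by (fastforce simp: below_diagonal_def)
  have eq: "schroeder_paths (Suc n) = D \<union> (\<Union>k\<in>{..n}. R k)"
  proof
    show "D \<union> (\<Union>k\<in>{..n}. R k) \<subseteq> schroeder_paths (Suc n)"
    proof (intro Un_least UN_least)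
      show "D \<subseteq> schroeder_paths (Suc n)" unfolding D_def using schroeder_paths_diagonal by auto
      fix k assume k: "k \<in> {..n}"
      show "R k \<subseteq> schroeder_paths (Suc n)"
      proof
        fix p assume "p \<in> R k"
        then obtain u v where p: "p = (1, 0) # u @ (0, 1) # v"
          and uv: "u \<in> schroeder_paths k" "v \<in> schroeder_paths (n - k)" by (auto simp: R_def)
        have u: "set u \<subseteq> steps" "end_point u = (k, k)" "below_diagonal 0 u"
          using uv(1) unfolding schroeder_paths_iff by blast+
        show "p \<in> schroeder_paths (Suc n)"
          unfolding p using schroeder_paths_return[OF u(2)] k u(1) mono[OF u(3)] uv(2) by simp
      qed
    qed
    show "schroeder_paths (Suc n) \<subseteq> D \<union> (\<Union>k\<in>{..n}. R k)"
    proof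
      fix p assume p: "p \<in> schroeder_paths (Suc n)"
      then obtain s q where pq: "p = s # q" by (cases p) (auto simp: schroeder_paths_iff end_point_Nil)
      have "s \<in> steps" "snd s \<le> fst s"
        using p spec[of _ "1::nat"] unfolding pq schroeder_paths_iff below_diagonal_Cons
        by (auto simp: end_point_Nil dest: spec[of _ "0::nat"])
      then consider "s = (1, 1)" | "s = (1, 0)" by auto
      then show "p \<in> D \<union> (\<Union>k\<in>{..n}. R k)"
      proof cases
        case 1
        then show ?thesis using p pq schroeder_paths_diagonal by (auto simp: D_def)
      next
        case 2
        have "set q \<subseteq> steps" "below_diagonal 1 q" "snd (end_point q) = fst (end_point q) + 1"
          using p unfolding pq 2 schroeder_paths_iff below_diagonal_Cons
          by (auto simp: below_diagonal_def end_point_Cons)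
        then obtain u v where uv: "q = u @ (0, 1) # v" "below_diagonal 0 u" "snd (end_point u) = fst (end_point u)"
          using first_return by blast
        define k where "k = fst (end_point u)"
        have uk: "end_point u = (k, k)" using uv(3) by (simp add: k_def prod_eq_iff)
        have kn: "k \<le> n" using p unfolding pq 2 uv(1) schroeder_paths_iff
          by (auto simp: end_point_Cons end_point_append uk)
        have "v \<in> schroeder_paths (n - k)" "set u \<subseteq> steps"
          using p schroeder_paths_return[OF uk kn] unfolding pq 2 uv(1) by auto
        then have "p \<in> R k" using uk uv(2) unfolding pq 2 uv(1) R_def
          by (intro image_eqI[of _ _ "(u, v)"]) (auto simp: schroeder_paths_iff)
        then show ?thesis using kn by auto
      qed
    qed
  qed
  have uniq: "k = k' \<and> u = u' \<and> v = v'"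
    if "u @ (0, 1) # v = u' @ (0, 1) # v'" "u \<in> schroeder_paths k" "u' \<in> schroeder_paths k'" for u v u' v' k k'
  proof -
    have "length u = length u'"
      using return_unique[OF that(1), of k] return_unique[OF that(1)[symmetric], of k'] that(2,3)
      by (simp add: schroeder_paths_iff)
    then have "u = u'" "v = v'" using that(1) by auto
    then show ?thesis using that(2,3) by (auto simp: schroeder_paths_iff)
  qed
  have finR: "finite (R k)" for k by (simp add: R_def finite_schroeder_paths)
  have "card (schroeder_paths (Suc n)) = card D + card (\<Union>k\<in>{..n}. R k)"
    unfolding eq by (rule card_Un_disjoint) (auto simp: D_def R_def finite_schroeder_paths)
  also have "card D = large_schroeder n" by (simp add: D_def card_image large_schroeder_def)
  also have "card (\<Union>k\<in>{..n}. R k) = (\<Sum>k\<le>n. card (R k))"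
  proof (rule card_UN_disjoint)
    show "\<forall>i\<in>{..n}. \<forall>j\<in>{..n}. i \<noteq> j \<longrightarrow> R i \<inter> R j = {}"
    proof (intro ballI impI equals0I)
      fix i j p assume "i \<noteq> j" "p \<in> R i \<inter> R j"
      then have p: "p \<in> R i" "p \<in> R j" by auto
      obtain u v where u: "p = (1, 0) # u @ (0, 1) # v" "u \<in> schroeder_paths i"
        using p(1) by (auto simp: R_def)
      obtain u' v' where u': "p = (1, 0) # u' @ (0, 1) # v'" "u' \<in> schroeder_paths j"
        using p(2) by (auto simp: R_def)
      show False using uniq[of u v u' v' i j] u u' \<open>i \<noteq> j\<close> by simp
    qed
  qed (use finR in auto)
  also have "\<dots> = (\<Sum>k\<le>n. large_schroeder k * large_schroeder (n - k))"
  proof (rule sum.cong[OF refl])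
    fix k
    have "inj_on (\<lambda>(u, v). (1, 0) # u @ (0, 1) # v) (schroeder_paths k \<times> schroeder_paths (n - k))"
    proof (rule inj_onI)
      fix p q assume pq: "p \<in> schroeder_paths k \<times> schroeder_paths (n - k)"
        "q \<in> schroeder_paths k \<times> schroeder_paths (n - k)"
        "(case p of (u, v) \<Rightarrow> (1, 0) # u @ (0, 1) # v) = (case q of (u, v) \<Rightarrow> (1, 0) # u @ (0, 1) # v)"
      obtain u v u' v' where uv: "p = (u, v)" "q = (u', v')" by (metis surj_pair)
      show "p = q" using uniq[of u v u' v' k k] pq unfolding uv by simp
    qed
    then show "card (R k) = large_schroeder k * large_schroeder (n - k)"
      by (simp add: R_def card_image card_cartesian_product large_schroeder_def)
  qed
  finally show ?thesis by (simp add: large_schroeder_def)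
qed

lemma card_smooth_collections: "card (smooth_collections n) = large_schroeder n"
proof (induction n rule: less_induct)
  case (less n)
  show ?case
  proof (cases n)
    case 0
    have "smooth_collections 0 = {\<lambda>_. undefined}" by (auto simp: smooth_collections_eq relabelled_def)
    then show ?thesis using 0 large_schroeder_0 by simp
  next
    case (Suc r)
    have "card (smooth_collections n) = card (smooth_collections r) +
      (\<Sum>m\<in>{1..n}. card (smooth_collections (m - 1)) * card (smooth_collections (n - m)))"
      using card_smooth_collections_rec[of n] Suc by simp
    also have "\<dots> = large_schroeder r + (\<Sum>m\<in>{1..n}. large_schroeder (m - 1) * large_schroeder (n - m))"
    proof -
      have "(\<Sum>m\<in>{1..n}. card (smooth_collections (m - 1)) * card (smooth_collections (n - m))) =
          (\<Sum>m\<in>{1..n}. large_schroeder (m - 1) * large_schroeder (n - m))"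
        using less by (intro sum.cong refl) auto
      then show ?thesis using less Suc by simp
    qed
    also have "(\<Sum>m\<in>{1..n}. large_schroeder (m - 1) * large_schroeder (n - m)) =
        (\<Sum>k\<le>r. large_schroeder k * large_schroeder (r - k))"
      by (rule sum.reindex_bij_witness[of _ Suc "\<lambda>m. m - 1"]) (auto simp: Suc)
    finally show ?thesis using Suc by (simp add: large_schroeder_Suc)
  qed
qed

section \<open>Torus fixed points\<close>

lemma coord_point_apply:
  assumes "index_collection n S" "k \<in> {1..n}"
  shows "coord_point n S k = coord_space (S k)"
  using mem_span_w[OF index_collectionD(3)[OF assms]] assms(2) by (auto simp: coord_point_def)

lemma w_in_coord_space: "w j \<in> coord_space A \<longleftrightarrow> j \<in> A"
  by (auto simp: w_def coord_space_def)

lemma torus_fixed_coord_point: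
  assumes S: "index_collection n S"
  shows "torus_fixed n (coord_point n S)"
  unfolding torus_fixed_def
proof
  fix t assume t: "t \<in> torus n"
  have "torus_act n t (coord_point n S) k = coord_point n S k" for k
  proof (cases "k \<in> {1..n}")
    case True
    define c where "c i = (if i \<le> k then fst t i else snd t (i - 1))" for i
    have c: "c i \<noteq> 0" if "i \<in> {1..n+1}" for i
    proof (cases "i \<le> k")
      case le: True
      then have "i \<in> {1..n}" using that True by auto
      then show ?thesis using t le by (auto simp: c_def torus_def)
    next
      case False
      then have "i - 1 \<in> {1..n}" using that True by auto
      then show ?thesis using t False by (auto simp: c_def torus_def)
    qed
    have "torus_act n t (coord_point n S) k = (\<lambda>v i. c i * v i) ` coord_space (S k)"
      using True by (simp add: torus_act_def coord_point_apply[OF S True] c_def)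
    also have "\<dots> = coord_space (S k)"
    proof
      show "coord_space (S k) \<subseteq> (\<lambda>v i. c i * v i) ` coord_space (S k)"
      proof
        fix u assume u: "u \<in> coord_space (S k)"
        have "c i * (u i / c i) = u i" for i
          using c[of i] u index_collectionD(1)[OF S True] by (cases "i \<in> S k") (auto simp: coord_space_def)
        then show "u \<in> (\<lambda>v i. c i * v i) ` coord_space (S k)"
          using u by (intro image_eqI[of _ _ "\<lambda>i. u i / c i"]) (auto simp: coord_space_def)
      qed
    qed (auto simp: coord_space_def)
    finally show ?thesis using coord_point_apply[OF S True] by simp
  next
    case False
    then show ?thesis by (simp only: torus_act_def coord_point_def restrict_def if_False)
  qed
  then show "torus_act n t (coord_point n S) = coord_point n S" by blast
qed

lemma torus_fixed_imp_coord_point: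
  assumes V: "V \<in> prod_Gr n" and fixed: "torus_fixed n V"
  shows "\<exists>S\<in>{1..n} \<rightarrow>\<^sub>E Pow {1..n+1}. index_collection n S \<and> V = coord_point n S"
proof -
  let ?U = "{1..n+1}"
  have Vk: "cvs.subspace (V k)" "V k \<subseteq> coord_space ?U" "cvs.dim (V k) = k" if "k \<in> {1..n}" for k
    using V that by (auto simp: prod_Gr_def Gr_def W_def dest!: PiE_mem)
  define S where "S = (\<lambda>k\<in>{1..n}. {i\<in>?U. w i \<in> V k})"
  have S: "S k = {i\<in>?U. w i \<in> V k}" if "k \<in> {1..n}" for k using that by (simp add: S_def)
  have w: "w i \<in> V k" if k: "k \<in> {1..n}" and v: "v \<in> V k" "v i \<noteq> 0" and i: "i \<in> ?U" for k v i
  proof -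
    \<comment> \<open>This torus element doubles the coordinate \<open>i\<close> at vertex
      \<open>k\<close> and fixes the others there. Hence the difference of the translate of
      \<open>v\<close> and \<open>v\<close> itself is \<open>v i\<close> times
      \<open>w i\<close>.\<close>
    define t where "t = (\<lambda>j. if i \<le> k \<and> j = i then 2 else 1 :: complex, \<lambda>j. if k < i \<and> j = i - 1 then 2 else 1 :: complex)"
    have "t \<in> torus n" by (auto simp: t_def torus_def)
    then have "torus_act n t V k = V k" using fixed by (simp add: torus_fixed_def)
    then have "(\<lambda>l. (if l \<le> k then fst t l else snd t (l - 1)) * v l) \<in> V k"
      using v(1) k by (auto simp: torus_act_def)
    then have "(\<lambda>l. (if l \<le> k then fst t l else snd t (l - 1)) * v l) - v \<in> V k"
      using v(1) Vk(1)[OF k] cvs.subspace_diff by blast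
    then have "fscale (1 / v i) ((\<lambda>l. (if l \<le> k then fst t l else snd t (l - 1)) * v l) - v) \<in> V k"
      using Vk(1)[OF k] cvs.subspace_scale by blast
    moreover have "fscale (1 / v i) ((\<lambda>l. (if l \<le> k then fst t l else snd t (l - 1)) * v l) - v) = w i"
      using v(2) i by (auto simp: fun_eq_iff fscale_def t_def w_def)
    ultimately show ?thesis by simp
  qed
  have eq: "V k = cvs.span (w ` S k)" if k: "k \<in> {1..n}" for k
  proof
    show "V k \<subseteq> cvs.span (w ` S k)"
    proof
      fix v assume v: "v \<in> V k"
      have "v i = 0" if "i \<notin> S k" for i
        using w[OF k v, of i] Vk(2)[OF k] v that by (cases "i \<in> ?U") (auto simp: S[OF k] coord_space_def)
      then show "v \<in> cvs.span (w ` S k)" using S[OF k] by (simp add: mem_span_w coord_space_def)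
    qed
    show "cvs.span (w ` S k) \<subseteq> V k"
      using Vk(1)[OF k] S[OF k] by (intro cvs.span_minimal) auto
  qed
  have "card (S k) = k" if k: "k \<in> {1..n}" for k
  proof -
    have "w ` S k = graph_basis (S k) (S k) (\<lambda>_ _. 0) ` S k"
      by (intro image_cong) (auto simp: graph_basis_def)
    then have "cvs.dim (cvs.span (w ` S k)) = card (S k)"
      using dim_span_graph_basis[of "S k" "S k"] S[OF k] by simp
    then show ?thesis using Vk(3)[OF k] eq[OF k] by simp
  qed
  then have "index_collection n S" using S by (auto simp: index_collection_def)
  moreover have "V k = coord_point n S k" for k
    using eq V by (cases "k \<in> {1..n}") (auto simp: coord_point_def prod_Gr_def PiE_arb[of V])
  then have "V = coord_point n S" by blast
  moreover have "S \<in> {1..n} \<rightarrow>\<^sub>E Pow ?U" by (auto simp: S_def)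
  ultimately show ?thesis by blast
qed

section \<open>Fixed points on the variety and the smoothness criterion\<close>

lemma coord_point_in_degenerate_flag_variety:
  assumes S: "index_collection n S"
  shows "coord_point n S \<in> degenerate_flag_variety n \<longleftrightarrow> admissible n S"
proof
  assume V: "coord_point n S \<in> degenerate_flag_variety n"
  have "j \<in> S (k + 1)" if k: "1 \<le> k" "k < n" and j: "j \<in> S k" "j \<noteq> k + 1" for k j
  proof -
    have kk: "k \<in> {1..n}" "k + 1 \<in> {1..n}" using k by auto
    have "w j \<in> coord_point n S k" using j(1) by (simp add: coord_point_apply[OF S kk(1)] w_in_coord_space)
    then have "pr (k + 1) (w j) \<in> coord_point n S (k + 1)"
      using V k by (auto simp: degenerate_flag_variety_def)
    moreover have "pr (k + 1) (w j) = w j" using j(2) by (auto simp: pr_def w_def fun_eq_iff)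
    ultimately show ?thesis using w_in_coord_space[of j "S (k + 1)"] coord_point_apply[OF S kk(2)] by simp
  qed
  then show "admissible n S" using S by (auto simp: admissible_def)
next
  assume "admissible n S"
  then interpret admissible_collection n S by unfold_locales
  have "lin e 0 = quad e 0" for e by (cases e) simp
  then have "chart n S 0 \<in> degenerate_flag_variety n" using chart_in_degenerate_flag_variety by blast
  then show "coord_point n S \<in> degenerate_flag_variety n" using chart_zero[OF S] by simp
qed

lemma (in admissible_collection) smooth_point_iff_smoothness_condition:
  "smooth_point n (degenerate_flag_variety n) (coord_point n S) \<longleftrightarrow> smoothness_condition"
proof -
  have le: "local_dim J Z 0 \<le> enat (\<Sum>{1..n})" unfolding Z_def by (rule local_dim_chart_le[OF index])
  have "lin e 0 = quad e 0" for e by (cases e) simp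
  then have Z0: "0 \<in> Z" unfolding Z_iff by (simp add: coord_space_def)
  show ?thesis
  proof (cases smoothness_condition)
    case True
    \<comment> \<open>Here the tangent dimension equals the upper bound for chains, and the graph
      over \<open>free\<close> provides a chain of that length.\<close>
    then have "enat (card free) = local_dim J Z 0"
      using local_dim_ge[OF True] le card_free(1)[OF True] by (metis order.antisym)
    then show ?thesis using True Z0 unfolding smooth_point_iff affine_smooth_point_def dim_tangent_space by simp
  next
    case False
    \<comment> \<open>The tangent dimension exceeds the upper bound that holds at every point, so
      the exact local dimension need not be known.\<close>
    then have "enat (card free) \<noteq> local_dim J Z 0"
      using le card_free(2)[OF False] by (metis enat_ord_simps(1) linorder_not_less)
    then show ?thesis using False unfolding smooth_point_iff affine_smooth_point_def dim_tangent_space by simp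
  qed
qed

theorem theorem1p2:
  fixes n :: nat
  assumes "n \<ge> 1"
  shows "(\<forall>S. admissible n S \<longrightarrow>
            (smooth_point n (degenerate_flag_variety n) (coord_point n S) \<longleftrightarrow>
              (\<forall>i j. 1 \<le> j \<and> j < i \<and> i \<le> n \<longrightarrow> i \<in> S j \<longrightarrow> j + 1 \<in> S i)))
       \<and> card {V \<in> degenerate_flag_variety n.
            torus_fixed n V \<and> smooth_point n (degenerate_flag_variety n) V} = large_schroeder n"
proof
  let ?F = "degenerate_flag_variety n"
  have smooth: "smooth_point n ?F (coord_point n S) \<longleftrightarrow>
      (\<forall>i j. 1 \<le> j \<and> j < i \<and> i \<le> n \<longrightarrow> i \<in> S j \<longrightarrow> j + 1 \<in> S i)" if "admissible n S" for S
  proof -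
    interpret admissible_collection n S using that by unfold_locales
    show ?thesis using smooth_point_iff_smoothness_condition unfolding smoothness_condition_def .
  qed
  then show "\<forall>S. admissible n S \<longrightarrow> (smooth_point n ?F (coord_point n S) \<longleftrightarrow>
      (\<forall>i j. 1 \<le> j \<and> j < i \<and> i \<le> n \<longrightarrow> i \<in> S j \<longrightarrow> j + 1 \<in> S i))" by blast
  have "{V \<in> ?F. torus_fixed n V \<and> smooth_point n ?F V} = coord_point n ` smooth_collections n"
  proof (intro equalityI subsetI)
    fix V assume "V \<in> {V \<in> ?F. torus_fixed n V \<and> smooth_point n ?F V}"
    then have V: "V \<in> ?F" "torus_fixed n V" "smooth_point n ?F V" by auto
    have "V \<in> prod_Gr n" using V(1) by (simp add: degenerate_flag_variety_def)
    then obtain S where S: "S \<in> {1..n} \<rightarrow>\<^sub>E Pow {1..n+1}" "index_collection n S" "V = coord_point n S"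
      using torus_fixed_imp_coord_point V(2) by blast
    then have "admissible n S" using V(1) coord_point_in_degenerate_flag_variety by blast
    then have "S \<in> smooth_collections n" using smooth V(3) S unfolding smooth_collections_def by blast
    then show "V \<in> coord_point n ` smooth_collections n" using S(3) by blast
  next
    fix V assume "V \<in> coord_point n ` smooth_collections n"
    then obtain S where S: "V = coord_point n S" "admissible n S"
      "\<forall>i j. 1 \<le> j \<and> j < i \<and> i \<le> n \<longrightarrow> i \<in> S j \<longrightarrow> j + 1 \<in> S i"
      unfolding smooth_collections_def by blast
    have "index_collection n S" using S(2) by (simp add: admissible_def)
    then show "V \<in> {V \<in> ?F. torus_fixed n V \<and> smooth_point n ?F V}"
      using S smooth coord_point_in_degenerate_flag_variety torus_fixed_coord_point by blast
  qed
  moreover have "inj_on (coord_point n) (smooth_collections n)"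
  proof (rule inj_onI)
    fix S T assume S: "S \<in> smooth_collections n" and T: "T \<in> smooth_collections n"
      and eq: "coord_point n S = coord_point n T"
    have ind: "index_collection n S" "index_collection n T"
      using S T by (auto simp: smooth_collections_def admissible_def)
    have "\<forall>k\<in>{1..n}. T k = S k"
      using chart_eq_coord_point[OF ind, of 0] chart_zero[OF ind(2)] eq by (simp add: coord_space_def)
    then show "S = T"
      using S T by (intro PiE_ext[of S "{1..n}" _ T]) (auto simp: smooth_collections_def)
  qed
  ultimately show "card {V \<in> ?F. torus_fixed n V \<and> smooth_point n ?F V} = large_schroeder n"
    by (simp add: card_image card_smooth_collections)
qed

end
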